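(* Let $3\alpha+2\beta=\pi$, and assume triangle $ABC$ is $N$-tiled by a tile with angles $(\alpha,\beta,\gamma)$ and sides $(a,b,c)$, and that $ABC$ is not similar to the tile. Let $B$ be the vertex of $ABC$ at which just one tile has a vertex (any such vertex, if there are several), let $X$ and $Z$ be the lengths of the two sides of $ABC$ adjacent to $B$, and let $Y$ be the length of the side opposite $B$. Let the tiles be colored black and white so that any two tiles lying on opposite sides of a common interior edge segment have opposite colors and the tile at $B$ is black, and let $M$ be the number of black tiles minus the number of white tiles. Then $$M(a+b+c)=X\pm Y+Z,$$ where the sign is determined by the shape of $ABC$ as follows. If $ABC$ is isosceles with base angles $\alpha$ or with base angles $\beta$, then $$M(a+b+c)=X+Y+Z.$$ If $ABC$ has angles $2\alpha,\alpha,2\beta$, or angles $2\alpha,\beta,\alpha+\beta$, or is isosceles with base angles $\alpha+\beta$, then $$M(a+b+c)=X-Y+Z.$$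
   Context: An $N$-tiling of a triangle $ABC$ by a triangle $T$ (the tile) is a way of writing $ABC$ as a union of $N$ triangles congruent to $T$ (also called tiles; reflections allowed) overlapping only at their boundaries; tiles need not meet edge-to-edge. The sides $a,b,c$ of the tile are opposite its angles $\alpha,\beta,\gamma$ respectively. "Two tiles lie on opposite sides of a common interior edge segment" means that their boundaries share a line segment of positive length. *)

theory Defs
  imports "HOL-Analysis.Analysis" "HOL-Library.Multiset"
begin

definition triangle_region :: "real^2 \<Rightarrow> real^2 \<Rightarrow> real^2 \<Rightarrow> (real^2) set" where
  "triangle_region P Q R = convex hull {P, Q, R}"

text \<open>The unoriented angle in \<open>[0, \<pi>]\<close> at the middle argument \<open>Q\<close>.\<close>

definition angle :: "real^2 \<Rightarrow> real^2 \<Rightarrow> real^2 \<Rightarrow> real" where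
  "angle P Q R = arccos (((P - Q) \<bullet> (R - Q)) / (norm (P - Q) * norm (R - Q)))"

text \<open>A dilation factor \<open>k > 0\<close> gives similarity. Orientation-reversing maps are allowed in both
  notions.\<close>

definition similar :: "(real^2) set \<Rightarrow> (real^2) set \<Rightarrow> bool" where
  "similar S T \<longleftrightarrow>
     (\<exists>f k. k > 0 \<and> (\<forall>x y. dist (f x) (f y) = k * dist x y) \<and> f ` S = T)"

definition congruent_sets :: "(real^2) set \<Rightarrow> (real^2) set \<Rightarrow> bool" where
  "congruent_sets S T \<longleftrightarrow> (\<exists>f. (\<forall>x y. dist (f x) (f y) = dist x y) \<and> f ` S = T)"

text \<open>\<open>\<T>\<close> is the set of tiles of a tiling of the region \<open>\<Delta>\<close> by \<open>N\<close> copies of \<open>T\<close>.\<close>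

definition is_tiling :: "nat \<Rightarrow> (real^2) set set \<Rightarrow> (real^2) set \<Rightarrow> (real^2) set \<Rightarrow> bool" where
  "is_tiling N \<T> T \<Delta> \<longleftrightarrow>
     finite \<T> \<and> card \<T> = N \<and>
     (\<forall>S\<in>\<T>. congruent_sets T S) \<and>
     \<Union>\<T> = \<Delta> \<and>
     (\<forall>S\<in>\<T>. \<forall>S'\<in>\<T>. S \<noteq> S' \<longrightarrow> S \<inter> S' \<subseteq> frontier S \<inter> frontier S')"

text \<open>Two different tiles of a tiling that share a boundary segment automatically lie on opposite
  sides of it, and the relative interior of that segment lies in the interior of the tiled
  triangle.\<close>

definition share_segment :: "(real^2) set \<Rightarrow> (real^2) set \<Rightarrow> bool" where
  "share_segment S S' \<longleftrightarrow>
     (\<exists>x y. x \<noteq> y \<and> closed_segment x y \<subseteq> frontier S \<inter> frontier S')"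

text \<open>The predicate \<open>black\<close> is only relevant on \<open>\<T>\<close>; the tiles not satisfying it are white.\<close>

definition alternating_coloring :: "(real^2) set set \<Rightarrow> ((real^2) set \<Rightarrow> bool) \<Rightarrow> bool" where
  "alternating_coloring \<T> black \<longleftrightarrow>
     (\<forall>S\<in>\<T>. \<forall>S'\<in>\<T>. S \<noteq> S' \<and> share_segment S S' \<longrightarrow> black S \<noteq> black S')"

definition color_excess :: "(real^2) set set \<Rightarrow> ((real^2) set \<Rightarrow> bool) \<Rightarrow> int" where
  "color_excess \<T> black = int (card {S\<in>\<T>. black S}) - int (card {S\<in>\<T>. \<not> black S})"

definition has_angles :: "real^2 \<Rightarrow> real^2 \<Rightarrow> real^2 \<Rightarrow> real multiset \<Rightarrow> bool" where
  "has_angles A B C M \<longleftrightarrow> {#angle B A C, angle A B C, angle A C B#} = M"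

text \<open>Any of the three vertices may be the apex.\<close>

definition isosceles_base_angle :: "real^2 \<Rightarrow> real^2 \<Rightarrow> real^2 \<Rightarrow> real \<Rightarrow> bool" where
  "isosceles_base_angle A B C \<delta> \<longleftrightarrow>
     (dist A B = dist A C \<and> angle A B C = \<delta> \<and> angle A C B = \<delta>) \<or>
     (dist B A = dist B C \<and> angle B A C = \<delta> \<and> angle B C A = \<delta>) \<or>
     (dist C A = dist C B \<and> angle C A B = \<delta> \<and> angle C B A = \<delta>)"

end

theory Submission
  imports Defs "HOL-Number_Theory.Cong" "Jordan_Normal_Form.Char_Poly"
begin

text \<open>Give black tiles the weight \<open>1\<close> and white tiles the weight \<open>-1\<close> and sum the weighted perimeters: interior edge
  segments cancel, and what remains is the boundary of \<open>ABC\<close>, every elementary boundary segment being counted with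
  the sign of the tile at it. Around a boundary vertex the colours of successive tiles alternate, so the sign
  persists through the vertex iff the number of tiles there is odd. It remains to see that this number is odd
  inside the sides of \<open>ABC\<close>, odd at a corner with angle \<open>\<alpha>\<close> or \<open>\<beta>\<close>, and even at a corner with angle
  \<open>2\<alpha>\<close> or \<open>\<alpha> + \<beta>\<close>.

  The relation \<open>3\<alpha> + 2\<beta> = \<pi>\<close> alone gives this parity, unless \<open>\<alpha>\<close> and \<open>\<beta>\<close> satisfy a second linear relation, that is,
  unless both are rational multiples \<open>j \<pi> / n\<close> of \<open>\<pi>\<close>. In that case all edges have directions in \<open>\<pi>/n \<int>\<close>, and a
  Galois conjugation \<open>w \<mapsto> w^k\<close> of the \<open>2n\<close>-th roots of unity, extended to a semilinear map of the plane, carries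
  the tiling to a system of triangles with angles \<open>(kj mod n) \<pi> / n\<close>. When these are again angles of a triangle,
  winding numbers show that the angle sums at the vertices behave as in a tiling. Choosing \<open>k\<close> such that one of
  the angles comes close to \<open>\<pi>/2\<close> or to \<open>\<pi>\<close> bounds the number of such angles at a vertex and excludes the exceptional
  relations. For \<open>\<beta> = 2\<alpha>\<close> and \<open>\<alpha> = \<pi>/4\<close> the conjugations only determine the tile angles at the corners of \<open>ABC\<close>:
  either \<open>ABC\<close> is similar to the tile, or it is a right isosceles triangle and \<open>\<alpha> = \<pi>/4\<close>, which is excluded by
  comparing lengths and areas.\<close>

section \<open>Triangles in the complex plane\<close>

text \<open>The semilinear map is built from a basis of the complex numbers over the rationals. It
  sends each relevant line into a line, but as a function on that line it is only additive: order
  and betweenness may be lost, image triangles may overlap, and images of boundary points may leave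
  the image of \<open>ABC\<close>. What survives is every antisymmetric function of two points that
  is additive along lines for any order of the points, and the signed angle seen from a fixed point
  is set up as such a function. So the winding numbers of the image tiles still add up to that of
  the image of \<open>ABC\<close>. This bounds the conjugated angle sum at a vertex from above,
  while the conjugation determines it modulo \<pi>; with positivity this fixes it on the sides of
  \<open>ABC\<close>. The same cancellation of oriented edge pieces stands in for two topological
  arguments: connectedness of the tiling, when all edges are shown to have directions that are
  multiples of \<pi> / n, and the cyclic order of the tiles at a vertex, since the signs of the two
  boundary pieces there add up to twice the sum of the tile signs.\<close>

lemma three_index [simp]:
  fixes i :: 3
  shows "i + 1 + 1 = i + 2" "i + 1 + 2 = i" "i + 2 + 1 = i" "i + 2 + 2 = i + 1"
    "i + 1 \<noteq> i" "i + 2 \<noteq> i" "i + 1 \<noteq> i + 2" "i \<noteq> i + 1" "i \<noteq> i + 2" "i + 2 \<noteq> i + 1"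
  using exhaust_3[of i] by auto

lemma three_num [simp]: "(4::3) = 1" "(5::3) = 2" "(i::3) + 3 = i" "3 + i = i"
  by simp_all

lemma three_cases: "(j::3) = i \<or> j = i + 1 \<or> j = i + 2"
  using exhaust_3[of i] exhaust_3[of j] by auto

lemma forall_three: "(\<forall>j::3. P j) \<longleftrightarrow> P i \<and> P (i + 1) \<and> P (i + 2)"
  by (metis three_cases)

lemma sum_three:
  fixes f :: "3 \<Rightarrow> 'a::comm_monoid_add"
  shows "sum f UNIV = f i + f (i + 1) + f (i + 2)"
  using exhaust_3[of i] by (auto simp: sum_3 ac_simps)

definition crs :: "complex \<Rightarrow> complex \<Rightarrow> real" where
  "crs u v = Re u * Im v - Im u * Re v"

lemma crs_diff: "crs (u - u') v = crs u v - crs u' v" "crs u (v - v') = crs u v - crs u v'"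
  and crs_minus: "crs (- u) v = - crs u v" "crs u (- v) = - crs u v"
  and crs_scale: "crs (of_real r * u) v = r * crs u v" "crs u (of_real r * v) = r * crs u v"
  by (simp_all add: crs_def algebra_simps)

lemma crs_self [simp]: "crs u u = 0" "crs 0 u = 0" "crs u 0 = 0"
  by (simp_all add: crs_def)

lemma crs_swap: "crs v u = - crs u v"
  by (simp add: crs_def)

text \<open>Twice the signed area of the triangle formed by edge \<open>i\<close> and
  \<open>z\<close>; divided by \<open>side v 1 (v 3)\<close> it is the barycentric coordinate of
  \<open>z\<close> that belongs to the opposite vertex \<open>v (i + 2)\<close>. Indices have type
  \<open>3\<close>, so \<open>i + 1\<close> and \<open>i + 2\<close> are cyclic and \<open>3\<close>
  is the zero.\<close>

definition side :: "(3 \<Rightarrow> complex) \<Rightarrow> 3 \<Rightarrow> complex \<Rightarrow> real" where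
  "side v i z = crs (v (i + 1) - v i) (z - v i)"

definition ccw :: "(3 \<Rightarrow> complex) \<Rightarrow> bool" where
  "ccw v \<longleftrightarrow> side v 1 (v 3) > 0"

definition tri :: "(3 \<Rightarrow> complex) \<Rightarrow> complex set" where
  "tri v = {z. \<forall>i. side v i z \<ge> 0}"

definition otri :: "(3 \<Rightarrow> complex) \<Rightarrow> complex set" where
  "otri v = {z. \<forall>i. side v i z > 0}"

definition oedge :: "(3 \<Rightarrow> complex) \<Rightarrow> 3 \<Rightarrow> complex set" where
  "oedge v i = {z. side v i z = 0 \<and> side v (i + 1) z > 0 \<and> side v (i + 2) z > 0}"

lemma side_opposite: "side v i (v (i + 2)) = side v 1 (v 3)"
  using exhaust_3[of i] by (auto simp: side_def crs_def algebra_simps)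

lemma side_opposite2: "side v (i + 1) (v i) = side v 1 (v 3)" "side v (i + 2) (v (i + 1)) = side v 1 (v 3)"
  using side_opposite[of v "i + 1"] side_opposite[of v "i + 2"] by simp_all

lemma side_vertex [simp]: "side v i (v i) = 0" "side v i (v (i + 1)) = 0" "side v (i + 2) (v i) = 0"
  "side v (i + 1) (v (i + 2)) = 0"
  by (simp_all add: side_def)

lemma ccw_side: "ccw v \<Longrightarrow> side v i (v (i + 2)) > 0"
  by (simp add: ccw_def side_opposite)

lemma side_sum: "side v i z + side v (i + 1) z + side v (i + 2) z = side v 1 (v 3)"
  using exhaust_3[of i] by (auto simp: side_def crs_def algebra_simps)

lemma side_comb: "side v i (of_real (1 - t) * p + of_real t * q) = (1 - t) * side v i p + t * side v i q"
  by (simp add: side_def crs_def algebra_simps)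

lemma side_add: "side v i (z + w) = side v i z + crs (v (i + 1) - v i) w"
  by (simp add: side_def crs_def algebra_simps)

text \<open>Cramer's rule: two independent linear forms on the plane vanish together only at
  0.\<close>

lemma crs_basis_zero:
  assumes "crs u v \<noteq> 0" "crs u w = 0" "crs v w = 0"
  shows "w = 0"
proof -
  have "Re w * crs u v = Re u * crs v w * (-1) + Re v * crs u w"
    "Im w * crs u v = Im v * crs u w - Im u * crs v w"
    by (simp_all add: crs_def algebra_simps)
  then show ?thesis using assms by (simp add: complex_eq_iff)
qed

lemma side_zero_vertex:
  assumes "ccw v" "side v i z = 0" "side v (i + 2) z = 0"
  shows "z = v i"
proof -
  have 1: "crs (v (i + 1) - v i) (z - v i) = 0" using assms(2) by (simp add: side_def)
  have 2: "crs (v (i + 2) - v i) (z - v i) = 0"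
    using assms(3) by (simp add: side_def crs_def algebra_simps)
  have 3: "crs (v (i + 1) - v i) (v (i + 2) - v i) \<noteq> 0"
    using ccw_side[OF assms(1), of i] by (simp add: side_def)
  show ?thesis using crs_basis_zero[OF 3 1 2] by simp
qed

lemma ccw_distinct: "ccw v \<Longrightarrow> v i \<noteq> v (i + 1)" "ccw v \<Longrightarrow> v i \<noteq> v (i + 2)"
  using ccw_side[of v i] ccw_side[of v "i + 2"] by (auto simp: side_def)

lemma ccw_inj: "ccw v \<Longrightarrow> v i = v j \<Longrightarrow> i = j"
  using three_cases[of j i] ccw_distinct[of v i] by auto

text \<open>The cases are distinguished by the vanishing barycentric coordinates: none, exactly one,
  or two, which forces a vertex.\<close>

lemma tri_cases:
  assumes "ccw v" "z \<in> tri v"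
  obtains "z \<in> otri v" | i where "z = v i" | i where "z \<in> oedge v i"
proof (cases "\<exists>i. side v i z = 0")
  case False
  then have "z \<in> otri v" using assms(2) by (auto simp: tri_def otri_def less_le)
  then show thesis by (rule that)
next
  case True
  then obtain i where i: "side v i z = 0" by blast
  have ge: "side v j z \<ge> 0" for j using assms(2) by (simp add: tri_def)
  consider "side v (i + 1) z = 0" | "side v (i + 2) z = 0" | "side v (i + 1) z > 0" "side v (i + 2) z > 0"
    using ge[of "i+1"] ge[of "i+2"] by linarith
  then show thesis
  proof cases
    case 1
    have "z = v (i + 1)" by (rule side_zero_vertex[OF assms(1)]) (use 1 i in simp_all)
    then show ?thesis by (rule that)
  next
    case 2
    have "z = v i" by (rule side_zero_vertex[OF assms(1)]) (use 2 i in simp_all)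
    then show ?thesis by (rule that)
  next
    case 3
    then have "z \<in> oedge v i" using i by (simp add: oedge_def)
    then show ?thesis by (rule that)
  qed
qed

lemma oedge_iff:
  assumes "ccw v"
  shows "z \<in> oedge v i \<longleftrightarrow> (\<exists>t. 0 < t \<and> t < 1 \<and> z = of_real (1 - t) * v i + of_real t * v (i + 1))"
proof
  define D where "D = side v 1 (v 3)"
  have D: "D > 0" using assms by (simp add: ccw_def D_def)
  assume z: "z \<in> oedge v i"
  \<comment> \<open>The barycentric coordinate of \<open>v (i + 1)\<close>. The point
    \<open>?w\<close> with this parameter agrees with \<open>z\<close> in two independent linear
    forms.\<close>
  define t where "t = side v (i + 2) z / D"
  have s: "side v (i + 1) z + side v (i + 2) z = D" using z side_sum[of v i z] by (simp add: oedge_def D_def)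
  have t: "0 < t" "t < 1" using z s D by (auto simp: t_def oedge_def divide_simps)
  let ?w = "of_real (1 - t) * v i + of_real t * v (i + 1)"
  have e: "side v (i + 2) z = t * D" using D by (simp add: t_def)
  have dz: "crs (v (i + 1) - v i) (z - ?w) = 0"
  proof -
    have "side v i ?w = 0" by (simp only: side_comb) simp
    then have "side v i z - side v i ?w = 0" using z by (simp add: oedge_def)
    then show ?thesis by (simp add: side_def crs_def algebra_simps)
  qed
  have dz2: "crs (v i - v (i + 2)) (z - ?w) = 0"
  proof -
    have "side v (i + 2) ?w = t * D" using side_opposite2(2)[of v i] by (simp only: side_comb) (simp add: D_def)
    then have "side v (i + 2) z - side v (i + 2) ?w = 0" using e by simp
    then show ?thesis by (simp add: side_def crs_def algebra_simps)
  qed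
  have nz: "crs (v (i + 1) - v i) (v i - v (i + 2)) \<noteq> 0"
    using ccw_side[OF assms, of i] by (simp add: side_def crs_def algebra_simps)
  have "z = ?w" using crs_basis_zero[OF nz dz dz2] by simp
  then show "\<exists>t. 0 < t \<and> t < 1 \<and> z = of_real (1 - t) * v i + of_real t * v (i + 1)" using t by blast
next
  assume "\<exists>t. 0 < t \<and> t < 1 \<and> z = of_real (1 - t) * v i + of_real t * v (i + 1)"
  then obtain t where t: "0 < t" "t < 1" and z: "z = of_real (1 - t) * v i + of_real t * v (i + 1)" by blast
  have D: "side v 1 (v 3) > 0" using assms by (simp add: ccw_def)
  have "side v i z = 0" unfolding z by (simp only: side_comb) simp
  moreover have "side v (i + 1) z > 0" unfolding z side_comb using side_opposite2[of v i] t D by simp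
  moreover have "side v (i + 2) z > 0" unfolding z side_comb using side_opposite2[of v i] t D by simp
  ultimately show "z \<in> oedge v i" by (simp add: oedge_def)
qed

lemma vertex_in_tri: "ccw v \<Longrightarrow> v i \<in> tri v"
  unfolding tri_def using forall_three[of "\<lambda>j. side v j (v i) \<ge> 0" i] side_opposite2[of v i]
  by (simp add: ccw_def)

lemma otri_subset: "otri v \<subseteq> tri v"
  by (auto simp: tri_def otri_def less_imp_le)

lemma oedge_subset: "oedge v i \<subseteq> tri v"
  unfolding tri_def oedge_def using forall_three[of "\<lambda>j. side v j _ \<ge> 0" i] by auto

section \<open>Winding numbers\<close>

text \<open>The signed angle subtended at \<open>z\<close>, set to \<open>0\<close> when \<open>z\<close> is on the line \<open>PQ\<close>.\<close>

definition subt :: "complex \<Rightarrow> complex \<Rightarrow> complex \<Rightarrow> real" where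
  "subt z P Q = (if crs (P - z) (Q - z) = 0 then 0 else Arg ((Q - z) / (P - z)))"

lemma Im_divide_crs: "Im (q / p) = crs p q / (cmod p)\<^sup>2"
  by (simp add: Im_divide crs_def cmod_power2 algebra_simps)

lemma Arg_pos: "0 < Im z \<Longrightarrow> 0 < Arg z \<and> Arg z < pi"
  using Arg_lt_pi by blast

lemma Arg_neg:
  assumes "Im z < 0" shows "- pi < Arg z \<and> Arg z < 0"
  using assms Arg_bounded[of z] Arg_less_0[of z] by auto

lemma subt_pos: "crs (P - z) (Q - z) > 0 \<Longrightarrow> 0 < subt z P Q \<and> subt z P Q < pi"
  unfolding subt_def by (auto intro!: Arg_pos simp: Im_divide_crs zero_less_divide_iff)

lemma subt_neg: "crs (P - z) (Q - z) < 0 \<Longrightarrow> - pi < subt z P Q \<and> subt z P Q < 0"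
  unfolding subt_def by (auto intro!: Arg_neg simp: Im_divide_crs divide_less_0_iff)

lemma subt_zero: "crs (P - z) (Q - z) = 0 \<Longrightarrow> subt z P Q = 0"
  by (simp add: subt_def)

lemma subt_bounds: "- pi < subt z P Q \<and> subt z P Q < pi"
  using subt_pos[of P z Q] subt_neg[of P z Q] subt_zero[of P z Q] pi_gt_zero by linarith

lemma cis_sub:
  assumes "crs (P - z) (Q - z) \<noteq> 0"
  shows "cis (subt z P Q) = sgn (Q - z) / sgn (P - z)"
proof -
  have "P - z \<noteq> 0" "Q - z \<noteq> 0" using assms by auto
  then have "(Q - z) / (P - z) \<noteq> 0" by simp
  then have "cis (Arg ((Q - z) / (P - z))) = sgn ((Q - z) / (P - z))" by (rule cis_Arg)
  then show ?thesis using assms by (simp add: subt_def sgn_divide)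
qed

lemma cis_eq_1_imp_zero:
  assumes "cis d = 1" "\<bar>d\<bar> < 2 * pi" shows "d = 0"
proof -
  have "cos d = 1" using assms(1) by (metis cis.sel(1) one_complex.sel(1))
  then obtain n :: int where n: "d = real_of_int n * 2 * pi" using cos_one_2pi_int[of d] by auto
  then have "\<bar>real_of_int n\<bar> < 1" using assms(2) by (simp add: abs_mult)
  then show ?thesis using n by simp
qed

lemma cis_eq_m1_imp_pi:
  assumes "cis d = - 1" "0 < d" "d < 3 * pi" shows "d = pi"
proof -
  have "cis (d - pi) = 1" using assms(1) by (simp add: cis_divide[symmetric])
  then show ?thesis using cis_eq_1_imp_zero[of "d - pi"] assms by auto
qed

text \<open>The three angles have the signs of \<open>s * c\<close>, \<open>(t - s) * c\<close> and
  \<open>t * c\<close> with one common \<open>c\<close>, and both sides have the same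
  \<open>cis\<close>; so they differ by a multiple of 2 \<pi> that is smaller than 2 \<pi>. The
  points may come in any order on the line, which is essential for images under maps that do not
  respect order. The value 0 for points seen from their own line makes the equation hold there as
  well.\<close>

lemma subt_add:
  assumes "Q - P = of_real s * d" "R - P = of_real t * d"
  shows "subt z P Q + subt z Q R = subt z P R"
proof -
  define c where "c = crs (P - z) d"
  have Q: "Q = P + of_real s * d" and R: "R = P + of_real t * d" using assms by (auto simp: algebra_simps)
  have 1: "crs (P - z) (Q - z) = s * c" by (simp add: Q c_def crs_def algebra_simps)
  have 2: "crs (Q - z) (R - z) = (t - s) * c" by (simp add: Q R c_def crs_def algebra_simps)
  have 3: "crs (P - z) (R - z) = t * c" by (simp add: R c_def crs_def algebra_simps)
  show ?thesis
  proof (cases "c = 0")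
    case True
    then show ?thesis using 1 2 3 by (simp add: subt_def)
  next
    case c: False
    have nz: "P - z \<noteq> 0" "Q - z \<noteq> 0" "R - z \<noteq> 0"
    proof -
      have "crs (P - z) d = c" "crs (Q - z) d = c" "crs (R - z) d = c"
        by (simp_all add: Q R c_def crs_def algebra_simps)
      then show "P - z \<noteq> 0" "Q - z \<noteq> 0" "R - z \<noteq> 0" using c by auto
    qed
    consider "s = 0" | "t = s" | "t = 0" | "s \<noteq> 0" "t \<noteq> s" "t \<noteq> 0" by blast
    then show ?thesis
    proof cases
      case 1
      then have "Q = P" by (simp add: Q)
      then show ?thesis using subt_zero[of P z P] by simp
    next
      case 2
      then have "Q = R" by (simp add: Q R)
      then show ?thesis using subt_zero[of R z R] by simp
    next
      case 3
      then have RP: "R = P" by (simp add: R)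
      show ?thesis
      proof (cases "s = 0")
        case True
        then show ?thesis using RP Q subt_zero[of P z P] by simp
      next
        case False
        let ?d = "subt z P Q + subt z Q P"
        have "cis ?d = cis (subt z P Q) * cis (subt z Q P)" by (simp add: cis_mult)
        also have "\<dots> = 1" using cis_sub[of P z Q] cis_sub[of Q z P] 1 2 3 c False nz RP
          by (simp add: sgn_zero_iff)
        finally have e: "cis ?d = 1" .
        have "\<bar>?d\<bar> < 2 * pi" using subt_bounds[of z P Q] subt_bounds[of z Q P] by linarith
        then have "?d = 0" using cis_eq_1_imp_zero[OF e] by simp
        then show ?thesis using RP subt_zero[of P z P] by simp
      qed
    next
      case 4
      let ?x = "subt z P Q" and ?y = "subt z Q R" and ?w = "subt z P R"
      have e: "cis (?x + ?y - ?w) = 1"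
        using cis_sub[of P z Q] cis_sub[of Q z R] cis_sub[of P z R] 1 2 3 c 4 nz
        by (simp add: cis_mult[symmetric] cis_divide[symmetric] sgn_zero_iff)
      have b: "\<bar>?x\<bar> < pi" "\<bar>?y\<bar> < pi" "\<bar>?w\<bar> < pi"
        using subt_bounds[of z P Q] subt_bounds[of z Q R] subt_bounds[of z P R] by linarith+
      have pieces: "subt z p q > 0 \<longleftrightarrow> crs (p - z) (q - z) > 0" "subt z p q < 0 \<longleftrightarrow> crs (p - z) (q - z) < 0" for p q
        using subt_pos[of p z q] subt_neg[of p z q] subt_zero[of p z q] by linarith+
      \<comment> \<open>Only equal signs of \<open>?x\<close> and \<open>?y\<close> are dangerous;
        then \<open>?w\<close> has this sign too and compensates part of the sum.\<close>
      have "\<bar>?x + ?y - ?w\<bar> < 2 * pi"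
      proof (cases "?x * ?y \<le> 0")
        case True
        then have "\<bar>?x + ?y\<bar> < pi" using b by (auto simp: mult_le_0_iff)
        then show ?thesis using b by linarith
      next
        case False
        then consider "?x > 0" "?y > 0" | "?x < 0" "?y < 0" by (auto simp: not_le zero_less_mult_iff)
        then show ?thesis
        proof cases
          case p: 1
          then have "s * c > 0" "(t - s) * c > 0" using pieces 1 2 by auto
          then have "t * c > 0" by (simp add: algebra_simps)
          then have "?w > 0" using pieces 3 by auto
          then show ?thesis using p b by linarith
        next
          case p: 2
          then have "s * c < 0" "(t - s) * c < 0" using pieces 1 2 by auto
          then have "t * c < 0" by (simp add: algebra_simps)
          then have "?w < 0" using pieces 3 by auto
          then show ?thesis using p b by linarith
        qed
      qed
      then show ?thesis using cis_eq_1_imp_zero[OF e] by simp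
    qed
  qed
qed

lemma subt_swap: "subt z Q P = - subt z P Q"
  using subt_add[of Q P 1 "Q - P" P 0 z] subt_zero[of P z P] by simp

definition ang :: "(3 \<Rightarrow> complex) \<Rightarrow> 3 \<Rightarrow> real" where
  "ang v i = Arg ((v (i + 2) - v i) / (v (i + 1) - v i))"

text \<open>For a counterclockwise triangle this is the angle which it occupies at \<open>z\<close>:
  2 \<pi> inside, \<pi> on an open edge, the interior angle at a vertex, 0 outside. Angles at a
  point can thus be added up without describing how the tiles are arranged around it.\<close>

definition wind :: "complex \<Rightarrow> (3 \<Rightarrow> complex) \<Rightarrow> real" where
  "wind z v = (\<Sum>i\<in>UNIV. subt z (v i) (v (i + 1)))"

lemma crs_side: "crs (v i - z) (v (i + 1) - z) = side v i z"
  by (simp add: side_def crs_def algebra_simps)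

lemma crs_side': "crs (v (i + 1) - z) (v (i + 2) - z) = side v (i + 1) z"
  "crs (v (i + 2) - z) (v i - z) = side v (i + 2) z"
  using crs_side[of v "i + 1" z] crs_side[of v "i + 2" z] by simp_all

lemma wind_three: "wind z v = subt z (v i) (v (i + 1)) + subt z (v (i + 1)) (v (i + 2)) + subt z (v (i + 2)) (v i)"
  unfolding wind_def by (subst sum_three[of _ i]) simp

lemma ang_bounds:
  assumes "ccw v" shows "0 < ang v i" "ang v i < pi"
proof -
  have "0 < Im ((v (i + 2) - v i) / (v (i + 1) - v i))"
    using ccw_side[OF assms, of i] ccw_distinct[OF assms, of i]
    by (auto simp: Im_divide_crs side_def zero_less_divide_iff)
  then show "0 < ang v i" "ang v i < pi" using Arg_pos by (auto simp: ang_def)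
qed

lemma wind_vertex:
  assumes "ccw v" shows "wind (v i) v = ang v i"
proof -
  have "subt (v i) (v (i + 1)) (v (i + 2)) = ang v i"
    using ccw_side[OF assms, of i] by (simp add: subt_def ang_def side_def)
  then show ?thesis by (simp add: wind_three[of _ _ i] subt_def)
qed

lemma wind_otri:
  assumes "z \<in> otri v" shows "wind z v = 2 * pi"
proof -
  let ?i = "1 :: 3"
  have p: "0 < side v i z" for i using assms by (simp add: otri_def)
  have b: "0 < subt z (v i) (v (i + 1)) \<and> subt z (v i) (v (i + 1)) < pi" for i
    using subt_pos[of "v i" z "v (i + 1)"] p[of i] by (simp add: crs_side)
  have nz: "v i - z \<noteq> 0" for i using p[of i] by (auto simp: side_def crs_def algebra_simps)
  have c: "cis (subt z (v i) (v (i + 1))) = sgn (v (i + 1) - z) / sgn (v i - z)" for i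
    using cis_sub[of "v i" z "v (i + 1)"] p[of i] by (simp add: crs_side)
  have "cis (wind z v) = 1"
    unfolding wind_three[of z v ?i] using c[of ?i] c[of "?i + 1"] c[of "?i + 2"] nz
    by (simp add: cis_mult[symmetric] sgn_zero_iff)
  then have e: "cis (wind z v - 2 * pi) = 1" by (simp add: cis_divide[symmetric])
  have "\<bar>wind z v - 2 * pi\<bar> < 2 * pi"
    using b[of ?i] b[of "?i + 1"] b[of "?i + 2"] by (simp add: wind_three[of z v ?i] abs_less_iff)
  then show ?thesis using cis_eq_1_imp_zero[OF e] by simp
qed

lemma wind_oedge:
  assumes "ccw v" "z \<in> oedge v i" shows "wind z v = pi"
proof -
  have p: "side v i z = 0" "0 < side v (i + 1) z" "0 < side v (i + 2) z" using assms(2) by (auto simp: oedge_def)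
  obtain t where t: "0 < t" "t < 1" and z: "z = of_real (1 - t) * v i + of_real t * v (i + 1)"
    using assms oedge_iff by blast
  let ?d = "v (i + 1) - v i"
  have d: "?d \<noteq> 0" using ccw_distinct[OF assms(1), of i] by simp
  have 1: "v i - z = - of_real t * ?d" "v (i + 1) - z = of_real (1 - t) * ?d" by (simp_all add: z algebra_simps)
  have s: "sgn (v i - z) = - sgn ?d" "sgn (v (i + 1) - z) = sgn ?d"
    unfolding 1 sgn_mult using t sgn_of_real[of t, where 'a = complex]
      sgn_of_real[of "1 - t", where 'a = complex] by simp_all
  have nz: "v (i + 2) - z \<noteq> 0" using p by (auto simp: side_def)
  have w: "wind z v = subt z (v (i + 1)) (v (i + 2)) + subt z (v (i + 2)) (v i)"
    using subt_zero[of "v i" z "v (i + 1)"] p by (simp add: wind_three[of z v i] crs_side)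
  have "cis (wind z v) = sgn (v (i + 2) - z) / sgn (v (i + 1) - z) * (sgn (v i - z) / sgn (v (i + 2) - z))"
    unfolding w using cis_sub[of "v (i + 1)" z "v (i + 2)"] cis_sub[of "v (i + 2)" z "v i"] p
    by (simp add: cis_mult[symmetric] crs_side')
  also have "\<dots> = - 1" using nz d unfolding s by (simp add: sgn_zero_iff)
  finally have e: "cis (wind z v) = - 1" .
  show ?thesis
    using cis_eq_m1_imp_pi[OF e] w subt_pos[of "v (i + 1)" z "v (i + 2)"] subt_pos[of "v (i + 2)" z "v i"] p
    by (auto simp: crs_side')
qed

text \<open>One barycentric coordinate is negative and another one positive, so two of the three
  subtended angles have opposite signs. This keeps the sum below 2 \<pi> in absolute value, and in
  the generic case it is a multiple of 2 \<pi>.\<close>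

lemma wind_outside:
  assumes "ccw v" "z \<notin> tri v" shows "wind z v = 0"
proof -
  obtain i where i: "side v i z < 0" using assms(2) by (auto simp: tri_def not_le)
  have D: "side v i z + side v (i + 1) z + side v (i + 2) z > 0"
    using side_sum[of v i z] assms(1) by (simp add: ccw_def)
  have main: "wind z v = 0" if neg: "side v i z < 0" and pos: "side v j z > 0" and j: "j \<noteq> i"
    and k: "k \<noteq> i" "k \<noteq> j" for i j k
  proof -
    have W: "wind z v = subt z (v i) (v (i + 1)) + subt z (v j) (v (j + 1)) + subt z (v k) (v (k + 1))"
    proof -
      have "j = i + 1 \<and> k = i + 2 \<or> j = i + 2 \<and> k = i + 1"
        using j k three_cases[of j i] three_cases[of k i] by auto
      then show ?thesis by (auto simp: wind_three[of z v i])
    qed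
    have a: "- pi < subt z (v i) (v (i + 1)) \<and> subt z (v i) (v (i + 1)) < 0"
      using subt_neg[of "v i" z "v (i + 1)"] neg by (simp add: crs_side)
    have b: "0 < subt z (v j) (v (j + 1)) \<and> subt z (v j) (v (j + 1)) < pi"
      using subt_pos[of "v j" z "v (j + 1)"] pos by (simp add: crs_side)
    have bd: "\<bar>wind z v\<bar> < 2 * pi"
      using W a b subt_bounds[of z "v k" "v (k + 1)"] by linarith
    have nz: "v l - z \<noteq> 0" for l
    proof
      assume "v l - z = 0"
      then have z: "z = v l" by simp
      have "side v m z \<ge> 0" for m using vertex_in_tri[OF assms(1), of l] z by (auto simp: tri_def)
      then show False using neg by (meson not_le)
    qed
    have c: "cis (subt z (v l) (v (l + 1))) = sgn (v (l + 1) - z) / sgn (v l - z)" if "side v l z \<noteq> 0" for l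
      using cis_sub[of "v l" z "v (l + 1)"] that by (simp add: crs_side)
    show ?thesis
    proof (cases "side v k z = 0")
      case False
      have nz0: "side v l z \<noteq> 0" for l
        using False neg pos j k three_cases[of j i] three_cases[of k i] three_cases[of l i] by auto
      have "cis (wind z v) = 1"
        unfolding wind_three[of z v i] using c[of i] c[of "i + 1"] c[of "i + 2"] nz nz0
        by (simp add: cis_mult[symmetric] sgn_zero_iff)
      then show ?thesis using cis_eq_1_imp_zero bd by blast
    next
      \<comment> \<open>Here \<open>z\<close> lies on the prolongation of edge \<open>k\<close>,
        which contributes 0. The other two angles add up to a multiple of \<pi> of absolute value
        below \<pi>.\<close>
      case k0: True
      have Wk: "wind z v = subt z (v (k + 1)) (v (k + 2)) + subt z (v (k + 2)) (v k)"
        using subt_zero[of "v k" z "v (k + 1)"] k0 by (simp add: wind_three[of z v k] crs_side)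
      have ij: "i = k + 1 \<or> i = k + 2" using k three_cases[of i k] by auto
      have jj: "j = k + 1 \<or> j = k + 2" using k three_cases[of j k] by auto
      have nzk: "side v (k + 1) z \<noteq> 0" "side v (k + 2) z \<noteq> 0" using ij jj j neg pos by auto
      have e: "cis (wind z v) = sgn (v k - z) / sgn (v (k + 1) - z)"
        unfolding Wk using c[of "k + 1"] c[of "k + 2"] nz nzk
        by (simp add: cis_mult[symmetric] sgn_zero_iff)
      have "Im ((v k - z) / (v (k + 1) - z)) = 0"
        using k0 crs_side[of v k z] crs_swap[of "v k - z" "v (k + 1) - z"] by (simp add: Im_divide_crs)
      then have "Im (sgn ((v k - z) / (v (k + 1) - z))) = 0" by (simp only: Im_sgn div_0)
      then have s: "sin (wind z v) = 0" using e by (simp add: sgn_divide complex_eq_iff)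
      have "\<bar>wind z v\<bar> < pi" using a b W k0 subt_zero[of "v k" z "v (k + 1)"] by (simp add: crs_side abs_less_iff)
      then show ?thesis using sin_eq_0_pi[OF _ _ s] by (simp add: abs_less_iff)
    qed
  qed
  from D i have "side v (i + 1) z > 0 \<or> side v (i + 2) z > 0" by linarith
  then show ?thesis using main[of i "i + 1" "i + 2"] main[of i "i + 2" "i + 1"] i by auto
qed

lemma wind_nonneg:
  assumes "ccw v" shows "wind z v \<ge> 0" "wind z v \<le> 2 * pi"
proof -
  have "0 \<le> wind z v \<and> wind z v \<le> 2 * pi"
  proof (cases "z \<in> tri v")
    case True
    from assms True show ?thesis
      proof (rule tri_cases)
      fix i assume "z = v i"
      then show ?thesis using wind_vertex[OF assms, of i] ang_bounds[OF assms, of i] by simp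
    next
      fix i assume "z \<in> oedge v i"
      then show ?thesis using wind_oedge[OF assms] by simp
    qed (simp add: wind_otri)
  qed (simp add: wind_outside[OF assms])
  then show "wind z v \<ge> 0" "wind z v \<le> 2 * pi" by auto
qed

text \<open>Meant for points known only to lie on the line of an edge: the conjugated image of a
  point of a side may fall outside the image segment.\<close>

lemma wind_line:
  assumes "ccw v" "side v i z = 0" shows "wind z v \<le> pi"
proof (cases "z \<in> tri v")
  case True
  from assms(1) True show ?thesis
  proof (rule tri_cases)
    assume "z \<in> otri v"
    then show ?thesis using assms(2) by (simp add: otri_def less_le)
  next
    fix i assume "z = v i"
    then show ?thesis using wind_vertex[OF assms(1), of i] ang_bounds[OF assms(1), of i] by simp
  next
    fix i assume "z \<in> oedge v i"
    then show ?thesis using wind_oedge[OF assms(1)] by simp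
  qed
qed (simp add: wind_outside[OF assms(1)])

text \<open>From a vertex only the opposite edge subtends a nonzero angle, whose sign is the
  orientation. This is how the image of the big triangle will be recognised as positively
  oriented.\<close>

lemma wind_vertex_pos_imp_ccw:
  assumes "wind (v i) v > 0" shows "ccw v"
proof -
  have "wind (v i) v = subt (v i) (v (i + 1)) (v (i + 2))" by (simp add: wind_three[of _ _ i] subt_def)
  then have "crs (v (i + 1) - v i) (v (i + 2) - v i) > 0"
    using assms subt_neg[of "v (i + 1)" "v i" "v (i + 2)"] subt_zero[of "v (i + 1)" "v i" "v (i + 2)"] by linarith
  then show ?thesis using side_opposite[of v i] by (simp add: ccw_def side_def)
qed

lemma cis_ang:
  assumes "ccw v" shows "cis (ang v i) = sgn (v (i + 2) - v i) / sgn (v (i + 1) - v i)"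
  unfolding ang_def using ccw_distinct[OF assms, of i]
  by (subst cis_Arg) (auto simp: sgn_divide)

text \<open>The quotients of unit edge vectors at the three corners multiply to -1, and the sum lies
  between 0 and 3 \<pi>.\<close>

lemma ang_sum:
  assumes "ccw v" shows "(\<Sum>i\<in>UNIV. ang v i) = pi"
proof -
  let ?i = "1 :: 3"
  have S: "(\<Sum>i\<in>UNIV. ang v i) = ang v ?i + ang v (?i + 1) + ang v (?i + 2)" by (rule sum_three)
  let ?a = "sgn (v (?i + 1) - v ?i)" and ?b = "sgn (v (?i + 2) - v (?i + 1))" and ?c = "sgn (v ?i - v (?i + 2))"
  have nz: "?a \<noteq> 0" "?b \<noteq> 0" "?c \<noteq> 0"
    using ccw_distinct[OF assms, of ?i] ccw_distinct[OF assms, of "?i + 1"] by (auto simp: sgn_zero_iff)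
  have m: "sgn (p - q) = - sgn (q - p)" for p q :: complex by (metis minus_diff_eq sgn_minus)
  have "cis (ang v ?i + ang v (?i + 1) + ang v (?i + 2)) =
    sgn (v (?i + 2) - v ?i) / ?a * (sgn (v ?i - v (?i + 1)) / ?b) * (sgn (v (?i + 1) - v (?i + 2)) / ?c)"
    using cis_ang[OF assms, of ?i] cis_ang[OF assms, of "?i + 1"] cis_ang[OF assms, of "?i + 2"]
    by (simp add: cis_mult[symmetric])
  also have "\<dots> = - ?c / ?a * (- ?a / ?b) * (- ?b / ?c)"
    using m[of "v (?i + 2)" "v ?i"] m[of "v ?i" "v (?i + 1)"] m[of "v (?i + 1)" "v (?i + 2)"] by simp
  also have "\<dots> = - 1" using nz by (simp add: field_simps)
  finally have e: "cis (ang v ?i + ang v (?i + 1) + ang v (?i + 2)) = - 1" .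
  show ?thesis unfolding S
    by (rule cis_eq_m1_imp_pi[OF e])
      (use ang_bounds[OF assms, of ?i] ang_bounds[OF assms, of "?i + 1"] ang_bounds[OF assms, of "?i + 2"] in linarith)+
qed

section \<open>Subdivided segments\<close>

definition open_seg :: "complex \<Rightarrow> complex \<Rightarrow> complex set" where
  "open_seg P Q = {z. \<exists>t. 0 < t \<and> t < 1 \<and> z = P + of_real t * (Q - P)}"

text \<open>The points of \<open>S\<close> cut the segment \<open>PQ\<close> into the \<open>pieces S P Q\<close>, oriented from \<open>P\<close> to \<open>Q\<close>.\<close>

definition piece :: "complex set \<Rightarrow> complex \<Rightarrow> complex \<Rightarrow> bool" where
  "piece S u v \<longleftrightarrow> u \<in> S \<and> v \<in> S \<and> u \<noteq> v \<and> S \<inter> open_seg u v = {}"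

definition pieces :: "complex set \<Rightarrow> complex \<Rightarrow> complex \<Rightarrow> (complex \<times> complex) set" where
  "pieces S P Q = {(u, v). piece S u v \<and>
     (\<exists>s t. 0 \<le> s \<and> s < t \<and> t \<le> 1 \<and> u = P + of_real s * (Q - P) \<and> v = P + of_real t * (Q - P))}"

lemma open_seg_sym: "open_seg P Q = open_seg Q P"
proof -
  have "open_seg P Q \<subseteq> open_seg Q P" for P Q
  proof
    fix z assume "z \<in> open_seg P Q"
    then obtain t where "0 < t" "t < 1" "z = P + of_real t * (Q - P)" by (auto simp: open_seg_def)
    then have "0 < 1 - t \<and> 1 - t < 1 \<and> z = Q + of_real (1 - t) * (P - Q)" by (simp add: algebra_simps)
    then show "z \<in> open_seg Q P" unfolding open_seg_def by blast
  qed
  then show ?thesis by blast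
qed

lemma piece_sym: "piece S u v \<longleftrightarrow> piece S v u"
  by (auto simp: piece_def open_seg_sym)

lemma param_inj: "P \<noteq> Q \<Longrightarrow> P + of_real s * (Q - P) = P + of_real t * (Q - P) \<longleftrightarrow> s = (t :: real)" for P Q :: complex
  by auto

lemma open_seg_sub:
  assumes "0 \<le> s" "s < t" "t \<le> 1"
    "z \<in> open_seg (P + of_real s * (Q - P)) (P + of_real t * (Q - P))"
  obtains r where "s < r" "r < t" "z = P + of_real r * (Q - P)"
proof -
  obtain x where x: "0 < x" "x < 1"
    "z = P + of_real s * (Q - P) + of_real x * ((P + of_real t * (Q - P)) - (P + of_real s * (Q - P)))"
    using assms(4) by (auto simp: open_seg_def)
  have "z = P + of_real (s + x * (t - s)) * (Q - P)" unfolding x(3) by (simp add: algebra_simps)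
  moreover have "s < s + x * (t - s)" using x assms by simp
  moreover have "s + x * (t - s) < t"
  proof -
    have "x * (t - s) < 1 * (t - s)" using x assms by (intro mult_strict_right_mono) auto
    then show ?thesis by simp
  qed
  ultimately show thesis using that by blast
qed

lemma open_seg_subI:
  assumes "s < r" "r < (t :: real)"
  shows "P + of_real r * (Q - P) \<in> open_seg (P + of_real s * (Q - P)) (P + of_real t * (Q - P))"
proof -
  define x where "x = (r - s) / (t - s)"
  have x: "0 < x" "x < 1" "x * (t - s) = r - s" using assms by (auto simp: x_def field_simps)
  have "P + of_real r * (Q - P) = P + of_real s * (Q - P) + of_real (x * (t - s)) * (Q - P)"
    unfolding x by (simp add: algebra_simps)
  also have "\<dots> = P + of_real s * (Q - P) + of_real x * ((P + of_real t * (Q - P)) - (P + of_real s * (Q - P)))"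
    by (simp add: algebra_simps)
  finally show ?thesis unfolding open_seg_def using x by blast
qed

lemma pieces_subset_left:
  assumes "R = P + of_real r * (Q - P)" "0 < r" "r < 1"
  shows "pieces S P R \<subseteq> pieces S P Q"
proof
  fix e assume "e \<in> pieces S P R"
  then obtain u v s t where e: "e = (u, v)" "piece S u v" "0 \<le> s" "s < t" "t \<le> 1"
    "u = P + of_real s * (R - P)" "v = P + of_real t * (R - P)" by (auto simp: pieces_def)
  have "u = P + of_real (s * r) * (Q - P)" "v = P + of_real (t * r) * (Q - P)"
    using e assms(1) by (simp_all add: algebra_simps)
  moreover have "0 \<le> s * r" "s * r < t * r" "t * r \<le> 1" using e assms mult_mono[of t 1 r 1] by auto
  ultimately show "e \<in> pieces S P Q" unfolding pieces_def using e(1,2) by blast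
qed

lemma pieces_subset_right:
  assumes "R = P + of_real r * (Q - P)" "0 < r" "r < 1"
  shows "pieces S R Q \<subseteq> pieces S P Q"
proof
  fix e assume "e \<in> pieces S R Q"
  then obtain u v s t where e: "e = (u, v)" "piece S u v" "0 \<le> s" "s < t" "t \<le> 1"
    "u = R + of_real s * (Q - R)" "v = R + of_real t * (Q - R)" by (auto simp: pieces_def)
  have "u = P + of_real (r + s * (1 - r)) * (Q - P)" "v = P + of_real (r + t * (1 - r)) * (Q - P)"
    using e assms(1) by (simp_all add: algebra_simps)
  moreover have "0 \<le> r + s * (1 - r)" "r + s * (1 - r) < r + t * (1 - r)" using e assms by auto
  moreover have "r + t * (1 - r) \<le> 1"
  proof -
    have "t * (1 - r) \<le> 1 * (1 - r)" using e(5) assms(3) by (intro mult_right_mono) auto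
    then show ?thesis by simp
  qed
  ultimately show "e \<in> pieces S P Q" unfolding pieces_def using e(1,2) by blast
qed

lemma pieces_split:
  assumes "P \<noteq> Q" "R \<in> S" "R \<in> open_seg P Q"
  shows "pieces S P Q = pieces S P R \<union> pieces S R Q" "pieces S P R \<inter> pieces S R Q = {}"
proof -
  obtain r where r: "0 < r" "r < 1" "R = P + of_real r * (Q - P)" using assms(3) by (auto simp: open_seg_def)
  have "pieces S P Q \<subseteq> pieces S P R \<union> pieces S R Q"
  proof
    fix e assume "e \<in> pieces S P Q"
    then obtain u v s t where e: "e = (u, v)" "piece S u v" "0 \<le> s" "s < t" "t \<le> 1"
      "u = P + of_real s * (Q - P)" "v = P + of_real t * (Q - P)" by (auto simp: pieces_def)
    have "\<not> (s < r \<and> r < t)"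
    proof
      assume "s < r \<and> r < t"
      then have "R \<in> open_seg u v" unfolding e(6,7) r(3) by (intro open_seg_subI) auto
      then show False using e(2) assms(2) by (auto simp: piece_def)
    qed
    then consider "t \<le> r" | "r \<le> s" by linarith
    then show "e \<in> pieces S P R \<union> pieces S R Q"
    proof cases
      case 1
      have "u = P + of_real (s / r) * (R - P)" "v = P + of_real (t / r) * (R - P)"
        unfolding e(6,7) r(3) using r(1) by simp_all
      moreover have "0 \<le> s / r" "s / r < t / r" "t / r \<le> 1" using e r 1 by (auto simp: divide_simps)
      ultimately show ?thesis unfolding pieces_def using e(1,2) by blast
    next
      case 2
      let ?s = "(s - r) / (1 - r)" and ?t = "(t - r) / (1 - r)"
      have c: "of_real (1 - r) * (Q - P) = Q - R" using r by (simp add: algebra_simps)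
      have "?s * (1 - r) = s - r" "?t * (1 - r) = t - r" using r by simp_all
      then have "u = R + of_real (?s * (1 - r)) * (Q - P)" "v = R + of_real (?t * (1 - r)) * (Q - P)"
        using e r by (simp_all only:) (simp_all add: algebra_simps)
      then have "u = R + of_real ?s * (Q - R)" "v = R + of_real ?t * (Q - R)"
        unfolding c[symmetric] by (simp_all only: of_real_mult mult.assoc)
      moreover have "0 \<le> ?s" "?s < ?t" "?t \<le> 1" using e r 2 by (auto simp: divide_simps)
      ultimately show ?thesis unfolding pieces_def using e(1,2) by blast
    qed
  qed
  then show "pieces S P Q = pieces S P R \<union> pieces S R Q"
    using pieces_subset_left[OF r(3,1,2)] pieces_subset_right[OF r(3,1,2)] by blast
  show "pieces S P R \<inter> pieces S R Q = {}"
  proof (rule ccontr)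
    assume "pieces S P R \<inter> pieces S R Q \<noteq> {}"
    then obtain u v where uv: "(u, v) \<in> pieces S P R" "(u, v) \<in> pieces S R Q" by auto
    obtain s t where e: "0 \<le> s" "s < t" "t \<le> 1" "v = P + of_real t * (R - P)"
      using uv(1) unfolding pieces_def by blast
    obtain s' t' where e': "0 \<le> s'" "s' < t'" "t' \<le> 1" "v = R + of_real t' * (Q - R)"
      using uv(2) unfolding pieces_def by blast
    have "v = P + of_real (t * r) * (Q - P)" using e(4) r(3) by simp
    moreover have "v = P + of_real (r + t' * (1 - r)) * (Q - P)" by (simp add: e'(4) r(3) algebra_simps)
    ultimately have "t * r = r + t' * (1 - r)" using param_inj[OF assms(1)] by metis
    moreover have "t * r \<le> r" using e r by auto
    moreover have "t' * (1 - r) > 0" using e' r by auto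
    ultimately show False by linarith
  qed
qed

lemma pieces_base:
  assumes "P \<in> S" "Q \<in> S" "P \<noteq> Q" "S \<inter> open_seg P Q = {}"
  shows "pieces S P Q = {(P, Q)}"
proof
  show "{(P, Q)} \<subseteq> pieces S P Q"
  proof -
    have "(0::real) \<le> 0 \<and> (0::real) < 1 \<and> (1::real) \<le> 1 \<and> P = P + of_real 0 * (Q - P) \<and> Q = P + of_real 1 * (Q - P)" by simp
    then show ?thesis unfolding pieces_def piece_def using assms by blast
  qed
  show "pieces S P Q \<subseteq> {(P, Q)}"
  proof
    fix e assume "e \<in> pieces S P Q"
    then obtain u v s t where e: "e = (u, v)" "piece S u v" "0 \<le> s" "s < t" "t \<le> 1"
      "u = P + of_real s * (Q - P)" "v = P + of_real t * (Q - P)" by (auto simp: pieces_def)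
    have no: "\<not> (0 < x \<and> x < 1)" if "P + of_real x * (Q - P) \<in> S" for x
      using assms(4) that unfolding open_seg_def by blast
    have "u \<in> S" "v \<in> S" using e(2) by (auto simp: piece_def)
    then have "\<not> (0 < s \<and> s < 1)" "\<not> (0 < t \<and> t < 1)" using no[of s] no[of t] e(6,7) by auto
    then have "s = 0" "t = 1" using e(3-5) by auto
    then show "e \<in> {(P, Q)}" using e by simp
  qed
qed

text \<open>Induction on the number of points of \<open>S\<close> inside the segment: a statement
  about a subdivided segment is reduced to segments without such points and to one cut at a point of
  \<open>S\<close>.\<close>

lemma pieces_induct [consumes 4, case_names base step]:
  assumes "finite S" "P \<in> S" "Q \<in> S" "P \<noteq> Q"
    and "\<And>P Q. P \<in> S \<Longrightarrow> Q \<in> S \<Longrightarrow> P \<noteq> Q \<Longrightarrow> S \<inter> open_seg P Q = {} \<Longrightarrow> \<Phi> P Q"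
    and "\<And>P Q R. P \<in> S \<Longrightarrow> Q \<in> S \<Longrightarrow> R \<in> S \<Longrightarrow> P \<noteq> Q \<Longrightarrow> P \<noteq> R \<Longrightarrow> R \<noteq> Q \<Longrightarrow> R \<in> open_seg P Q \<Longrightarrow> \<Phi> P R \<Longrightarrow> \<Phi> R Q \<Longrightarrow> \<Phi> P Q"
  shows "\<Phi> P Q"
  using assms(2-4)
proof (induction "card (S \<inter> open_seg P Q)" arbitrary: P Q rule: less_induct)
  case less
  show ?case
  proof (cases "S \<inter> open_seg P Q = {}")
    case True
    then show ?thesis using assms(5) less.prems by blast
  next
    case False
    then obtain R where R: "R \<in> S" "R \<in> open_seg P Q" by blast
    then obtain r where r: "0 < r" "r < 1" "R = P + of_real r * (Q - P)" by (auto simp: open_seg_def)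
    have PR: "P \<noteq> R" "R \<noteq> Q"
      using param_inj[OF less.prems(3), of r 0] param_inj[OF less.prems(3), of r 1] r by auto
    have a: "open_seg P R \<subseteq> open_seg P Q" "R \<notin> open_seg P R"
    proof -
      { fix z assume "z \<in> open_seg P R"
        then have "z \<in> open_seg (P + of_real 0 * (Q - P)) (P + of_real r * (Q - P))" using r by simp
        then obtain x where "0 < x" "x < r" "z = P + of_real x * (Q - P)"
          by (rule open_seg_sub[rotated 3]) (use r in auto)
        then have "z \<in> open_seg P Q \<and> z \<noteq> R"
          unfolding open_seg_def r(3) using r(1,2) param_inj[OF less.prems(3), of x r] by (auto intro!: exI[of _ x]) }
      then show "open_seg P R \<subseteq> open_seg P Q" "R \<notin> open_seg P R" by blast+
    qed
    have b: "open_seg R Q \<subseteq> open_seg P Q" "R \<notin> open_seg R Q"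
    proof -
      { fix z assume "z \<in> open_seg R Q"
        then have "z \<in> open_seg (P + of_real r * (Q - P)) (P + of_real 1 * (Q - P))" using r by simp
        then obtain x where "r < x" "x < 1" "z = P + of_real x * (Q - P)"
          by (rule open_seg_sub[rotated 3]) (use r in auto)
        then have "z \<in> open_seg P Q \<and> z \<noteq> R"
          unfolding open_seg_def r(3) using r(1,2) param_inj[OF less.prems(3), of x r] by (auto intro!: exI[of _ x]) }
      then show "open_seg R Q \<subseteq> open_seg P Q" "R \<notin> open_seg R Q" by blast+
    qed
    have "S \<inter> open_seg P R \<subset> S \<inter> open_seg P Q" using a R by blast
    then have 1: "\<Phi> P R" using less.prems R PR less.hyps[of P R] assms(1) by (meson finite_Int psubset_card_mono)
    have "S \<inter> open_seg R Q \<subset> S \<inter> open_seg P Q" using b R by blast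
    then have 2: "\<Phi> R Q" using less.prems R PR less.hyps[of R Q] assms(1) by (meson finite_Int psubset_card_mono)
    show ?thesis using assms(6)[of P Q R] less.prems R PR 1 2 by blast
  qed
qed

lemma pieces_finite: "finite S \<Longrightarrow> finite (pieces S P Q)"
  by (rule finite_subset[of _ "S \<times> S"]) (auto simp: pieces_def piece_def)

text \<open>The conditions on \<open>s / t\<close> ask for additivity only when \<open>y\<close>
  lies between \<open>x\<close> and \<open>z\<close>, so that distances are covered as well as
  signed angles.\<close>

lemma pieces_sum:
  fixes F :: "complex \<Rightarrow> complex \<Rightarrow> real"
  assumes S: "finite S" and PQ: "P \<in> S" "Q \<in> S" "P \<noteq> Q"
    and d: "Q - P = of_real q * d"
    and add: "\<And>x y z s t. x \<in> S \<Longrightarrow> y \<in> S \<Longrightarrow> z \<in> S \<Longrightarrow> y - x = of_real s * d \<Longrightarrow> z - x = of_real t * d \<Longrightarrow>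
      0 \<le> s / t \<Longrightarrow> s / t \<le> 1 \<Longrightarrow> t \<noteq> 0 \<Longrightarrow> F x y + F y z = F x z"
  shows "(\<Sum>(u, v)\<in>pieces S P Q. F u v) = F P Q"
proof -
  have "\<forall>q. Q - P = of_real q * d \<longrightarrow> (\<Sum>(u, v)\<in>pieces S P Q. F u v) = F P Q"
    using S PQ
  proof (induction rule: pieces_induct)
    case (base P Q)
    then show ?case by (simp add: pieces_base)
  next
    case (step P Q R)
    show ?case
    proof (intro allI impI)
      fix q assume q: "Q - P = of_real q * d"
      obtain r where r: "0 < r" "r < 1" "R = P + of_real r * (Q - P)" using step(7) by (auto simp: open_seg_def)
      have 1: "R - P = of_real (r * q) * d" using r q by simp
      have 2: "Q - R = of_real ((1 - r) * q) * d" using r q by (simp add: algebra_simps)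
      have q0: "q \<noteq> 0" using q step by auto
      have "(\<Sum>(u, v)\<in>pieces S P Q. F u v) = (\<Sum>(u, v)\<in>pieces S P R. F u v) + (\<Sum>(u, v)\<in>pieces S R Q. F u v)"
        using pieces_split[OF step(4) step(3) step(7)] pieces_finite[OF S] by (simp add: sum.union_disjoint)
      also have "\<dots> = F P R + F R Q" using step.IH(1)[rule_format, OF 1] step.IH(2)[rule_format, OF 2] by (simp only:)
      also have "\<dots> = F P Q" by (rule add[OF step(1) step(3) step(2) 1 q]) (use r q0 in auto)
      finally show "(\<Sum>(u, v)\<in>pieces S P Q. F u v) = F P Q" .
    qed
  qed
  then show ?thesis using d by blast
qed

text \<open>An inner point of the segment ends one piece and starts the next one; an end point of
  the segment bounds a single piece.\<close>

lemma pieces_count: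
  assumes S: "finite S" and PQ: "P \<in> S" "Q \<in> S" "P \<noteq> Q" and V: "V \<in> S"
  shows "(\<Sum>(u, v)\<in>pieces S P Q. of_bool (u = V) + of_bool (v = V)) =
    (of_bool (P = V) + of_bool (Q = V) + 2 * of_bool (V \<in> open_seg P Q) :: real)"
  using S PQ
proof (induction rule: pieces_induct)
  case (base P Q)
  then show ?case using V by (auto simp: pieces_base)
next
  case (step P Q R)
  obtain r where r: "0 < r" "r < 1" "R = P + of_real r * (Q - P)" using step(7) by (auto simp: open_seg_def)
  have "(\<Sum>(u, v)\<in>pieces S P Q. of_bool (u = V) + of_bool (v = V)) =
      (\<Sum>(u, v)\<in>pieces S P R. of_bool (u = V) + of_bool (v = V)) + (\<Sum>(u, v)\<in>pieces S R Q. of_bool (u = V) + of_bool (v = V) :: real)"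
    using pieces_split[OF step(4) step(3) step(7)] pieces_finite[OF S] by (simp add: sum.union_disjoint)
  also have "\<dots> = of_bool (P = V) + of_bool (R = V) + 2 * of_bool (V \<in> open_seg P R) +
      (of_bool (R = V) + of_bool (Q = V) + 2 * of_bool (V \<in> open_seg R Q))" using step.IH by simp
  also have "\<dots> = of_bool (P = V) + of_bool (Q = V) + 2 * of_bool (V \<in> open_seg P Q)"
  proof -
    have L: "V \<in> open_seg P R \<longleftrightarrow> (\<exists>x. 0 < x \<and> x < r \<and> V = P + of_real x * (Q - P))"
    proof
      assume "V \<in> open_seg P R"
      then have "V \<in> open_seg (P + of_real 0 * (Q - P)) (P + of_real r * (Q - P))" using r by simp
      then obtain x where "0 < x" "x < r" "V = P + of_real x * (Q - P)"
        by (rule open_seg_sub[rotated 3]) (use r in auto)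
      then show "\<exists>x. 0 < x \<and> x < r \<and> V = P + of_real x * (Q - P)" by blast
    next
      assume "\<exists>x. 0 < x \<and> x < r \<and> V = P + of_real x * (Q - P)"
      then obtain x where x: "0 < x" "x < r" "V = P + of_real x * (Q - P)" by blast
      show "V \<in> open_seg P R" using open_seg_subI[OF x(1,2), of P Q] x r by simp
    qed
    have Rr: "V \<in> open_seg R Q \<longleftrightarrow> (\<exists>x. r < x \<and> x < 1 \<and> V = P + of_real x * (Q - P))"
    proof
      assume "V \<in> open_seg R Q"
      then have "V \<in> open_seg (P + of_real r * (Q - P)) (P + of_real 1 * (Q - P))" using r by simp
      then obtain x where "r < x" "x < 1" "V = P + of_real x * (Q - P)"
        by (rule open_seg_sub[rotated 3]) (use r in auto)
      then show "\<exists>x. r < x \<and> x < 1 \<and> V = P + of_real x * (Q - P)" by blast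
    next
      assume "\<exists>x. r < x \<and> x < 1 \<and> V = P + of_real x * (Q - P)"
      then obtain x where x: "r < x" "x < 1" "V = P + of_real x * (Q - P)" by blast
      show "V \<in> open_seg R Q" using open_seg_subI[OF x(1,2), of P Q] x r by simp
    qed
    note inj = param_inj[OF step(4)]
    show ?thesis
    proof (cases "\<exists>x. 0 < x \<and> x < 1 \<and> V = P + of_real x * (Q - P)")
      case True
      then obtain x where x: "0 < x" "x < 1" "V = P + of_real x * (Q - P)" by blast
      have "V \<in> open_seg P Q" unfolding open_seg_def using x by blast
      moreover have "V \<noteq> P" "V \<noteq> Q" using inj[of x 0] inj[of x 1] x by auto
      moreover have "V \<in> open_seg P R \<longleftrightarrow> x < r"
        unfolding L unfolding x(3) using x(1) by (auto simp: step(4)[symmetric])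
      moreover have "V \<in> open_seg R Q \<longleftrightarrow> r < x"
        unfolding Rr unfolding x(3) using x(2) by (auto simp: step(4)[symmetric])
      moreover have "V = R \<longleftrightarrow> x = r" using inj[of x r] x r by simp
      ultimately show ?thesis by (auto simp: not_less)
    next
      case False
      then have "V \<notin> open_seg P Q" "V \<notin> open_seg P R" "V \<notin> open_seg R Q" "V \<noteq> R"
        using r L Rr by (auto simp: open_seg_def)
      then show ?thesis by auto
    qed
  qed
  finally show ?case .
qed

section \<open>Dissections of a triangle\<close>

text \<open>The position of a triangle near \<open>z\<close> is tested along \<open>z + t w\<close>
  for \<open>t\<close> tending to 0 from the right. The coordinates are affine in \<open>t\<close>,
  so the constant term decides their sign, or the slope where that term vanishes.\<close>

lemma eventually_affine_pos:
  assumes "(0::real) < a"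
  shows "\<forall>\<^sub>F t in at_right 0. 0 < a + t * b"
proof -
  have "((\<lambda>t. a + t * b) \<longlongrightarrow> a + 0 * b) (at_right 0)" by (intro tendsto_intros)
  then show ?thesis using order_tendstoD(1)[of "\<lambda>t. a + t * b" "a + 0 * b" "at_right 0" 0] assms by simp
qed

lemma eventually_right_pos: "\<forall>\<^sub>F t :: real in at_right 0. 0 < t"
  by (simp add: eventually_at_right_less)

lemma side_shift: "side v j (z + of_real t * w) = side v j z + t * crs (v (j + 1) - v j) w"
  by (simp add: side_add crs_scale)

lemma otri_eventually:
  assumes "z \<in> otri v"
  shows "\<forall>\<^sub>F t in at_right 0. z + of_real t * w \<in> otri v"
proof -
  have "\<forall>\<^sub>F t in at_right 0. \<forall>j\<in>UNIV. 0 < side v j (z + of_real t * w)"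
    unfolding side_shift using assms by (intro eventually_ball_finite ballI eventually_affine_pos) (auto simp: otri_def)
  then show ?thesis by (simp add: otri_def)
qed

lemma oedge_eventually:
  assumes "z \<in> oedge v i" "crs (v (i + 1) - v i) w > 0"
  shows "\<forall>\<^sub>F t in at_right 0. z + of_real t * w \<in> otri v"
proof -
  have "\<forall>\<^sub>F t in at_right 0. 0 < side v j (z + of_real t * w)" for j
  proof -
    consider "j = i" | "side v j z > 0" using three_cases[of j i] assms(1) by (auto simp: oedge_def)
    then show ?thesis
    proof cases
      case 1
      have "side v i z = 0" using assms(1) by (simp add: oedge_def)
      then show ?thesis unfolding side_shift 1
        by (intro eventually_mono[OF eventually_right_pos]) (simp add: assms(2))
    next
      case 2
      then show ?thesis unfolding side_shift by (rule eventually_affine_pos)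
    qed
  qed
  then have "\<forall>\<^sub>F t in at_right 0. \<forall>j\<in>UNIV. 0 < side v j (z + of_real t * w)"
    by (intro eventually_ball_finite ballI) auto
  then show ?thesis by (simp add: otri_def)
qed

lemma frequently_tri_closed:
  assumes "\<exists>\<^sub>F t in at_right 0. z + of_real t * w \<in> tri v"
  shows "z \<in> tri v"
proof (rule ccontr)
  assume "z \<notin> tri v"
  then obtain j where j: "0 < - side v j z" by (auto simp: tri_def not_le)
  have "\<forall>\<^sub>F t in at_right 0. 0 < - side v j z + t * (- crs (v (j + 1) - v j) w)"
    by (rule eventually_affine_pos[OF j])
  then have "\<forall>\<^sub>F t in at_right 0. z + of_real t * w \<notin> tri v"
    by (rule eventually_mono) (auto simp: tri_def side_shift not_le intro!: exI[of _ j])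
  then show False using assms by (simp add: frequently_def)
qed

lemma crs_parallel:
  assumes "crs d d' = 0" "d \<noteq> 0"
  obtains c where "d' = of_real c * d"
proof -
  have "Im (d' / d) = 0" using assms by (simp add: Im_divide_crs)
  then have "d' / d = of_real (Re (d' / d))" by (simp add: complex_eq_iff)
  then have "d' = of_real (Re (d' / d)) * d" using assms(2) by (metis nonzero_divide_eq_eq)
  then show thesis using that by blast
qed

lemma crs_i_times: "crs d (\<i> * d) = (cmod d)\<^sup>2"
  unfolding cmod_power2 by (simp add: crs_def power2_eq_square)

text \<open>Two open half planes bounded by lines through 0 are disjoint only if they are opposite.
  Applied to triangles with disjoint interiors that have edges through a common point.\<close>

lemma opposite_directions:
  assumes "d \<noteq> 0" "d' \<noteq> 0" and no: "\<And>e. crs d e > 0 \<Longrightarrow> crs d' e > 0 \<Longrightarrow> False"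
  obtains c where "c > 0" "d' = - of_real c * d"
proof -
  have "crs d d' = 0"
  proof (rule ccontr)
    assume "crs d d' \<noteq> 0"
    then consider "crs d d' > 0" | "crs d d' < 0" by linarith
    then show False
    proof cases
      case 1
      show False by (rule no[of "d' - d"]) (use 1 crs_swap[of d' d] in \<open>simp_all add: crs_diff\<close>)
    next
      case 2
      show False by (rule no[of "d - d'"]) (use 2 crs_swap[of d' d] in \<open>simp_all add: crs_diff\<close>)
    qed
  qed
  then obtain c where c: "d' = of_real c * d" using crs_parallel assms(1) by blast
  have "c < 0"
  proof (rule ccontr)
    assume "\<not> c < 0"
    moreover have "c \<noteq> 0" using c assms(2) by auto
    ultimately have "c > 0" by linarith
    moreover have "crs d (\<i> * d) > 0" using assms(1) by (simp add: crs_i_times)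
    ultimately show False using no[of "\<i> * d"] c by (simp add: crs_scale)
  qed
  then show thesis using that[of "- c"] c by simp
qed

lemma open_seg_oedge: "ccw v \<Longrightarrow> oedge v i = open_seg (v i) (v (i + 1))"
  unfolding open_seg_def using oedge_iff[of v _ i] by (auto simp: algebra_simps)

definition mid :: "complex \<Rightarrow> complex \<Rightarrow> complex" where
  "mid u v = (u + v) / 2"

lemma mid_inn: "u \<noteq> v \<Longrightarrow> mid u v \<in> open_seg u v"
  unfolding open_seg_def mid_def by (auto intro!: exI[of _ "1/2"] simp: field_simps)

lemma mid_sym: "mid u v = mid v u"
  by (simp add: mid_def add.commute)

lemma piece_mid: "piece S u v \<Longrightarrow> mid u v \<notin> S"
  using mid_inn[of u v] by (auto simp: piece_def)

lemma piecesD: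
  assumes "(u, v) \<in> pieces S P Q"
  obtains c where "piece S u v" "c > 0" "v - u = of_real c * (Q - P)" "mid u v \<in> open_seg P Q"
    "P \<noteq> Q"
proof -
  obtain s t where e: "piece S u v" "0 \<le> s" "s < t" "t \<le> 1"
    "u = P + of_real s * (Q - P)" "v = P + of_real t * (Q - P)" using assms unfolding pieces_def by blast
  have 1: "v - u = of_real (t - s) * (Q - P)" unfolding e(5,6) by (simp add: algebra_simps)
  have "mid u v = P + of_real ((s + t) / 2) * (Q - P)" by (simp add: e mid_def field_simps)
  then have 2: "mid u v \<in> open_seg P Q" unfolding open_seg_def using e by (auto intro!: exI[of _ "(s + t) / 2"])
  have "P \<noteq> Q" using e(1) e(5,6) by (auto simp: piece_def)
  then show thesis using that[of "t - s"] e 1 2 by simp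
qed

text \<open>A piece on the line \<open>PQ\<close> with its midpoint inside the segment cannot stick
  out at either end, because \<open>P\<close> and \<open>Q\<close> belong to \<open>S\<close> and a
  piece has no point of \<open>S\<close> inside.\<close>

lemma piecesI:
  assumes "piece S u v" "P \<in> S" "Q \<in> S" "v - u = of_real c * (Q - P)" "c > 0" "mid u v \<in> open_seg P Q"
  shows "(u, v) \<in> pieces S P Q"
proof -
  obtain x where x: "0 < x" "x < 1" "mid u v = P + of_real x * (Q - P)" using assms(6) by (auto simp: open_seg_def)
  define s t where "s = x - c / 2" and "t = x + c / 2"
  have st: "s < t" "s < x" "x < t" using assms(5) by (auto simp: s_def t_def)
  have u: "u = P + of_real s * (Q - P)"
  proof -
    have "u = mid u v - (v - u) / 2" by (simp add: mid_def field_simps)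
    then show ?thesis unfolding x(3) assms(4) s_def by (simp add: algebra_simps)
  qed
  have v: "v = P + of_real t * (Q - P)"
  proof -
    have "v = mid u v + (v - u) / 2" by (simp add: mid_def field_simps)
    then show ?thesis unfolding x(3) assms(4) t_def by (simp add: algebra_simps)
  qed
  have "0 \<le> s"
  proof (rule ccontr)
    assume "\<not> 0 \<le> s"
    then have "P + of_real 0 * (Q - P) \<in> open_seg u v" unfolding u v by (intro open_seg_subI) (use x st in auto)
    then show False using assms(1,2) by (auto simp: piece_def)
  qed
  moreover have "t \<le> 1"
  proof (rule ccontr)
    assume "\<not> t \<le> 1"
    then have "P + of_real 1 * (Q - P) \<in> open_seg u v" unfolding u v by (intro open_seg_subI) (use x st in auto)
    then show False using assms(1,3) by (auto simp: piece_def)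
  qed
  ultimately show ?thesis unfolding pieces_def using assms(1) u v st(1) by blast
qed

locale dissection =
  fixes I :: "'t set" and vt :: "'t \<Rightarrow> 3 \<Rightarrow> complex" and \<Delta> :: "3 \<Rightarrow> complex"
  assumes fin: "finite I"
    and ccw_tile: "T \<in> I \<Longrightarrow> ccw (vt T)"
    and ccw_big: "ccw \<Delta>"
    and cover: "tri \<Delta> = (\<Union>T\<in>I. tri (vt T))"
    and disj: "T \<in> I \<Longrightarrow> T' \<in> I \<Longrightarrow> T \<noteq> T' \<Longrightarrow> otri (vt T) \<inter> otri (vt T') = {}"
begin

text \<open>Edges of neighbouring tiles need not match. Cut at all tile vertices, however, they fall
  into pieces that do match, and all bookkeeping is done with these.\<close>

definition S :: "complex set" where
  "S = {vt T i | T i. T \<in> I}"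

definition bd :: "(3 \<Rightarrow> complex) \<Rightarrow> (complex \<times> complex) set" where
  "bd v = (\<Union>i. pieces S (v i) (v (i + 1)))"

lemma fin_S: "finite S"
proof -
  have "S = (\<lambda>(T, i). vt T i) ` (I \<times> UNIV)" by (auto simp: S_def)
  then show ?thesis using fin by simp
qed

lemma vt_S: "T \<in> I \<Longrightarrow> vt T i \<in> S"
  by (auto simp: S_def)

lemma tile_subset: "T \<in> I \<Longrightarrow> tri (vt T) \<subseteq> tri \<Delta>"
  using cover by blast

text \<open>A corner of the big triangle is an extreme point of it, so in a tile containing it it is
  neither an inner point nor inside an edge.\<close>

lemma corner_S: "\<Delta> i \<in> S"
proof -
  have "\<Delta> i \<in> tri \<Delta>" by (rule vertex_in_tri[OF ccw_big])
  then obtain T where T: "T \<in> I" "\<Delta> i \<in> tri (vt T)" using cover by blast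
  have ge: "side \<Delta> j z \<ge> 0" if "z \<in> tri (vt T)" for j z using tile_subset[OF T(1)] that by (auto simp: tri_def)
  have pts: "side \<Delta> j (vt T k) \<ge> 0" for j k using ge vertex_in_tri[OF ccw_tile[OF T(1)]] by blast
  \<comment> \<open>No segment centred at a corner stays in the big triangle: the coordinates of
    both sides through the corner would have to be constant along it.\<close>
  have nowhere: False if "w \<noteq> 0" "\<forall>\<^sub>F t in at_right 0. \<Delta> i + of_real t * w \<in> tri (vt T)"
    "\<forall>\<^sub>F t in at_right 0. \<Delta> i + of_real t * (- w) \<in> tri (vt T)" for w
  proof -
    have "\<forall>\<^sub>F t in at_right 0. 0 < t \<and> \<Delta> i + of_real t * w \<in> tri (vt T) \<and> \<Delta> i + of_real t * (- w) \<in> tri (vt T)"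
      using that eventually_right_pos by (simp add: eventually_conj_iff)
    then obtain t where t: "0 < t" "\<Delta> i + of_real t * w \<in> tri (vt T)" "\<Delta> i + of_real t * (- w) \<in> tri (vt T)"
      using eventually_happens[of _ "at_right (0::real)"] trivial_limit_at_right_real by blast
    have "side \<Delta> j (\<Delta> i) = 0 \<Longrightarrow> crs (\<Delta> (j + 1) - \<Delta> j) w = 0" for j
      using ge[OF t(2), of j] ge[OF t(3), of j] t(1) unfolding side_shift
      by (simp add: crs_minus zero_le_mult_iff mult_le_0_iff)
    from this[of i] this[of "i + 2"] have z: "crs (\<Delta> (i + 1) - \<Delta> i) w = 0" "crs (\<Delta> i - \<Delta> (i + 2)) w = 0" by simp_all
    have "crs (\<Delta> (i + 1) - \<Delta> i) (\<Delta> i - \<Delta> (i + 2)) \<noteq> 0"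
      using ccw_side[OF ccw_big, of i] by (simp add: side_def crs_def algebra_simps)
    then show False using crs_basis_zero z that(1) by blast
  qed
  show ?thesis
  proof (rule tri_cases[OF ccw_tile[OF T(1)] T(2)])
    assume "\<Delta> i \<in> otri (vt T)"
    then have ev: "\<forall>\<^sub>F t in at_right 0. \<Delta> i + of_real t * w \<in> tri (vt T)" for w
      using otri_subset by (blast intro: eventually_mono[OF otri_eventually])
    show ?thesis using nowhere[OF one_neq_zero ev ev] by simp
  next
    fix k assume "\<Delta> i = vt T k"
    then show ?thesis using vt_S[OF T(1)] by simp
  next
    fix k assume k: "\<Delta> i \<in> oedge (vt T) k"
    let ?v = "vt T"
    obtain t where t: "0 < t" "t < 1" "\<Delta> i = of_real (1 - t) * ?v k + of_real t * ?v (k + 1)"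
      using k oedge_iff ccw_tile[OF T(1)] by blast
    have "side \<Delta> j (\<Delta> i) = (1 - t) * side \<Delta> j (?v k) + t * side \<Delta> j (?v (k + 1))" for j
      by (subst t(3)) (simp only: side_comb)
    then have "side \<Delta> j (?v k) = 0 \<and> side \<Delta> j (?v (k + 1)) = 0" if "side \<Delta> j (\<Delta> i) = 0" for j
      using that pts[of j k] pts[of j "k + 1"] t(1,2) add_nonneg_eq_0_iff[of "(1 - t) * side \<Delta> j (?v k)" "t * side \<Delta> j (?v (k + 1))"]
      by simp
    from this[of i] this[of "i + 2"] have "?v k = \<Delta> i" "?v (k + 1) = \<Delta> i"
      using side_zero_vertex[OF ccw_big, of i] by simp_all
    then show ?thesis using vt_S[OF T(1)] by metis
  qed
qed

lemma bdD:
  assumes "(p, q) \<in> bd v" "ccw v"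
  obtains i c where "piece S p q" "c > 0" "q - p = of_real c * (v (i + 1) - v i)" "mid p q \<in> oedge v i"
    "(p, q) \<in> pieces S (v i) (v (i + 1))"
proof -
  obtain i where i: "(p, q) \<in> pieces S (v i) (v (i + 1))" using assms(1) by (auto simp: bd_def)
  then show thesis by (rule piecesD) (use that i open_seg_oedge[OF assms(2)] in blast)
qed

lemma bdI:
  assumes "ccw v" "v i \<in> S" "v (i + 1) \<in> S" "piece S p q" "c > 0" "q - p = of_real c * (v (i + 1) - v i)"
    "mid p q \<in> oedge v i"
  shows "(p, q) \<in> bd v"
  using piecesI[OF assms(4) assms(2,3) assms(6,5)] assms(1,7) open_seg_oedge by (auto simp: bd_def)

lemma bd_left:
  assumes "(p, q) \<in> bd v" "ccw v" "crs (q - p) e > 0"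
  shows "\<forall>\<^sub>F t in at_right 0. mid p q + of_real t * e \<in> otri v"
  using assms(1,2)
proof (rule bdD)
  fix i c assume "c > 0" "q - p = of_real c * (v (i + 1) - v i)" "mid p q \<in> oedge v i"
  then show ?thesis using oedge_eventually[of "mid p q" v i e] assms(3) by (simp add: crs_scale zero_less_mult_iff)
qed

lemma bd_in_left:
  assumes "(p, q) \<in> bd v" "ccw v" "mid p q + of_real t * e \<in> tri v" "t > 0"
  shows "crs (q - p) e \<ge> 0"
  using assms(1,2)
proof (rule bdD)
  fix i c assume i: "c > 0" "q - p = of_real c * (v (i + 1) - v i)" "mid p q \<in> oedge v i"
  have "side v i (mid p q + of_real t * e) \<ge> 0" using assms(3) by (simp add: tri_def)
  then show ?thesis using i assms(4) unfolding side_shift by (simp add: oedge_def crs_scale zero_le_mult_iff)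
qed

lemma ex_right:
  assumes "\<forall>\<^sub>F t :: real in at_right 0. P t"
  obtains t where "t > 0" "P t"
proof -
  have "\<forall>\<^sub>F t in at_right 0. 0 < t \<and> P t" using assms eventually_right_pos by eventually_elim auto
  then show thesis using eventually_happens[of _ "at_right (0::real)"] trivial_limit_at_right_real that by blast
qed

lemma no_common_direction:
  assumes "T \<in> I" "T' \<in> I" "\<forall>\<^sub>F t in at_right 0. z + of_real t * e \<in> otri (vt T)"
    "\<forall>\<^sub>F t in at_right 0. z + of_real t * e \<in> otri (vt T')"
  shows "T = T'"
proof (rule ccontr)
  assume ne: "T \<noteq> T'"
  have "\<forall>\<^sub>F t in at_right 0. z + of_real t * e \<in> otri (vt T) \<and> z + of_real t * e \<in> otri (vt T')"
    using assms(3,4) by eventually_elim auto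
  then obtain t where "t > 0" "z + of_real t * e \<in> otri (vt T) \<and> z + of_real t * e \<in> otri (vt T')" by (rule ex_right)
  then show False using disj[OF assms(1,2) ne] by blast
qed

text \<open>From the midpoint the left normal leads into the interior of every counterclockwise
  triangle that has the oriented piece on its boundary.\<close>

lemma bd_unique:
  assumes "T \<in> I" "T' \<in> I" "(p, q) \<in> bd (vt T)" "(p, q) \<in> bd (vt T')"
  shows "T = T'"
proof -
  have "p \<noteq> q" by (rule bdD[OF assms(3) ccw_tile[OF assms(1)]]) (auto simp: piece_def)
  then have "crs (q - p) (\<i> * (q - p)) > 0" by (simp add: crs_i_times)
  then show ?thesis using no_common_direction[OF assms(1,2)] bd_left[OF assms(3) ccw_tile[OF assms(1)]]
      bd_left[OF assms(4) ccw_tile[OF assms(2)]] by blast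
qed

text \<open>Finitely many tiles cover the points \<open>z + t e\<close>, so one of them contains
  such points for arbitrarily small \<open>t\<close>; since tiles are closed, it contains
  \<open>z\<close>.\<close>

lemma approach_tile:
  assumes "\<forall>\<^sub>F t in at_right 0. z + of_real t * e \<in> tri \<Delta>"
  obtains T where "T \<in> I" "\<exists>\<^sub>F t in at_right 0. z + of_real t * e \<in> tri (vt T)" "z \<in> tri (vt T)"
proof -
  have "\<exists>T\<in>I. \<exists>\<^sub>F t in at_right 0. z + of_real t * e \<in> tri (vt T)"
  proof (rule ccontr)
    assume "\<not> ?thesis"
    then have "\<forall>T\<in>I. \<forall>\<^sub>F t in at_right 0. z + of_real t * e \<notin> tri (vt T)" by (simp add: frequently_def)
    then have "\<forall>\<^sub>F t in at_right 0. \<forall>T\<in>I. z + of_real t * e \<notin> tri (vt T)"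
      using fin by (intro eventually_ball_finite) auto
    from eventually_conj[OF this assms] have "\<forall>\<^sub>F t :: real in at_right 0. False"
      by (rule eventually_mono) (use cover in blast)
    then show False using ex_right by blast
  qed
  then show thesis using that frequently_tri_closed by blast
qed

lemma local_cases:
  assumes "T \<in> I" "z \<in> tri (vt T)" "z \<notin> S"
  obtains "z \<in> otri (vt T)" | i where "z \<in> oedge (vt T) i"
  using tri_cases[OF ccw_tile[OF assms(1)] assms(2)] vt_S[OF assms(1)] assms(3) by metis

text \<open>The midpoint of the piece is no tile vertex. Either it is on the boundary of the big
  triangle, or a tile met on the right-hand side has it on an open edge, which runs in the opposite
  direction because the interiors are disjoint.\<close>

lemma bd_opposite:
  assumes T: "T \<in> I" and e: "(p, q) \<in> bd (vt T)"
  shows "(p, q) \<in> bd \<Delta> \<or> (\<exists>T'\<in>I. (q, p) \<in> bd (vt T'))"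
proof -
  let ?m = "mid p q" and ?d = "q - p"
  obtain i c where i: "piece S p q" "c > 0" "?d = of_real c * (vt T (i + 1) - vt T i)" "?m \<in> oedge (vt T) i"
    by (rule bdD[OF e ccw_tile[OF T]])
  have pq: "p \<noteq> q" using i(1) by (simp add: piece_def)
  have mS: "?m \<notin> S" by (rule piece_mid[OF i(1)])
  have left: "crs ?d (\<i> * ?d) > 0" using pq by (simp add: crs_i_times)
  note bdl = bd_left[OF e ccw_tile[OF T]]
  have mT: "?m \<in> tri (vt T)" using i(4) oedge_subset by blast
  then have m: "?m \<in> tri \<Delta>" using tile_subset[OF T] by blast
  show ?thesis
  proof (rule tri_cases[OF ccw_big m])
    fix j assume "?m = \<Delta> j"
    then show ?thesis using corner_S mS by metis
  next
    fix j assume j: "?m \<in> oedge \<Delta> j"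
    let ?D = "\<Delta> (j + 1) - \<Delta> j"
    have D: "?D \<noteq> 0" using ccw_distinct[OF ccw_big, of j] by simp
    have nonneg: "crs ?D e \<ge> 0" if de: "crs ?d e > 0" for e
    proof -
      obtain t where t: "t > 0" "?m + of_real t * e \<in> otri (vt T)" by (rule ex_right[OF bdl[OF de]])
      then have "?m + of_real t * e \<in> tri \<Delta>" using tile_subset[OF T] otri_subset by blast
      then have "side \<Delta> j (?m + of_real t * e) \<ge> 0" by (simp add: tri_def)
      then show ?thesis using j t(1) unfolding side_shift by (simp add: oedge_def zero_le_mult_iff)
    qed
    have "\<exists>c>0. - ?D = - of_real c * ?d"
    proof (rule opposite_directions[of ?d "- ?D"])
      show "?d \<noteq> 0" "- ?D \<noteq> 0" using pq D by auto
      show "crs ?d e > 0 \<Longrightarrow> crs (- ?D) e > 0 \<Longrightarrow> False" for e using nonneg[of e] unfolding crs_minus by linarith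
    qed blast
    then obtain c' where c': "c' > 0" "?D = of_real c' * ?d" by (metis minus_minus mult_minus_left)
    have "?d = of_real (1 / c') * ?D" using c' by (simp add: field_simps)
    then have "(p, q) \<in> bd \<Delta>"
      using bdI[OF ccw_big corner_S corner_S i(1), of "1 / c'" j] c' j by simp
    then show ?thesis ..
  next
    assume "?m \<in> otri \<Delta>"
    then have "\<forall>\<^sub>F t in at_right 0. ?m + of_real t * (- (\<i> * ?d)) \<in> tri \<Delta>"
      using otri_subset by (blast intro: eventually_mono[OF otri_eventually])
    then obtain T' where T': "T' \<in> I" "\<exists>\<^sub>F t in at_right 0. ?m + of_real t * (- (\<i> * ?d)) \<in> tri (vt T')"
      "?m \<in> tri (vt T')" by (rule approach_tile)
    have ne: "T' \<noteq> T"
    proof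
      assume "T' = T"
      then have "\<exists>\<^sub>F t in at_right 0. ?m + of_real t * (- (\<i> * ?d)) \<in> tri (vt T) \<and> t > 0"
        using T'(2) eventually_right_pos by (auto intro: frequently_rev_mp elim: eventually_mono)
      then obtain t where t: "?m + of_real t * (- (\<i> * ?d)) \<in> tri (vt T)" "t > 0" by (auto dest: frequently_ex)
      have "crs ?d (- (\<i> * ?d)) \<ge> 0" by (rule bd_in_left[OF e ccw_tile[OF T] t])
      then show False using left unfolding crs_minus by linarith
    qed
    have "\<exists>T'\<in>I. (q, p) \<in> bd (vt T')"
    proof (rule local_cases[OF T'(1) T'(3) mS])
      assume "?m \<in> otri (vt T')"
      then have "\<forall>\<^sub>F t in at_right 0. ?m + of_real t * (\<i> * ?d) \<in> otri (vt T')" by (rule otri_eventually)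
      then show ?thesis using no_common_direction[OF T'(1) T] bdl[OF left] ne by blast
    next
      fix j assume j: "?m \<in> oedge (vt T') j"
      let ?D = "vt T' (j + 1) - vt T' j"
      have D: "?D \<noteq> 0" using ccw_distinct[OF ccw_tile[OF T'(1)], of j] by simp
      have "\<exists>c>0. ?D = - of_real c * ?d"
      proof (rule opposite_directions[of ?d ?D])
        show "?d \<noteq> 0" "?D \<noteq> 0" using pq D by auto
        show "crs ?d e > 0 \<Longrightarrow> crs ?D e > 0 \<Longrightarrow> False" for e
          using no_common_direction[OF T'(1) T] oedge_eventually[OF j] bdl ne by blast
      qed blast
      then obtain c' where c': "c' > 0" "?D = - of_real c' * ?d" by blast
      have "p - q = of_real (1 / c') * ?D" using c' by (simp add: field_simps)
      then have "(q, p) \<in> bd (vt T')"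
        using bdI[OF ccw_tile[OF T'(1)] vt_S[OF T'(1)] vt_S[OF T'(1)], of q p "1 / c'" j] i(1) c' j
        by (simp add: piece_sym mid_sym)
      then show ?thesis using T'(1) by blast
    qed
    then show ?thesis ..
  qed
qed

lemma big_bd_inside:
  assumes "(p, q) \<in> bd \<Delta>" "T \<in> I" "\<forall>\<^sub>F t in at_right 0. mid p q + of_real t * e \<in> otri (vt T)"
  shows "crs (q - p) e \<ge> 0"
proof -
  obtain t where t: "t > 0" "mid p q + of_real t * e \<in> otri (vt T)" using assms(3) ex_right by blast
  then have "mid p q + of_real t * e \<in> tri \<Delta>" using tile_subset[OF assms(2)] otri_subset by blast
  then show ?thesis using bd_in_left[OF assms(1) ccw_big] t(1) by blast
qed

lemma bd_big_not_opposite: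
  assumes "(p, q) \<in> bd \<Delta>" "T \<in> I"
  shows "(q, p) \<notin> bd (vt T)"
proof
  assume e: "(q, p) \<in> bd (vt T)"
  have pq: "p \<noteq> q" by (rule bdD[OF assms(1) ccw_big]) (auto simp: piece_def)
  have l: "crs (p - q) (\<i> * (p - q)) > 0" using pq by (simp add: crs_i_times)
  have "crs (q - p) (\<i> * (p - q)) \<ge> 0"
    using big_bd_inside[OF assms] bd_left[OF e ccw_tile[OF assms(2)] l] by (simp add: mid_sym)
  then show False using l crs_minus(1)[of "p - q"] by simp
qed

lemma bd_big_owner:
  assumes "(p, q) \<in> bd \<Delta>"
  shows "\<exists>T\<in>I. (p, q) \<in> bd (vt T)"
proof -
  let ?m = "mid p q" and ?d = "q - p"
  obtain i c where i: "piece S p q" "c > 0" "?d = of_real c * (\<Delta> (i + 1) - \<Delta> i)" "?m \<in> oedge \<Delta> i"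
    by (rule bdD[OF assms ccw_big])
  have pq: "p \<noteq> q" using i(1) by (simp add: piece_def)
  have mS: "?m \<notin> S" by (rule piece_mid[OF i(1)])
  have left: "crs ?d (\<i> * ?d) > 0" using pq by (simp add: crs_i_times)
  have "\<forall>\<^sub>F t in at_right 0. ?m + of_real t * (\<i> * ?d) \<in> tri \<Delta>"
    using otri_subset by (blast intro: eventually_mono[OF bd_left[OF assms ccw_big left]])
  then obtain T where T: "T \<in> I" "?m \<in> tri (vt T)" by (rule approach_tile)
  show ?thesis
  proof (rule local_cases[OF T mS])
    assume "?m \<in> otri (vt T)"
    then have "\<forall>\<^sub>F t in at_right 0. ?m + of_real t * (- (\<i> * ?d)) \<in> otri (vt T)" by (rule otri_eventually)
    then have "crs ?d (- (\<i> * ?d)) \<ge> 0" by (rule big_bd_inside[OF assms T(1)])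
    then show ?thesis using left unfolding crs_minus by linarith
  next
    fix j assume j: "?m \<in> oedge (vt T) j"
    let ?D = "vt T (j + 1) - vt T j"
    have D: "?D \<noteq> 0" using ccw_distinct[OF ccw_tile[OF T(1)], of j] by simp
    have "\<exists>c>0. ?D = - of_real c * (- ?d)"
    proof (rule opposite_directions[of "- ?d" ?D])
      show "- ?d \<noteq> 0" "?D \<noteq> 0" using pq D by auto
      show "crs (- ?d) e > 0 \<Longrightarrow> crs ?D e > 0 \<Longrightarrow> False" for e
        using big_bd_inside[OF assms T(1) oedge_eventually[OF j, of e]] unfolding crs_minus by linarith
    qed blast
    then obtain c' where c': "c' > 0" "?D = of_real c' * ?d" by (metis minus_mult_minus)
    have "?d = of_real (1 / c') * ?D" using c' by (simp add: field_simps)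
    then have "(p, q) \<in> bd (vt T)"
      using bdI[OF ccw_tile[OF T(1)] vt_S[OF T(1)] vt_S[OF T(1)] i(1), of "1 / c'" j] c' j by simp
    then show ?thesis using T(1) by blast
  qed
qed

definition own :: "complex \<Rightarrow> complex \<Rightarrow> 't" where
  "own p q = (THE T. T \<in> I \<and> (p, q) \<in> bd (vt T))"

lemma own_eq: "T \<in> I \<Longrightarrow> (p, q) \<in> bd (vt T) \<Longrightarrow> own p q = T"
  unfolding own_def using bd_unique by (intro the_equality) auto

lemma bd_finite: "finite (bd v)"
  by (simp add: bd_def pieces_finite[OF fin_S])

text \<open>Reversing a piece and passing to the neighbouring tile is an involution on the pieces
  off the boundary of the big triangle, and it changes the sign of the summand. Winding numbers,
  areas, signed perimeters and signed incidences at a vertex are all treated as instances.\<close>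

theorem edge_cancellation:
  fixes G :: "'t \<Rightarrow> complex \<Rightarrow> complex \<Rightarrow> real"
  assumes anti: "\<And>T T' p q. T \<in> I \<Longrightarrow> T' \<in> I \<Longrightarrow> (p, q) \<in> bd (vt T) \<Longrightarrow> (q, p) \<in> bd (vt T') \<Longrightarrow> G T p q + G T' q p = 0"
  shows "(\<Sum>T\<in>I. \<Sum>(p, q)\<in>bd (vt T). G T p q) = (\<Sum>(p, q)\<in>bd \<Delta>. G (own p q) p q)"
proof -
  let ?Z = "Sigma I (\<lambda>T. bd (vt T))"
  let ?g = "\<lambda>(T, (p, q)). G T p q"
  let ?B = "{x \<in> ?Z. snd x \<in> bd \<Delta>}" and ?X = "{x \<in> ?Z. snd x \<notin> bd \<Delta>}"
  have finZ: "finite ?Z" using fin bd_finite by auto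
  have "(\<Sum>T\<in>I. \<Sum>(p, q)\<in>bd (vt T). G T p q) = sum ?g ?Z"
    using fin bd_finite by (subst sum.Sigma) auto
  also have "\<dots> = sum ?g ?B + sum ?g ?X"
    by (subst sum.union_disjoint[symmetric]) (use finZ in \<open>auto intro!: sum.cong finite_subset[OF _ finZ]\<close>)
  also have "sum ?g ?X = 0"
  proof -
    have opp: "\<exists>T'\<in>I. (q, p) \<in> bd (vt T')" if "T \<in> I" "(p, q) \<in> bd (vt T)" "(p, q) \<notin> bd \<Delta>" for T p q
      using bd_opposite that by blast
    let ?h = "\<lambda>(T, (p, q)). (own q p, (q, p))"
    have "sum ?g ?X = sum (\<lambda>x. - ?g x) ?X"
    proof (rule sum.reindex_bij_witness[of _ ?h ?h])
      fix x assume "x \<in> ?X"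
      then obtain T p q where x: "x = (T, (p, q))" "T \<in> I" "(p, q) \<in> bd (vt T)" "(p, q) \<notin> bd \<Delta>" by auto
      then obtain T' where T': "T' \<in> I" "(q, p) \<in> bd (vt T')" using opp by blast
      have o: "own q p = T'" "own p q = T" using own_eq T' x by auto
      have n: "(q, p) \<notin> bd \<Delta>" using bd_big_not_opposite[of q p T] x by blast
      show "?h (?h x) = x" "?h x \<in> ?X" using x T' o n by auto
      show "?h (?h x) = x" "?h x \<in> ?X" using x T' o n by auto
      show "- ?g (?h x) = ?g x" using anti[OF x(2) T'(1) x(3) T'(2)] x o by simp
    qed
    then show ?thesis by (simp add: sum_negf)
  qed
  also have "sum ?g ?B = (\<Sum>(p, q)\<in>bd \<Delta>. G (own p q) p q)"
  proof (rule sum.reindex_bij_witness[of _ "\<lambda>(p, q). (own p q, (p, q))" snd])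
    fix x assume "x \<in> ?B"
    then obtain T p q where x: "x = (T, (p, q))" "T \<in> I" "(p, q) \<in> bd (vt T)" "(p, q) \<in> bd \<Delta>" by auto
    then show "(case snd x of (p, q) \<Rightarrow> (own p q, p, q)) = x" "snd x \<in> bd \<Delta>"
      "(case snd x of (p, q) \<Rightarrow> G (own p q) p q) = ?g x" using own_eq by auto
  next
    fix y assume y: "y \<in> bd \<Delta>"
    obtain p q where pq: "y = (p, q)" by (cases y)
    obtain T where "T \<in> I" "(p, q) \<in> bd (vt T)" using bd_big_owner y pq by blast
    then show "snd (case y of (p, q) \<Rightarrow> (own p q, p, q)) = y" "(case y of (p, q) \<Rightarrow> (own p q, p, q)) \<in> ?B"
      using own_eq y pq by auto
  qed
  finally show ?thesis by simp
qed

lemma bd_sum: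
  fixes h :: "complex \<times> complex \<Rightarrow> real"
  assumes "ccw v"
  shows "sum h (bd v) = (\<Sum>i\<in>UNIV. sum h (pieces S (v i) (v (i + 1))))"
  unfolding bd_def
proof (rule sum.UNION_disjoint)
  show "\<forall>i\<in>UNIV. \<forall>j\<in>UNIV. i \<noteq> j \<longrightarrow> pieces S (v i) (v (i + 1)) \<inter> pieces S (v j) (v (j + 1)) = {}"
  proof (intro ballI impI)
    fix i j :: 3 assume ij: "i \<noteq> j"
    have "False" if "(p, q) \<in> pieces S (v i) (v (i + 1))" "(p, q) \<in> pieces S (v j) (v (j + 1))" for p q
    proof -
      have "mid p q \<in> oedge v i" "mid p q \<in> oedge v j"
        using that piecesD open_seg_oedge[OF assms] by metis+
      then show False using ij three_cases[of j i] by (auto simp: oedge_def)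
    qed
    then show "pieces S (v i) (v (i + 1)) \<inter> pieces S (v j) (v (j + 1)) = {}" by auto
  qed
qed (use pieces_finite[OF fin_S] in auto)

end

section \<open>Angle sums and colours\<close>

lemma endpoint_not_open_seg:
  assumes "P \<noteq> Q" shows "P \<notin> open_seg P Q" "Q \<notin> open_seg P Q"
proof -
  have "P \<notin> open_seg P Q" if "P \<noteq> Q" for P Q
  proof
    assume "P \<in> open_seg P Q"
    then obtain t where t: "0 < t" "P = P + of_real t * (Q - P)" by (auto simp: open_seg_def)
    from t(2) have "of_real t * (Q - P) = 0" by (metis add_cancel_right_right)
    then show False using t(1) that by simp
  qed
  from this[of P Q] this[of Q P] show "P \<notin> open_seg P Q" "Q \<notin> open_seg P Q" using assms by (auto simp: open_seg_sym)
qed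

lemma dist_additive:
  fixes x y z d :: complex
  assumes "y - x = of_real a * d" "z - x = of_real t * d" "0 \<le> a / t" "a / t \<le> 1" "t \<noteq> 0"
  shows "dist x y + dist y z = dist x z"
proof -
  have "y = x + of_real a * d" "z = x + of_real t * d" using assms by (auto simp: algebra_simps)
  then have e: "x - y = of_real (- a) * d" "y - z = of_real (a - t) * d" "x - z = of_real (- t) * d"
    by (simp_all add: algebra_simps)
  have "dist x y = \<bar>- a\<bar> * cmod d" "dist y z = \<bar>a - t\<bar> * cmod d" "dist x z = \<bar>- t\<bar> * cmod d"
    by (simp_all only: dist_norm e norm_mult norm_of_real)
  moreover have "\<bar>- a\<bar> + \<bar>a - t\<bar> = \<bar>- t\<bar>"
    using assms(3-5) by (auto simp: divide_simps abs_if split: if_splits)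
  ultimately show ?thesis by (metis distrib_right)
qed

text \<open>Additivity for every order of the three points, in contrast to the restricted form that
  lengths satisfy.\<close>

definition additive_along :: "(complex \<Rightarrow> complex \<Rightarrow> real) \<Rightarrow> complex \<Rightarrow> bool" where
  "additive_along F d \<longleftrightarrow>
     (\<forall>x y z s t. y - x = of_real s * d \<longrightarrow> z - x = of_real t * d \<longrightarrow> F x y + F y z = F x z)"

context dissection
begin

lemma bd_sum_edges:
  fixes F :: "complex \<Rightarrow> complex \<Rightarrow> real"
  assumes v: "ccw v" and vS: "\<And>i. v i \<in> S"
    and add: "\<And>i x y z s t. y - x = of_real s * (v (i + 1) - v i) \<Longrightarrow> z - x = of_real t * (v (i + 1) - v i) \<Longrightarrow>
      0 \<le> s / t \<Longrightarrow> s / t \<le> 1 \<Longrightarrow> t \<noteq> 0 \<Longrightarrow> F x y + F y z = F x z"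
  shows "(\<Sum>(p, q)\<in>bd v. F p q) = (\<Sum>i\<in>UNIV. F (v i) (v (i + 1)))"
proof -
  have "(\<Sum>(p, q)\<in>pieces S (v i) (v (i + 1)). F p q) = F (v i) (v (i + 1))" for i
    by (rule pieces_sum[OF fin_S vS vS ccw_distinct(1)[OF v], where q = 1 and d = "v (i + 1) - v i"])
      (use add in \<open>simp_all\<close>)
  then show ?thesis by (simp add: bd_sum[OF v])
qed

lemma pieces_dist_sum:
  assumes "P \<in> S" "Q \<in> S" "P \<noteq> Q"
  shows "(\<Sum>(p, q)\<in>pieces S P Q. dist p q) = dist P Q"
  by (rule pieces_sum[OF fin_S assms, where q = 1 and d = "Q - P"]) (simp, blast intro: dist_additive)

text \<open>Weights that agree across common pieces leave the cancellation intact. With values 0 and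
  1 they serve as a substitute for connectedness: the tiles of weight 1 alone already have the full
  boundary sum.\<close>

theorem weighted_cancellation:
  assumes anti: "\<And>p q. F q p = - F p q"
    and add: "\<And>T i. T \<in> I \<Longrightarrow> wt T \<noteq> 0 \<Longrightarrow> additive_along F (vt T (i + 1) - vt T i)"
    and addB: "\<And>i. additive_along F (\<Delta> (i + 1) - \<Delta> i)"
    and wt: "\<And>T T' p q. T \<in> I \<Longrightarrow> T' \<in> I \<Longrightarrow> (p, q) \<in> bd (vt T) \<Longrightarrow> (q, p) \<in> bd (vt T') \<Longrightarrow> wt T = wt T'"
    and wtB: "\<And>T p q. T \<in> I \<Longrightarrow> (p, q) \<in> bd (vt T) \<Longrightarrow> (p, q) \<in> bd \<Delta> \<Longrightarrow> wt T = 1"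
  shows "(\<Sum>T\<in>I. wt T * (\<Sum>i\<in>UNIV. F (vt T i) (vt T (i + 1)))) = (\<Sum>i\<in>UNIV. F (\<Delta> i) (\<Delta> (i + 1)) :: real)"
proof -
  have "wt T * (\<Sum>i\<in>UNIV. F (vt T i) (vt T (i + 1))) = (\<Sum>(p, q)\<in>bd (vt T). wt T * F p q)" if T: "T \<in> I" for T
  proof (cases "wt T = 0")
    case True
    then show ?thesis by (simp add: sum.neutral case_prod_unfold)
  next
    case False
    have "(\<Sum>(p, q)\<in>bd (vt T). F p q) = (\<Sum>i\<in>UNIV. F (vt T i) (vt T (i + 1)))"
      by (rule bd_sum_edges[OF ccw_tile[OF T] vt_S[OF T]])
        (use add[OF T False] in \<open>unfold additive_along_def, blast\<close>)
    then show ?thesis by (simp add: sum_distrib_left[symmetric] case_prod_unfold)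
  qed
  then have "(\<Sum>T\<in>I. wt T * (\<Sum>i\<in>UNIV. F (vt T i) (vt T (i + 1)))) = (\<Sum>T\<in>I. \<Sum>(p, q)\<in>bd (vt T). wt T * F p q)"
    by simp
  also have "\<dots> = (\<Sum>(p, q)\<in>bd \<Delta>. wt (own p q) * F p q)"
  proof (rule edge_cancellation)
    fix T T' p q assume "T \<in> I" "T' \<in> I" "(p, q) \<in> bd (vt T)" "(q, p) \<in> bd (vt T')"
    then have "wt T = wt T'" by (rule wt)
    then show "wt T * F p q + wt T' * F q p = 0" using anti[of q p] by simp
  qed
  also have "\<dots> = (\<Sum>(p, q)\<in>bd \<Delta>. F p q)"
  proof (intro sum.cong refl)
    fix e assume e: "e \<in> bd \<Delta>"
    obtain p q where pq: "e = (p, q)" by (cases e)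
    obtain T where T: "T \<in> I" "(p, q) \<in> bd (vt T)" using bd_big_owner e pq by blast
    then have "wt (own p q) = 1" using wtB[OF T] own_eq[OF T] e pq by simp
    then show "(case e of (p, q) \<Rightarrow> wt (own p q) * F p q) = (case e of (p, q) \<Rightarrow> F p q)" by (simp add: pq)
  qed
  also have "\<dots> = (\<Sum>i\<in>UNIV. F (\<Delta> i) (\<Delta> (i + 1)))"
    by (rule bd_sum_edges[OF ccw_big corner_S]) (use addB in \<open>unfold additive_along_def, blast\<close>)
  finally show ?thesis .
qed

lemma additive_cancellation:
  assumes anti: "\<And>p q. F q p = - F p q"
    and add: "\<And>T i. T \<in> I \<Longrightarrow> additive_along F (vt T (i + 1) - vt T i)"
    and addB: "\<And>i. additive_along F (\<Delta> (i + 1) - \<Delta> i)"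
  shows "(\<Sum>T\<in>I. \<Sum>i\<in>UNIV. F (vt T i) (vt T (i + 1))) = (\<Sum>i\<in>UNIV. F (\<Delta> i) (\<Delta> (i + 1)) :: real)"
  using weighted_cancellation[of F "\<lambda>_. 1", OF anti add addB] by simp

end

lemma additive_along_sub: "additive_along (subt z) d"
  unfolding additive_along_def using subt_add by blast

text \<open>Parallel lines of direction \<open>d\<close> go into lines of one direction
  \<open>d'\<close>. The dependence of \<open>r'\<close> on \<open>r\<close> is left open, so
  discontinuous maps are included.\<close>

definition line_map :: "(complex \<Rightarrow> complex) \<Rightarrow> complex \<Rightarrow> bool" where
  "line_map f d \<longleftrightarrow> (\<exists>d'. \<forall>x r. \<exists>r'. f (x + of_real r * d) = f x + of_real r' * d')"

lemma additive_along_line_map: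
  assumes "line_map f d"
  shows "additive_along (\<lambda>p q. subt z (f p) (f q)) d"
proof -
  obtain d' where d': "\<forall>x r. \<exists>r'. f (x + of_real r * d) = f x + of_real r' * d'"
    using assms by (auto simp: line_map_def)
  show ?thesis
    unfolding additive_along_def
  proof (intro allI impI)
    fix x y w s t assume "y - x = of_real s * d" "w - x = of_real t * d"
    then have "y = x + of_real s * d" "w = x + of_real t * d" by (auto simp: algebra_simps)
    then obtain a b where "f y = f x + of_real a * d'" "f w = f x + of_real b * d'" using d' by metis
    then show "subt z (f x) (f y) + subt z (f y) (f w) = subt z (f x) (f w)"
      using subt_add[of "f y" "f x" a d' "f w" b z] by simp
  qed
qed

context dissection
begin

text \<open>Replaces the local picture of tiles around a point: every tile contributes the angle
  which it occupies at \<open>z\<close>.\<close>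

theorem wind_total: "(\<Sum>T\<in>I. wind z (vt T)) = wind z \<Delta>"
  unfolding wind_def
  by (rule additive_cancellation[OF subt_swap additive_along_sub additive_along_sub])

theorem wind_total_map:
  assumes "\<And>T i. T \<in> I \<Longrightarrow> line_map f (vt T (i + 1) - vt T i)" "\<And>i. line_map f (\<Delta> (i + 1) - \<Delta> i)"
  shows "(\<Sum>T\<in>I. wind z (f \<circ> vt T)) = wind z (f \<circ> \<Delta>)"
  unfolding wind_def o_def
  by (rule additive_cancellation[OF subt_swap]) (auto intro!: additive_along_line_map assms)

lemma crs_total: "(\<Sum>T\<in>I. \<Sum>i\<in>UNIV. crs (vt T i) (vt T (i + 1))) = (\<Sum>i\<in>UNIV. crs (\<Delta> i) (\<Delta> (i + 1)))"
proof (rule additive_cancellation)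
  have "additive_along crs d" for d
    unfolding additive_along_def
  proof (intro allI impI)
    fix x y z s t assume "y - x = of_real s * d" "z - x = of_real t * d"
    then have "y = x + of_real s * d" "z = x + of_real t * d" by (auto simp: algebra_simps)
    then show "crs x y + crs y z = crs x z" by (simp add: crs_def algebra_simps)
  qed
  then show "additive_along crs (vt T (i + 1) - vt T i)" "additive_along crs (\<Delta> (i + 1) - \<Delta> i)" for T i by auto
qed (simp add: crs_def)

definition corners :: "complex \<Rightarrow> ('t \<times> 3) set" where
  "corners V = {(T, i). T \<in> I \<and> vt T i = V}"

lemma fin_corners: "finite (corners V)"
  by (rule finite_subset[of _ "I \<times> UNIV"]) (auto simp: corners_def fin)

lemma corners_sum:
  fixes h :: "'t \<Rightarrow> 3 \<Rightarrow> real"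
  shows "(\<Sum>(T, i)\<in>corners V. h T i) = (\<Sum>T\<in>I. \<Sum>i\<in>UNIV. of_bool (vt T i = V) * h T i)"
proof -
  have "(\<Sum>T\<in>I. \<Sum>i\<in>UNIV. of_bool (vt T i = V) * h T i) = (\<Sum>(T, i)\<in>I \<times> UNIV. of_bool (vt T i = V) * h T i)"
    by (rule sum.cartesian_product)
  also have "\<dots> = (\<Sum>(T, i)\<in>corners V. of_bool (vt T i = V) * h T i)"
    by (rule sum.mono_neutral_right) (auto simp: corners_def fin)
  also have "\<dots> = (\<Sum>(T, i)\<in>corners V. h T i)"
    by (intro sum.cong) (auto simp: corners_def)
  finally show ?thesis by simp
qed

lemma corners_nonempty: "V \<in> S \<Longrightarrow> corners V \<noteq> {}"
  by (auto simp: S_def corners_def)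

definition angle_sum :: "complex \<Rightarrow> real" where
  "angle_sum V = (\<Sum>(T, i)\<in>corners V. ang (vt T) i)"

lemma angle_sum_pos: "V \<in> S \<Longrightarrow> angle_sum V > 0"
  unfolding angle_sum_def
  by (rule sum_pos) (use fin_corners corners_nonempty ang_bounds ccw_tile in \<open>auto simp: corners_def\<close>)

definition local_angle :: "complex \<Rightarrow> 't \<Rightarrow> real" where
  "local_angle V T = (\<Sum>i\<in>UNIV. of_bool (vt T i = V) * ang (vt T) i)"

lemma local_angle_vertex:
  assumes "T \<in> I" "vt T i = V" shows "local_angle V T = ang (vt T) i"
proof -
  have "vt T (i + 1) \<noteq> V" "vt T (i + 2) \<noteq> V" using ccw_distinct[OF ccw_tile[OF assms(1)], of i] assms(2) by auto
  then show ?thesis unfolding local_angle_def by (subst sum_three[of _ i]) (simp add: assms(2))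
qed

lemma local_angle_zero: "(\<And>i. vt T i \<noteq> V) \<Longrightarrow> local_angle V T = 0"
  by (simp add: local_angle_def)

lemma angle_sum_local: "angle_sum V = (\<Sum>T\<in>I. local_angle V T)"
  unfolding angle_sum_def corners_sum local_angle_def ..

text \<open>Beyond a corner at \<open>V\<close>, a tile contributes 0, \<pi> or 2 \<pi>, according
  as \<open>V\<close> is outside, on an open edge or inside.\<close>

lemma wind_local:
  assumes "T \<in> I" shows "\<exists>m :: nat. wind V (vt T) = local_angle V T + m * pi"
proof (cases "\<exists>i. vt T i = V")
  case True
  then obtain i where i: "vt T i = V" by blast
  then have "wind V (vt T) = local_angle V T + (0 :: nat) * pi"
    using wind_vertex[OF ccw_tile[OF assms], of i] local_angle_vertex[OF assms i] by simp
  then show ?thesis by blast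
next
  case False
  then have l: "local_angle V T = 0" by (simp add: local_angle_zero)
  show ?thesis
  proof (cases "V \<in> tri (vt T)")
    case True
    show ?thesis
    proof (rule tri_cases[OF ccw_tile[OF assms] True])
      assume "V \<in> otri (vt T)"
      then have "wind V (vt T) = local_angle V T + (2 :: nat) * pi" using wind_otri l by simp
      then show ?thesis by blast
    next
      fix i assume "V \<in> oedge (vt T) i"
      then have "wind V (vt T) = local_angle V T + (1 :: nat) * pi" using wind_oedge[OF ccw_tile[OF assms]] l by simp
      then show ?thesis by blast
    qed (use False in blast)
  next
    case out: False
    have "wind V (vt T) = local_angle V T + (0 :: nat) * pi" using wind_outside[OF ccw_tile[OF assms] out] l by simp
    then show ?thesis by blast
  qed
qed

lemma angle_sum_wind: "\<exists>m :: nat. wind V \<Delta> = angle_sum V + m * pi"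
proof -
  have "\<forall>T\<in>I. \<exists>m :: nat. wind V (vt T) = local_angle V T + m * pi" using wind_local by blast
  from bchoice[OF this] obtain f :: "'t \<Rightarrow> nat"
    where f: "\<And>T. T \<in> I \<Longrightarrow> wind V (vt T) = local_angle V T + f T * pi" by blast
  have "wind V \<Delta> = (\<Sum>T\<in>I. local_angle V T + f T * pi)" using wind_total[of V] f by simp
  also have "\<dots> = angle_sum V + (\<Sum>T\<in>I. f T) * pi"
    by (simp add: angle_sum_local sum.distrib sum_distrib_right)
  finally show ?thesis by blast
qed

text \<open>The two numbers differ by a nonnegative multiple of \<pi>, the angle sum is positive and
  the winding number at most \<pi>; so the multiple is 0.\<close>

lemma angle_sum_boundary:
  assumes "V \<in> S" "wind V \<Delta> \<le> pi"
  shows "angle_sum V = wind V \<Delta>"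
proof -
  obtain m :: nat where m: "wind V \<Delta> = angle_sum V + m * pi" using angle_sum_wind by blast
  then have "m * pi < pi" using angle_sum_pos[OF assms(1)] assms(2) by linarith
  then have "m = 0" by simp
  then show ?thesis using m by simp
qed

lemma angle_sum_corner: "angle_sum (\<Delta> i) = ang \<Delta> i"
  using angle_sum_boundary[OF corner_S, of i] wind_vertex[OF ccw_big, of i] ang_bounds[OF ccw_big, of i] by simp

lemma angle_sum_side: "V \<in> S \<Longrightarrow> V \<in> oedge \<Delta> i \<Longrightarrow> angle_sum V = pi"
  using angle_sum_boundary[of V] wind_oedge[OF ccw_big] by simp

lemma angle_sum_inner:
  assumes "V \<in> S" "V \<in> otri \<Delta>"
  shows "angle_sum V = pi \<or> angle_sum V = 2 * pi"
proof -
  obtain m :: nat where m: "2 * pi = angle_sum V + m * pi"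
    using angle_sum_wind[of V] wind_otri[OF assms(2)] by auto
  then have "m * pi < 2 * pi" using angle_sum_pos[OF assms(1)] by linarith
  then have "m = 0 \<or> m = 1" by auto
  then show ?thesis using m by auto
qed

lemma S_tri: "V \<in> S \<Longrightarrow> V \<in> tri \<Delta>"
  using vertex_in_tri ccw_tile tile_subset by (fastforce simp: S_def)

lemma S_cases:
  assumes "V \<in> S"
  obtains i where "V = \<Delta> i" | i where "V \<in> oedge \<Delta> i" | "V \<in> otri \<Delta>"
  using tri_cases[OF ccw_big S_tri[OF assms]] by metis

text \<open>At a boundary vertex the tile corners use up the whole winding number, which leaves no
  room for the \<pi> of an open edge.\<close>

lemma no_straight_boundary:
  assumes "V \<in> S" "wind V \<Delta> \<le> pi" "T \<in> I"
  shows "V \<notin> oedge (vt T) i"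
proof
  assume V: "V \<in> oedge (vt T) i"
  have "vt T j \<noteq> V" for j
    using V three_cases[of j i] side_vertex[of "vt T" i] side_vertex[of "vt T" "i + 1"] side_vertex[of "vt T" "i + 2"] by (auto simp: oedge_def)
  then have l: "local_angle V T = 0" by (simp add: local_angle_zero)
  have ge: "local_angle V T' \<le> wind V (vt T')" if "T' \<in> I" for T' using wind_local[OF that, of V] by auto
  have "(\<Sum>T\<in>I. wind V (vt T) - local_angle V T) = 0"
    using angle_sum_boundary[OF assms(1,2)] wind_total[of V] by (simp add: sum_subtractf angle_sum_local)
  then have "wind V (vt T) - local_angle V T = 0"
    using sum_nonneg_eq_0_iff[OF fin, of "\<lambda>T. wind V (vt T) - local_angle V T"] ge assms(3) by auto
  then show False using wind_oedge[OF ccw_tile[OF assms(3)] V] l by simp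
qed

lemma wind_big_boundary: "V \<in> oedge \<Delta> i \<Longrightarrow> wind V \<Delta> \<le> pi" "wind (\<Delta> i) \<Delta> \<le> pi"
  using wind_oedge[OF ccw_big, of V i] wind_vertex[OF ccw_big, of i] ang_bounds[OF ccw_big, of i] by auto

text \<open>Only an inequality: the image of a tile without a corner at \<open>V\<close> may still
  contain \<open>f V\<close>. Such images are counterclockwise and contribute nonnegative winding
  numbers.\<close>

lemma map_angle_le:
  assumes "\<And>T i. T \<in> I \<Longrightarrow> line_map f (vt T (i + 1) - vt T i)" "\<And>i. line_map f (\<Delta> (i + 1) - \<Delta> i)"
    and ccw: "\<And>T. T \<in> I \<Longrightarrow> ccw (f \<circ> vt T)"
  shows "(\<Sum>(T, i)\<in>corners V. ang (f \<circ> vt T) i) \<le> wind (f V) (f \<circ> \<Delta>)"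
proof -
  have "(\<Sum>i\<in>UNIV. of_bool (vt T i = V) * ang (f \<circ> vt T) i) \<le> wind (f V) (f \<circ> vt T)" if T: "T \<in> I" for T
  proof (cases "\<exists>i. vt T i = V")
    case True
    then obtain i where i: "vt T i = V" by blast
    have "vt T (i + 1) \<noteq> V" "vt T (i + 2) \<noteq> V" using ccw_distinct[OF ccw_tile[OF T], of i] i by auto
    then have "(\<Sum>i\<in>UNIV. of_bool (vt T i = V) * ang (f \<circ> vt T) i) = ang (f \<circ> vt T) i"
      by (subst sum_three[of _ i]) (simp add: i)
    then show ?thesis using wind_vertex[OF ccw[OF T], of i] i by simp
  next
    case False
    then show ?thesis using wind_nonneg(1)[OF ccw[OF T]] by simp
  qed
  then have "(\<Sum>(T, i)\<in>corners V. ang (f \<circ> vt T) i) \<le> (\<Sum>T\<in>I. wind (f V) (f \<circ> vt T))"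
    unfolding corners_sum by (rule sum_mono)
  then show ?thesis using wind_total_map[OF assms(1,2)] by simp
qed

subsection \<open>Colourings\<close>

text \<open>Count the ends of pieces at \<open>V\<close> with the signs of the tiles. Inner pieces
  cancel, a tile with a corner at \<open>V\<close> has exactly two ends there, and what remains are
  the boundary pieces at \<open>V\<close>. The cyclic order of the tiles does not enter.\<close>

lemma colour_vertex:
  fixes s :: "'t \<Rightarrow> real"
  assumes alt: "\<And>T T' p q. T \<in> I \<Longrightarrow> T' \<in> I \<Longrightarrow> (p, q) \<in> bd (vt T) \<Longrightarrow> (q, p) \<in> bd (vt T') \<Longrightarrow> s T' = - s T"
    and V: "V \<in> S" "wind V \<Delta> \<le> pi"
  shows "(\<Sum>(p, q)\<in>bd \<Delta>. s (own p q) * (of_bool (p = V) + of_bool (q = V))) = 2 * (\<Sum>(T, i)\<in>corners V. s T)"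
proof -
  have "(\<Sum>(p, q)\<in>bd \<Delta>. s (own p q) * (of_bool (p = V) + of_bool (q = V))) =
      (\<Sum>T\<in>I. \<Sum>(p, q)\<in>bd (vt T). s T * (of_bool (p = V) + of_bool (q = V)))"
  proof (rule edge_cancellation[where G = "\<lambda>T p q. s T * (of_bool (p = V) + of_bool (q = V))", symmetric])
    fix T T' p q assume "T \<in> I" "T' \<in> I" "(p, q) \<in> bd (vt T)" "(q, p) \<in> bd (vt T')"
    then have "s T' = - s T" by (rule alt)
    then show "s T * (of_bool (p = V) + of_bool (q = V)) + s T' * (of_bool (q = V) + of_bool (p = V)) = 0" by simp
  qed
  also have "\<dots> = (\<Sum>T\<in>I. 2 * (\<Sum>i\<in>UNIV. of_bool (vt T i = V) * s T))"
  proof (rule sum.cong[OF refl])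
    fix T assume T: "T \<in> I"
    let ?v = "vt T"
    have n: "V \<notin> open_seg (?v i) (?v (i + 1))" for i
      using no_straight_boundary[OF V T] open_seg_oedge[OF ccw_tile[OF T]] by blast
    have "(\<Sum>(p, q)\<in>bd ?v. s T * (of_bool (p = V) + of_bool (q = V))) =
        s T * (\<Sum>(p, q)\<in>bd ?v. of_bool (p = V) + of_bool (q = V))"
      by (simp add: sum_distrib_left case_prod_unfold)
    also have "(\<Sum>(p, q)\<in>bd ?v. of_bool (p = V) + of_bool (q = V) :: real) = (\<Sum>i\<in>UNIV. of_bool (?v i = V) + of_bool (?v (i + 1) = V))"
      unfolding bd_sum[OF ccw_tile[OF T]]
      by (rule sum.cong[OF refl], subst pieces_count[OF fin_S vt_S[OF T] vt_S[OF T] ccw_distinct(1)[OF ccw_tile[OF T]] V(1)])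
        (simp add: n)
    also have "\<dots> = 2 * (\<Sum>i\<in>UNIV. of_bool (?v i = V))"
      by (simp add: sum_three[of _ 1])
    finally show "(\<Sum>(p, q)\<in>bd ?v. s T * (of_bool (p = V) + of_bool (q = V))) = 2 * (\<Sum>i\<in>UNIV. of_bool (?v i = V) * s T)"
      by (simp add: sum_distrib_right[symmetric])
  qed
  also have "\<dots> = 2 * (\<Sum>(T, i)\<in>corners V. s T)"
    unfolding corners_sum by (simp add: sum_distrib_left)
  finally show ?thesis .
qed

lemma sign_sum_parity:
  fixes s :: "'b \<Rightarrow> real"
  assumes "finite K" "\<And>x. x \<in> K \<Longrightarrow> s x = 1 \<or> s x = - 1"
  shows "\<exists>n :: int. sum s K = of_int n \<and> (even n \<longleftrightarrow> even (card K))"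
  using assms
proof (induction rule: finite_induct)
  case empty
  then show ?case by (auto intro!: exI[of _ 0])
next
  case (insert x K)
  then obtain n :: int where n: "sum s K = of_int n" "even n \<longleftrightarrow> even (card K)" by auto
  have "s x = 1 \<or> s x = - 1" using insert by blast
  then show ?case
  proof
    show ?thesis if "s x = 1" using that n insert(1,2) by (intro exI[of _ "n + 1"]) auto
    show ?thesis if "s x = - 1" using that n insert(1,2) by (intro exI[of _ "n - 1"]) auto
  qed
qed

text \<open>\<open>x + y\<close> is 2, 0 or -2, and half of it has the parity of the number of
  summands.\<close>

lemma two_signs:
  fixes x y :: real
  assumes "x = 1 \<or> x = - 1" "y = 1 \<or> y = - 1" "x + y = 2 * sum s K" "finite K" "\<And>e. e \<in> K \<Longrightarrow> s e = 1 \<or> s e = - 1"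
  shows "x = y \<longleftrightarrow> odd (card K)"
proof -
  obtain n :: int where n: "sum s K = of_int n" "even n \<longleftrightarrow> even (card K)" using sign_sum_parity assms(4,5) by metis
  then have "x + y = 2 * of_int n" using assms(3) by simp
  then consider "x = y" "n = 1 \<or> n = - 1" | "x = - y" "n = 0" "x \<noteq> y" using assms(1,2) by auto
  then show ?thesis using n(2) by cases auto
qed

text \<open>\<open>c i\<close> is the common sign of the tiles along side \<open>i\<close>, which
  runs from corner \<open>i\<close> to corner \<open>i + 1\<close>; so the sides meeting at corner
  \<open>i\<close> are \<open>i\<close> and \<open>i + 2\<close>.\<close>

theorem side_colours:
  fixes s :: "'t \<Rightarrow> real"
  assumes alt: "\<And>T T' p q. T \<in> I \<Longrightarrow> T' \<in> I \<Longrightarrow> (p, q) \<in> bd (vt T) \<Longrightarrow> (q, p) \<in> bd (vt T') \<Longrightarrow> s T' = - s T"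
    and sgn: "\<And>T. T \<in> I \<Longrightarrow> s T = 1 \<or> s T = - 1"
    and odd: "\<And>V i. V \<in> S \<Longrightarrow> V \<in> oedge \<Delta> i \<Longrightarrow> odd (card (corners V))"
  obtains c :: "3 \<Rightarrow> real" where "\<And>i. c i = 1 \<or> c i = - 1" "\<And>i. c (i + 2) + c i = 2 * (\<Sum>(T, j)\<in>corners (\<Delta> i). s T)"
    "\<And>i. c (i + 2) = c i \<longleftrightarrow> odd (card (corners (\<Delta> i)))"
    "(\<Sum>T\<in>I. s T * (\<Sum>i\<in>UNIV. dist (vt T i) (vt T (i + 1)))) = (\<Sum>i\<in>UNIV. c i * dist (\<Delta> i) (\<Delta> (i + 1)))"
proof -
  have sgno: "s (own p q) = 1 \<or> s (own p q) = - 1" if "(p, q) \<in> bd \<Delta>" for p q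
    using bd_big_owner[OF that] own_eq sgn by metis
  have subt: "pieces S (\<Delta> i) (\<Delta> (i + 1)) \<subseteq> bd \<Delta>" for i by (auto simp: bd_def)
  have const: "\<exists>x. (x = 1 \<or> x = - 1) \<and> (\<forall>(p, q)\<in>pieces S (\<Delta> i) (\<Delta> (i + 1)). s (own p q) = x)" for i
  proof -
    \<comment> \<open>The inclusions are carried through the induction so that a cut point is known
      to lie on the open side, where the parity assumption applies.\<close>
    have "pieces S P Q \<subseteq> pieces S (\<Delta> i) (\<Delta> (i + 1)) \<and> open_seg P Q \<subseteq> open_seg (\<Delta> i) (\<Delta> (i + 1)) \<longrightarrow>
       (\<exists>x. (x = 1 \<or> x = - 1) \<and> (\<forall>(p, q)\<in>pieces S P Q. s (own p q) = x))"
      if "P \<in> S" "Q \<in> S" "P \<noteq> Q" for P Q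
      using fin_S that
    proof (induction rule: pieces_induct)
      case (base P Q)
      then show ?case using sgno[of P Q] subt[of i] by (auto simp: pieces_base)
    next
      case (step P Q R)
      show ?case
      proof
        assume A: "pieces S P Q \<subseteq> pieces S (\<Delta> i) (\<Delta> (i + 1)) \<and> open_seg P Q \<subseteq> open_seg (\<Delta> i) (\<Delta> (i + 1))"
        obtain r where r: "0 < r" "r < 1" "R = P + of_real r * (Q - P)" using step(7) by (auto simp: open_seg_def)
        have i1: "open_seg P R \<subseteq> open_seg P Q"
        proof
          fix z assume "z \<in> open_seg P R"
          then have "z \<in> open_seg (P + of_real 0 * (Q - P)) (P + of_real r * (Q - P))" using r by simp
          then obtain x where "0 < x" "x < r" "z = P + of_real x * (Q - P)"
            by (rule open_seg_sub[rotated 3]) (use r in auto)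
          then show "z \<in> open_seg P Q" using r unfolding open_seg_def by (auto intro!: exI[of _ x])
        qed
        have i2: "open_seg R Q \<subseteq> open_seg P Q"
        proof
          fix z assume "z \<in> open_seg R Q"
          then have "z \<in> open_seg (P + of_real r * (Q - P)) (P + of_real 1 * (Q - P))" using r by simp
          then obtain x where "r < x" "x < 1" "z = P + of_real x * (Q - P)"
            by (rule open_seg_sub[rotated 3]) (use r in auto)
          then show "z \<in> open_seg P Q" using r unfolding open_seg_def by (auto intro!: exI[of _ x])
        qed
        note spl = pieces_split[OF step(4) step(3) step(7)]
        obtain x where x: "x = 1 \<or> x = - 1" "\<forall>(p, q)\<in>pieces S P R. s (own p q) = x"
          using step.IH(1) A i1 spl(1) by blast
        obtain y where y: "y = 1 \<or> y = - 1" "\<forall>(p, q)\<in>pieces S R Q. s (own p q) = y"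
          using step.IH(2) A i2 spl(1) by blast
        have Ri: "R \<in> open_seg (\<Delta> i) (\<Delta> (i + 1))" using A step(7) by blast
        then have Re: "R \<in> oedge \<Delta> i" using open_seg_oedge[OF ccw_big] by blast
        let ?h = "\<lambda>(p, q). of_bool (p = R) + of_bool (q = R) :: real"
        have c1: "sum ?h (pieces S P R) = 1"
          using pieces_count[OF fin_S step(1) step(3) step(5) step(3)] endpoint_not_open_seg[OF step(5)] step(5) by simp
        have c2: "sum ?h (pieces S R Q) = 1"
          using pieces_count[OF fin_S step(3) step(2) step(6) step(3)] endpoint_not_open_seg[OF step(6)] step(6) by simp
        \<comment> \<open>Exactly two boundary ends meet at \<open>R\<close>. They belong to the
          last piece of \<open>P R\<close> and to the first piece of \<open>R Q\<close>, so nothing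
          else enters the sum of \<open>colour_vertex\<close>.\<close>
        have tot: "sum ?h (bd \<Delta>) = 2"
        proof -
          have ne: "\<Delta> j \<noteq> R" for j
            using Re three_cases[of j i] side_vertex[of \<Delta> i] side_vertex[of \<Delta> "i + 1"] side_vertex[of \<Delta> "i + 2"] by (auto simp: oedge_def)
          have "R \<in> open_seg (\<Delta> j) (\<Delta> (j + 1)) \<longleftrightarrow> j = i" for j
            unfolding open_seg_oedge[OF ccw_big, symmetric] using Re three_cases[of j i] by (auto simp: oedge_def)
          then have "sum ?h (pieces S (\<Delta> j) (\<Delta> (j + 1))) = 2 * of_bool (j = i)" for j
            using pieces_count[OF fin_S corner_S corner_S ccw_distinct(1)[OF ccw_big] step(3), of j] ne by simp
          then have "sum ?h (bd \<Delta>) = (\<Sum>j\<in>UNIV. 2 * of_bool (j = i))" by (simp add: bd_sum[OF ccw_big])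
          then show ?thesis by (simp add: sum_three[of _ i])
        qed
        have PQ: "pieces S P Q \<subseteq> bd \<Delta>" using A subt by blast
        have cPQ: "sum g (pieces S P Q) = sum g (pieces S P R) + sum g (pieces S R Q)" for g :: "complex \<times> complex \<Rightarrow> real"
          unfolding spl(1) by (rule sum.union_disjoint) (use spl(2) pieces_finite[OF fin_S] in auto)
        have "sum ?h (bd \<Delta> - pieces S P Q) = 0"
          using sum.subset_diff[OF PQ bd_finite, of ?h] tot cPQ[of ?h] c1 c2 by simp
        then have z: "?h e = 0" if "e \<in> bd \<Delta> - pieces S P Q" for e
          using sum_nonneg_eq_0_iff[of "bd \<Delta> - pieces S P Q" ?h] bd_finite that by (auto split: prod.splits)
        let ?g = "\<lambda>(p, q). s (own p q) * (of_bool (p = R) + of_bool (q = R))"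
        have "sum ?g (bd \<Delta>) = sum ?g (pieces S P Q)"
          by (rule sum.mono_neutral_right) (use bd_finite PQ z in \<open>fastforce+\<close>)
        also have "\<dots> = x * sum ?h (pieces S P R) + y * sum ?h (pieces S R Q)"
          unfolding cPQ sum_distrib_left using x(2) y(2) by (intro arg_cong2[of _ _ _ _ "(+)"] sum.cong) auto
        finally have "x + y = 2 * (\<Sum>(T, i)\<in>corners R. s T)"
          using colour_vertex[where s = s, OF alt step(3) wind_big_boundary(1)[OF Re]] c1 c2 by simp
        then have "x = y \<longleftrightarrow> odd (card (corners R))"
          by (rule two_signs[OF x(1) y(1)]) (use fin_corners sgn in \<open>auto simp: corners_def\<close>)
        then have "x = y" using odd[OF step(3) Re] by simp
        then show "\<exists>x. (x = 1 \<or> x = - 1) \<and> (\<forall>(p, q)\<in>pieces S P Q. s (own p q) = x)"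
          using x y spl(1) by (intro exI[of _ x]) auto
      qed
    qed
    from this[OF corner_S corner_S ccw_distinct(1)[OF ccw_big], of i] show ?thesis by blast
  qed
  from choice[OF allI, OF const] obtain c
    where c0: "\<forall>i. (c i = 1 \<or> c i = - 1) \<and> (\<forall>(p, q)\<in>pieces S (\<Delta> i) (\<Delta> (i + 1)). s (own p q) = c i)" ..
  have c: "c i = 1 \<or> c i = - 1" for i using c0 by simp
  have c2: "s (own p q) = c i" if "(p, q) \<in> pieces S (\<Delta> i) (\<Delta> (i + 1))" for i p q
    using spec[OF c0, of i] that by auto
  have cv: "c (i + 2) + c i = 2 * (\<Sum>(T, j)\<in>corners (\<Delta> i). s T)" for i
  proof -
    let ?h = "\<lambda>(p, q). of_bool (p = \<Delta> i) + of_bool (q = \<Delta> i) :: real"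
    let ?g = "\<lambda>(p, q). s (own p q) * (of_bool (p = \<Delta> i) + of_bool (q = \<Delta> i))"
    have n: "\<Delta> i \<notin> open_seg (\<Delta> j) (\<Delta> (j + 1))" for j
    proof
      assume "\<Delta> i \<in> open_seg (\<Delta> j) (\<Delta> (j + 1))"
      then have "\<Delta> i \<in> oedge \<Delta> j" using open_seg_oedge[OF ccw_big] by blast
      then show False using three_cases[of i j] side_vertex[of \<Delta> j] side_vertex[of \<Delta> "j + 1"] side_vertex[of \<Delta> "j + 2"] by (auto simp: oedge_def)
    qed
    have e: "\<Delta> j = \<Delta> i \<longleftrightarrow> j = i" for j using ccw_inj[OF ccw_big] by blast
    have "sum ?g (pieces S (\<Delta> j) (\<Delta> (j + 1))) = c j * (of_bool (j = i) + of_bool (j + 1 = i))" for j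
    proof -
      have "sum ?g (pieces S (\<Delta> j) (\<Delta> (j + 1))) = c j * sum ?h (pieces S (\<Delta> j) (\<Delta> (j + 1)))"
        unfolding sum_distrib_left using c2 by (intro sum.cong) auto
      then show ?thesis using pieces_count[OF fin_S corner_S corner_S ccw_distinct(1)[OF ccw_big] corner_S, of i j] n e by simp
    qed
    then have "sum ?g (bd \<Delta>) = (\<Sum>j\<in>UNIV. c j * (of_bool (j = i) + of_bool (j + 1 = i)))"
      by (simp add: bd_sum[OF ccw_big])
    also have "\<dots> = c (i + 2) + c i" by (simp add: sum_three[of _ i])
    finally show ?thesis using colour_vertex[where s = s, OF alt corner_S wind_big_boundary(2)] by simp
  qed
  have par: "c (i + 2) = c i \<longleftrightarrow> odd (card (corners (\<Delta> i)))" for i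
    by (rule two_signs[OF c c cv]) (use fin_corners sgn in \<open>auto simp: corners_def\<close>)
  have "(\<Sum>T\<in>I. s T * (\<Sum>i\<in>UNIV. dist (vt T i) (vt T (i + 1)))) = (\<Sum>T\<in>I. \<Sum>(p, q)\<in>bd (vt T). s T * dist p q)"
  proof (rule sum.cong[OF refl])
    fix T assume T: "T \<in> I"
    have "(\<Sum>(p, q)\<in>bd (vt T). dist p q) = (\<Sum>i\<in>UNIV. dist (vt T i) (vt T (i + 1)))"
      by (rule bd_sum_edges[OF ccw_tile[OF T] vt_S[OF T]]) (blast intro: dist_additive)
    then show "s T * (\<Sum>i\<in>UNIV. dist (vt T i) (vt T (i + 1))) = (\<Sum>(p, q)\<in>bd (vt T). s T * dist p q)"
      by (simp add: sum_distrib_left[symmetric] case_prod_unfold)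
  qed
  also have "\<dots> = (\<Sum>(p, q)\<in>bd \<Delta>. s (own p q) * dist p q)"
  proof (rule edge_cancellation[where G = "\<lambda>T p q. s T * dist p q"])
    fix T T' p q assume "T \<in> I" "T' \<in> I" "(p, q) \<in> bd (vt T)" "(q, p) \<in> bd (vt T')"
    then have "s T' = - s T" by (rule alt)
    then show "s T * dist p q + s T' * dist q p = 0" by (simp add: dist_commute)
  qed
  also have "\<dots> = (\<Sum>i\<in>UNIV. c i * (\<Sum>(p, q)\<in>pieces S (\<Delta> i) (\<Delta> (i + 1)). dist p q))"
    unfolding bd_sum[OF ccw_big] sum_distrib_left using c2 by (intro sum.cong) auto
  also have "\<dots> = (\<Sum>i\<in>UNIV. c i * dist (\<Delta> i) (\<Delta> (i + 1)))"
    by (simp only: pieces_dist_sum[OF corner_S corner_S ccw_distinct(1)[OF ccw_big]])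
  finally show thesis using that[OF c cv par] by blast
qed

end

section \<open>Conjugation of roots of unity\<close>

definition ev :: "int poly \<Rightarrow> complex \<Rightarrow> complex" where
  "ev p x = poly (map_poly of_int p) x"

lemma ev_simps [simp]: "ev 0 x = 0" "ev 1 x = 1" "ev (p + q) x = ev p x + ev q x" "ev (p - q) x = ev p x - ev q x"
  "ev (- p) x = - ev p x" "ev (p * q) x = ev p x * ev q x" "ev (pCons a p) x = of_int a + x * ev p x"
  "ev (monom a k) x = of_int a * x ^ k" "ev [:a:] x = of_int a"
  by (simp_all add: ev_def hom_distribs poly_monom)

lemma ev_sum: "ev (sum f A) x = (\<Sum>i\<in>A. ev (f i) x)"
  by (induction A rule: infinite_finite_induct) simp_all

lemma ev_altdef: "ev p x = (\<Sum>i\<le>degree p. of_int (coeff p i) * x ^ i)"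
  unfolding ev_def by (simp add: poly_altdef)

definition Zadj :: "complex \<Rightarrow> complex set" where
  "Zadj w = range (\<lambda>p. ev p w)"

lemma Zadj_closed:
  assumes "a \<in> Zadj w" "b \<in> Zadj w"
  shows "a + b \<in> Zadj w" "a * b \<in> Zadj w"
proof -
  obtain p q where "a = ev p w" "b = ev q w" using assms by (auto simp: Zadj_def)
  then have "a + b = ev (p + q) w" "a * b = ev (p * q) w" by simp_all
  then show "a + b \<in> Zadj w" "a * b \<in> Zadj w" unfolding Zadj_def by (metis rangeI)+
qed

lemma Zadj_minus: "a \<in> Zadj w \<Longrightarrow> - a \<in> Zadj w"
  unfolding Zadj_def by (auto simp flip: ev_simps(5))

lemma Zadj_base: "of_int n \<in> Zadj w" "w \<in> Zadj w"
proof -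
  have "ev [:n:] w = of_int n" "ev [:0, 1:] w = w" by simp_all
  then show "of_int n \<in> Zadj w" "w \<in> Zadj w" by (metis Zadj_def rangeI)+
qed

lemma Zadj_power: "a \<in> Zadj w \<Longrightarrow> a ^ k \<in> Zadj w"
  using Zadj_base(1)[of 1 w] by (induction k) (auto intro: Zadj_closed)

lemma Zadj_sum: "(\<And>i. i \<in> A \<Longrightarrow> f i \<in> Zadj w) \<Longrightarrow> sum f A \<in> Zadj w"
  using Zadj_base(1)[of 0 w] by (induction A rule: infinite_finite_induct) (auto intro: Zadj_closed)

text \<open>Multiplication by an element of \<open>\<int>[w]\<close> acts on \<open>1, w, \<dots>, w^(N-1)\<close> by an integer matrix.\<close>

lemma Zadj_algebraic_int:
  assumes w: "w ^ N = 1" "N > 0" and z: "z \<in> Zadj w"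
  shows "algebraic_int z"
proof -
  obtain p where p: "z = ev p w" using z by (auto simp: Zadj_def)
  define A :: "int mat" where
    "A = mat N N (\<lambda>(i, j). \<Sum>m\<in>{m. m \<le> degree p \<and> (i + m) mod N = j}. coeff p m)"
  define B :: "complex mat" where "B = map_mat of_int A"
  define v where "v = vec N (\<lambda>j. w ^ j)"
  have A: "A \<in> carrier_mat N N" by (simp add: A_def)
  then have B: "B \<in> carrier_mat N N" by (simp add: B_def)
  have wm: "w ^ (m mod N) = w ^ m" for m
  proof -
    have "w ^ m = w ^ (m mod N + N * (m div N))" by (simp only: mod_mult_div_eq)
    also have "\<dots> = w ^ (m mod N)" by (simp only: power_add power_mult w(1) power_one mult_1_right)
    finally show ?thesis by simp
  qed
  have "B *\<^sub>v v = z \<cdot>\<^sub>v v"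
  proof (rule eq_vecI)
    fix i assume "i < dim_vec (z \<cdot>\<^sub>v v)"
    then have i: "i < N" by (simp add: v_def)
    have "(B *\<^sub>v v) $ i = (\<Sum>j\<in>{0..<N}. of_int (A $$ (i, j)) * w ^ j)"
      using i A by (simp add: B_def v_def scalar_prod_def)
    also have "\<dots> = (\<Sum>j\<in>{0..<N}. \<Sum>m\<in>{m\<in>{..degree p}. (i + m) mod N = j}. of_int (coeff p m) * w ^ ((i + m) mod N))"
      using i by (intro sum.cong refl) (auto simp: A_def sum_distrib_right)
    also have "\<dots> = (\<Sum>m\<in>{..degree p}. of_int (coeff p m) * w ^ ((i + m) mod N))"
      by (rule sum.group) (use w(2) in auto)
    also have "\<dots> = z * w ^ i"
      by (simp only: wm) (simp add: p ev_altdef sum_distrib_left sum_distrib_right power_add mult_ac)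
    finally show "(B *\<^sub>v v) $ i = (z \<cdot>\<^sub>v v) $ i" using i by (simp add: v_def)
  qed (use B in \<open>simp add: v_def\<close>)
  moreover have "v \<noteq> 0\<^sub>v N"
  proof
    assume "v = 0\<^sub>v N"
    then have "v $ 0 = 0" using w(2) by simp
    then show False using w(2) by (simp add: v_def)
  qed
  ultimately have "eigenvalue B z"
    unfolding eigenvalue_def eigenvector_def using B by (auto simp: v_def intro!: exI[of _ v])
  then have "poly (char_poly B) z = 0" using eigenvalue_root_char_poly[OF B] by simp
  moreover have "char_poly B = map_poly of_int (char_poly A)"
    unfolding B_def by (rule of_int_hom.char_poly_hom[OF A])
  moreover have "lead_coeff (char_poly A) = 1" using degree_monic_char_poly[OF A] by simp
  ultimately show ?thesis unfolding algebraic_int_altdef_ipoly by auto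
qed

text \<open>The quotient \<open>z\<close> is rational and an algebraic integer, hence an
  integer.\<close>

lemma Zadj_dvd:
  assumes w: "w ^ N = 1" "N > 0" and z: "z \<in> Zadj w" and m: "of_int m = of_int q * z" "q \<noteq> 0"
  shows "q dvd m"
proof -
  have "z = of_int m / of_int q" using m by simp
  then have "z \<in> \<rat>" by simp
  then have "z \<in> \<int>" using rational_algebraic_int_is_int Zadj_algebraic_int[OF w z] by blast
  then obtain k where "z = of_int k" by (auto elim: Ints_cases)
  then have "(of_int m :: complex) = of_int (q * k)" using m by simp
  then have "m = q * k" by (rule of_int_eq_iff[THEN iffD1])
  then show ?thesis by simp
qed

text \<open>In an integer polynomial of least degree that vanishes at \<open>z\<close> the constant
  term is nonzero, and it is a multiple of \<open>z\<close>.\<close>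

lemma Zadj_divides_int:
  assumes w: "w ^ N = 1" "N > 0" and z: "z \<in> Zadj w" "z \<noteq> 0"
  obtains m y where "m \<noteq> (0::int)" "y \<in> Zadj w" "z * y = of_int m"
proof -
  have "\<exists>p. ev p z = 0 \<and> p \<noteq> 0"
    using Zadj_algebraic_int[OF w z(1)] unfolding algebraic_int_altdef_ipoly ev_def[symmetric] by force
  then obtain p where p: "ev p z = 0" "p \<noteq> 0" and least: "\<And>q. ev q z = 0 \<Longrightarrow> q \<noteq> 0 \<Longrightarrow> degree p \<le> degree q"
    using ex_has_least_nat[of "\<lambda>p. ev p z = 0 \<and> p \<noteq> 0" _ degree] by blast
  obtain c q where cq: "p = pCons c q" by (cases p)
  have "c \<noteq> 0"
  proof
    assume "c = 0"
    then have "ev q z = 0" "q \<noteq> 0" using p cq z(2) by auto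
    then show False using least[of q] cq by simp
  qed
  moreover have "- ev q z \<in> Zadj w"
  proof -
    have "ev q z \<in> Zadj w" unfolding ev_altdef by (intro Zadj_sum Zadj_closed Zadj_base Zadj_power z)
    then show ?thesis by (rule Zadj_minus)
  qed
  moreover have "z * (- ev q z) = of_int c" using p(1) cq by (simp add: add_eq_0_iff)
  ultimately show thesis using that by blast
qed

section \<open>The Frobenius congruence and conjugation of integer relations\<close>

lemma prime_power_add:
  fixes a b :: "'a::comm_ring_1"
  assumes q: "prime q"
  shows "(a + b) ^ q = b ^ q + (a ^ q + of_nat q * (\<Sum>k\<in>{1..<q}. of_nat ((q choose k) div q) * a ^ k * b ^ (q - k)))"
proof -
  have q0: "q > 0" using q by (rule prime_gt_0_nat)
  have "(a + b) ^ q = (\<Sum>k\<le>q. of_nat (q choose k) * a ^ k * b ^ (q - k))"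
    by (rule binomial_ring)
  also have "{..q} = insert 0 (insert q {1..<q})" using q0 by auto
  also have "(\<Sum>k\<in>insert 0 (insert q {1..<q}). of_nat (q choose k) * a ^ k * b ^ (q - k)) =
      b ^ q + (a ^ q + (\<Sum>k\<in>{1..<q}. of_nat (q choose k) * a ^ k * b ^ (q - k)))"
    using q0 by simp
  also have "(\<Sum>k\<in>{1..<q}. of_nat (q choose k) * a ^ k * b ^ (q - k)) =
      of_nat q * (\<Sum>k\<in>{1..<q}. of_nat ((q choose k) div q) * a ^ k * b ^ (q - k))"
    unfolding sum_distrib_left
  proof (intro sum.cong refl)
    fix k assume "k \<in> {1..<q}"
    then have "q dvd (q choose k)" using q by (intro dvd_choose_prime) auto
    then have "of_nat (q choose k) = (of_nat q * of_nat ((q choose k) div q) :: 'a)"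
      by (metis dvd_mult_div_cancel of_nat_mult)
    then show "of_nat (q choose k) * a ^ k * b ^ (q - k) =
      of_nat q * (of_nat ((q choose k) div q) * a ^ k * b ^ (q - k))" by (simp add: mult.assoc)
  qed
  finally show ?thesis .
qed

lemma fermat_int:
  assumes q: "prime q" shows "int q dvd a ^ q - a"
proof -
  have q0: "q > 0" using q by (rule prime_gt_0_nat)
  have step: "int q dvd a ^ q - a \<longleftrightarrow> int q dvd (1 + a) ^ q - (1 + a)" for a
  proof -
    obtain s where "(1 + a) ^ q = a ^ q + (1 + int q * s)" using prime_power_add[OF q, of 1 a] by auto
    then have "(1 + a) ^ q - (1 + a) = (a ^ q - a) + int q * s" by simp
    then show ?thesis by (simp only:) (simp add: dvd_add_left_iff)
  qed
  show ?thesis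
  proof (induction a rule: int_induct[of _ 0])
    case base
    then show ?case using q0 by (simp add: power_0_left)
  next
    case (step1 i)
    then show ?case using step[of i] by (simp add: add.commute)
  next
    case (step2 i)
    then show ?case using step[of "i - 1"] by simp
  qed
qed

text \<open>Modulo a prime \<open>q\<close> the \<open>q\<close>-th power is additive and, by
  Fermat, fixes integer coefficients. The congruence is expressed by exhibiting the quotient
  \<open>r\<close> in the ring generated by \<open>w\<close>.\<close>

lemma frobenius_Zadj:
  assumes q: "prime q" and x: "x \<in> Zadj w"
  shows "\<exists>r\<in>Zadj w. ev h x ^ q - ev h (x ^ q) = of_nat q * r"
proof (induction h)
  case 0
  then show ?case using Zadj_base(1)[of 0 w] q by (intro bexI[of _ 0]) (auto simp: power_0_left prime_gt_0_nat)
next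
  case (pCons a h)
  then obtain r where r: "r \<in> Zadj w" "ev h x ^ q - ev h (x ^ q) = of_nat q * r" by blast
  let ?y = "x * ev h x"
  have evh: "ev h x \<in> Zadj w" unfolding ev_altdef by (intro Zadj_sum Zadj_closed Zadj_base Zadj_power x)
  have q0: "q > 0" using q by (rule prime_gt_0_nat)
  define s where "s = (\<Sum>k\<in>{1..<q}. of_nat ((q choose k) div q) * (of_int a :: complex) ^ k * ?y ^ (q - k))"
  have s: "s \<in> Zadj w"
    unfolding s_def using Zadj_base(1)[of "int _" w] by (intro Zadj_sum Zadj_closed Zadj_power Zadj_base x evh) simp
  have 1: "(of_int a + ?y) ^ q = ?y ^ q + (of_int a ^ q + of_nat q * s)" unfolding s_def by (rule prime_power_add[OF q])
  obtain b where b: "a ^ q - a = int q * b"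
  proof -
    have "int q dvd a ^ q - a" by (rule fermat_int[OF q])
    then show ?thesis using that by auto
  qed
  have b': "(of_int a :: complex) ^ q = of_int a + of_nat q * of_int b"
    by (metis add_diff_cancel_left' b diff_add_cancel of_int_add of_int_mult of_int_of_nat_eq of_int_power add.commute)
  have "ev (pCons a h) x ^ q - ev (pCons a h) (x ^ q) =
      of_nat q * (x ^ q * r + (of_int b + s))"
    using r(2) by (simp add: 1 b' power_mult_distrib algebra_simps)
  moreover have "x ^ q * r + (of_int b + s) \<in> Zadj w"
    by (intro Zadj_closed Zadj_power Zadj_base x r s)
  ultimately show ?case by blast
qed

lemma power_mod_order:
  fixes w :: complex
  assumes "w ^ N = 1" shows "w ^ (m mod N) = w ^ m"
proof -
  have "w ^ m = w ^ (m mod N + N * (m div N))" by (simp only: mod_mult_div_eq)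
  also have "\<dots> = w ^ (m mod N)" by (simp only: power_add power_mult assms power_one mult_1_right)
  finally show ?thesis by simp
qed

text \<open>A prime divisor \<open>p\<close> of \<open>M\<close> divides exactly one of the summands
  \<open>k\<close> and \<open>N * t\<close>: if it does not divide \<open>k\<close>, it is a factor
  of \<open>t\<close>; if it does, it divides neither \<open>N\<close>, which is coprime to
  \<open>k\<close>, nor \<open>t\<close>.\<close>

lemma coprime_representative:
  fixes k N M :: nat
  assumes "coprime k N" "M > 0"
  obtains K where "[K = k] (mod N)" "coprime K M" "K > 0"
proof -
  define t where "t = \<Prod>{p \<in> prime_factors M. \<not> p dvd k}"
  let ?K = "k + N * t"
  have cop: "coprime ?K M"
  proof (rule ccontr)
    assume "\<not> coprime ?K M"
    then obtain p where p: "prime p" "p dvd ?K" "p dvd M" using prime_factor_nat[of "gcd ?K M"] by (auto simp: coprime_iff_gcd_eq_1)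
  show False
    proof (cases "p dvd k")
      case True
      then have "p dvd N * t" using p(2) by (simp add: dvd_add_right_iff)
      moreover have "\<not> p dvd N" using True assms(1) p(1) by (metis coprime_common_divisor not_prime_unit)
      ultimately have "p dvd t" using p(1) by (simp add: prime_dvd_mult_iff)
      then obtain p' where "p' \<in> prime_factors M" "\<not> p' dvd k" "p dvd p'"
        unfolding t_def using p(1) by (subst (asm) prime_dvd_prod_iff) auto
      then show False using p(1) True by (metis in_prime_factors_iff primes_dvd_imp_eq)
    next
      case False
      then have "p \<in> {p \<in> prime_factors M. \<not> p dvd k}" using p assms(2) by (auto simp: in_prime_factors_iff)
      then have "p dvd t" unfolding t_def by (intro dvd_prodI) auto
      then show False using p(2) False by (simp add: dvd_add_left_iff)
    qed
  qed
  show thesis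
  proof (cases "?K = 0")
    case False
    then show thesis using that[of ?K] cop by (simp add: cong_def)
  next
    case True
    then have k: "k = 0" and M: "M = 1" using cop by auto
    then have "N = 1" using assms(1) by simp
    then show thesis using that[of 1] M by simp
  qed
qed

text \<open>Galois conjugation of roots of unity: by Frobenius the value at \<open>w^q\<close> lies in \<open>q\<int>[w]\<close>, and a nonzero
  value is divisible by few primes \<open>q\<close> only; primes to be avoided are avoided by changing \<open>k\<close> modulo \<open>N\<close>.\<close>

theorem root_of_unity_conjugate:
  assumes w: "w ^ N = 1" "N > 0" and k: "coprime k N" and h: "ev h w = 0"
  shows "ev h (w ^ k) = 0"
proof -
  define Y where "Y j = ev h (w ^ j)" for j
  have wZ: "w ^ j \<in> Zadj w" for j by (intro Zadj_power Zadj_base)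
  have YZ: "Y j \<in> Zadj w" for j unfolding Y_def ev_altdef by (intro Zadj_sum Zadj_closed Zadj_base Zadj_power)
  have Ymod: "Y (j mod N) = Y j" for j by (simp add: Y_def power_mod_order[OF w(1)])
  have "\<forall>j. \<exists>m :: int. m \<noteq> 0 \<and> (Y j \<noteq> 0 \<longrightarrow> (\<exists>y\<in>Zadj w. Y j * y = of_int m))"
  proof
    fix j
    show "\<exists>m :: int. m \<noteq> 0 \<and> (Y j \<noteq> 0 \<longrightarrow> (\<exists>y\<in>Zadj w. Y j * y = of_int m))"
    proof (cases "Y j = 0")
      case True
      then show ?thesis by (auto intro: exI[of _ 1])
    next
      case False
      obtain m y where "m \<noteq> (0::int)" "y \<in> Zadj w" "Y j * y = of_int m"
        by (rule Zadj_divides_int[OF w YZ False])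
      then show ?thesis by (intro exI[of _ m]) auto
    qed
  qed
  from choice[OF this] obtain m :: "nat \<Rightarrow> int"
    where m0: "\<forall>j. m j \<noteq> 0 \<and> (Y j \<noteq> 0 \<longrightarrow> (\<exists>y\<in>Zadj w. Y j * y = of_int (m j)))" ..
  have m: "m j \<noteq> 0" "Y j \<noteq> 0 \<Longrightarrow> \<exists>y\<in>Zadj w. Y j * y = of_int (m j)" for j
    using spec[OF m0, of j] by simp_all
  \<comment> \<open>Contains the primes to be avoided: a prime that divides a nonzero
    \<open>Y j\<close> in the ring divides its integer multiple \<open>m j\<close>.\<close>
  define M where "M = nat \<bar>\<Prod>j<N. m j\<bar>"
  have M0: "M > 0" using m(1) by (simp add: M_def)
  have step: "Y (i * q) = 0" if q: "prime q" "\<not> q dvd M" and i: "Y i = 0" for i q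
  proof (rule ccontr)
    assume nz: "Y (i * q) \<noteq> 0"
    let ?j = "i * q mod N"
    have jN: "?j < N" using w(2) by simp
    obtain r where r: "r \<in> Zadj w" "ev h (w ^ i) ^ q - ev h ((w ^ i) ^ q) = of_nat q * r"
      using frobenius_Zadj[OF q(1) wZ] by blast
    have q0: "q > 0" using q(1) by (rule prime_gt_0_nat)
    have "- ev h ((w ^ i) ^ q) = of_nat q * r" using r(2) i q0 by (simp add: Y_def zero_power)
    then have "ev h ((w ^ i) ^ q) = - (of_nat q * r)" by (metis minus_minus)
    then have Yq: "Y (i * q) = of_nat q * (- r)" by (simp add: Y_def power_mult)
    have "Y ?j \<noteq> 0" using nz by (simp only: Ymod) simp
    then obtain y where y: "y \<in> Zadj w" "Y ?j * y = of_int (m ?j)" using m(2) by blast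
    have "of_int (m ?j) = Y (i * q) * y" using y(2) by (simp only: Ymod)
    also have "\<dots> = of_int (int q) * (- r * y)" using Yq by simp
    finally have "of_int (m ?j) = of_int (int q) * (- r * y)" .
    moreover have "- r * y \<in> Zadj w" using r(1) y(1) by (intro Zadj_closed Zadj_minus)
    ultimately have "int q dvd m ?j" using Zadj_dvd[OF w] q0 by force
    also have "m ?j dvd (\<Prod>j<N. m j)" using jN by (intro dvd_prodI) auto
    finally have "q dvd M" unfolding M_def by (simp add: nat_dvd_iff)
    then show False using q(2) by simp
  qed
  obtain K where K: "[K = k] (mod N)" "coprime K M" "K > 0" using coprime_representative[OF k M0] by blast
  \<comment> \<open>\<open>K\<close> is a product of admissible primes, and each of them is one step
    starting from the given relation \<open>Y 1 = 0\<close>.\<close>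
  have "Y K = 0" using K(2,3)
  proof (induction K rule: less_induct)
    case (less K)
    show ?case
    proof (cases "K = 1")
      case True
      then show ?thesis using h by (simp add: Y_def)
    next
      case False
      then obtain q where q: "prime q" "q dvd K" using prime_factor_nat by blast
      then obtain L where L: "K = L * q" by (metis dvd_def mult.commute)
      have "L < K" "L > 0" using L less.prems prime_gt_1_nat[OF q(1)] by auto
      moreover have "coprime L M" using less.prems(1) L by simp
      ultimately have "Y L = 0" using less.IH by blast
      moreover have "\<not> q dvd M" using less.prems(1) q by (metis coprime_common_divisor not_prime_unit)
      ultimately show ?thesis using step[OF q(1)] L by blast
    qed
  qed
  then have "Y (K mod N) = 0" by (simp only: Ymod)
  then have "Y (k mod N) = 0" using K(1) by (simp add: cong_def)
  then show ?thesis by (simp only: Ymod) (simp add: Y_def)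
qed

section \<open>From relations between roots of unity to a semilinear map of the plane\<close>

lemma common_denominator:
  fixes r :: "nat \<Rightarrow> rat"
  assumes "finite E"
  obtains D :: int and z where "D \<noteq> 0" "\<And>e. e \<in> E \<Longrightarrow> of_int D * r e = of_int (z e)"
proof -
  have "\<exists>D :: int. D \<noteq> 0 \<and> (\<forall>e\<in>E. \<exists>z. of_int D * r e = of_int z)"
    using assms
  proof (induction rule: finite_induct)
    case empty
    then show ?case by (intro exI[of _ 1]) auto
  next
    case (insert x E)
    then obtain D :: int where D: "D \<noteq> 0" "\<forall>e\<in>E. \<exists>z. of_int D * r e = of_int z" by blast
    obtain a b where ab: "quotient_of (r x) = (a, b)" by force
    then have b: "b > 0" "r x = of_int a / of_int b"
      using quotient_of_denom_pos quotient_of_div by blast+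
    have "\<exists>z. of_int (D * b) * r e = of_int z" if "e \<in> insert x E" for e
    proof (cases "e = x")
      case True
      then have "of_int (D * b) * r e = of_int (D * a)" using b by simp
      then show ?thesis by blast
    next
      case False
      then obtain z where "of_int D * r e = of_int z" using D(2) \<open>e \<in> insert x E\<close> by blast
      then have "of_int (D * b) * r e = of_int (z * b)" by (simp add: mult_ac)
      then show ?thesis by blast
    qed
    then show ?case using D(1) b(1) by (intro exI[of _ "D * b"]) auto
  qed
  then obtain D :: int where D: "D \<noteq> 0" "\<forall>e\<in>E. \<exists>z. of_int D * r e = of_int z" by blast
  from bchoice[OF D(2)] show thesis using that D(1) by blast
qed

lemma rational_relation_conjugate:
  fixes w :: complex
  assumes w: "w ^ N = 1" "N > 0" and k: "coprime k N" and E: "finite E"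
    and rel: "(\<Sum>e\<in>E. of_rat (r e) * w ^ e) = 0"
  shows "(\<Sum>e\<in>E. of_rat (r e) * w ^ (k * e)) = 0"
proof -
  obtain D :: int and z where D: "D \<noteq> 0" "\<And>e. e \<in> E \<Longrightarrow> of_int D * r e = of_int (z e)"
    using common_denominator[OF E, of r] by blast
  have z: "of_int (z e) = (of_int D * of_rat (r e) :: complex)" if "e \<in> E" for e
    using D(2)[OF that] by (metis of_rat_mult of_rat_of_int_eq)
  define h where "h = (\<Sum>e\<in>E. monom (z e) e)"
  have h: "ev h x = of_int D * (\<Sum>e\<in>E. of_rat (r e) * x ^ e)" for x
    unfolding h_def ev_sum sum_distrib_left by (intro sum.cong) (auto simp: z)
  have "ev h (w ^ k) = 0" by (rule root_of_unity_conjugate[OF w k]) (simp add: h rel)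
  then show ?thesis using D(1) by (simp add: h power_mult)
qed

interpretation qc: vector_space "\<lambda>(r::rat) (z::complex). of_rat r * z"
  by unfold_locales (simp_all add: algebra_simps of_rat_add of_rat_mult)

interpretation qr: vector_space "\<lambda>(r::rat) (x::real). of_rat r * x"
  by unfold_locales (simp_all add: algebra_simps of_rat_add of_rat_mult)

interpretation qcr: vector_space_pair "\<lambda>(r::rat) (z::complex). of_rat r * z" "\<lambda>(r::rat) (x::real). of_rat r * x" ..

text \<open>Rational relations between the powers of \<open>w\<close> persist when \<open>w\<close>
  is replaced by \<open>w ^ k\<close>, so values prescribed on a basis of their span are right on
  all powers. The functional is extended to all complex numbers because the tile vertices need not
  lie in the cyclotomic field.\<close>

lemma conjugate_functional:
  fixes w :: complex
  assumes w: "w ^ N = 1" "N > 0" and k: "coprime k N"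
  obtains g :: "complex \<Rightarrow> real" where "\<And>x y. g (x + y) = g x + g y" "\<And>i. g (w ^ i) = Re (w ^ (k * i))"
proof -
  let ?V = "range (\<lambda>i. w ^ i)"
  obtain B where B: "B \<subseteq> ?V" "qc.independent B" "?V \<subseteq> qc.span B" by (rule qc.maximal_independent_subset[of ?V])
  define e where "e b = (SOME i. b = w ^ i)" for b
  have e: "w ^ e b = b" if "b \<in> B" for b
  proof -
    from B(1) that obtain i where "b = w ^ i" by auto
    then show ?thesis unfolding e_def by (rule someI[of "\<lambda>i. b = w ^ i", symmetric])
  qed
  obtain g where g: "Vector_Spaces.linear (\<lambda>(r::rat) (z::complex). of_rat r * z) (\<lambda>(r::rat) (x::real). of_rat r * x) g"
    "\<forall>b\<in>B. g b = Re (w ^ (k * e b))" using qcr.linear_independent_extend[OF B(2), of "\<lambda>b. Re (w ^ (k * e b))"] by blast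
  interpret g: Vector_Spaces.linear "\<lambda>(r::rat) (z::complex). of_rat r * z" "\<lambda>(r::rat) (x::real). of_rat r * x" g
    by (rule g(1))
  have "g (w ^ i) = Re (w ^ (k * i))" for i
  proof -
    have "w ^ i \<in> qc.span B" using B(3) by blast
    then obtain t r where t: "finite t" "t \<subseteq> B" "w ^ i = (\<Sum>b\<in>t. of_rat (r b) * b)"
      unfolding qc.span_explicit by blast
    have inj: "inj_on e t" using e t(2) by (metis inj_onI subsetD)
    define E where "E = e ` t"
    \<comment> \<open>Coefficients collected by exponent, with 1 subtracted at \<open>i\<close>: the
      expansion of \<open>w ^ i\<close> becomes a vanishing relation, also when \<open>i\<close>
      itself is one of the exponents.\<close>
    define s where "s j = (\<Sum>b\<in>{b\<in>t. e b = j}. r b) - of_bool (j = i)" for j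
    have fE: "finite (insert i E)" using t(1) by (simp add: E_def)
    have triple: "(\<Sum>j\<in>insert i E. of_rat (s j) * x ^ j) = (\<Sum>b\<in>t. of_rat (r b) * x ^ e b) - x ^ i" for x :: complex
    proof -
      have "(\<Sum>j\<in>insert i E. of_rat (s j) * x ^ j) =
          (\<Sum>j\<in>insert i E. \<Sum>b\<in>{b\<in>t. e b = j}. of_rat (r b) * x ^ e b) - (\<Sum>j\<in>insert i E. of_bool (j = i) * x ^ j)"
        unfolding sum_subtractf[symmetric]
        by (intro sum.cong refl) (auto simp: s_def of_rat_diff of_rat_sum sum_distrib_left sum_distrib_right algebra_simps)
      also have "(\<Sum>j\<in>insert i E. \<Sum>b\<in>{b\<in>t. e b = j}. of_rat (r b) * x ^ e b) = (\<Sum>b\<in>t. of_rat (r b) * x ^ e b)"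
        by (rule sum.group[OF t(1) fE]) (auto simp: E_def)
      also have "(\<Sum>j\<in>insert i E. of_bool (j = i) * x ^ j) = x ^ i"
        using fE by (simp add: sum.remove[of _ i])
      finally show ?thesis .
    qed
    have "(\<Sum>b\<in>t. of_rat (r b) * w ^ e b) = w ^ i" unfolding t(3) using t(2) e by (intro sum.cong) auto
    then have "(\<Sum>j\<in>insert i E. of_rat (s j) * w ^ j) = 0" using triple by simp
    from rational_relation_conjugate[OF w k fE this]
    have c: "w ^ (k * i) = (\<Sum>b\<in>t. of_rat (r b) * w ^ (k * e b))" using triple[of "w ^ k"] by (simp add: power_mult)
    have "g (w ^ i) = (\<Sum>b\<in>t. of_rat (r b) * g b)" unfolding t(3) by (simp add: g.sum g.scale)
    also have "\<dots> = (\<Sum>b\<in>t. of_rat (r b) * Re (w ^ (k * e b)))" using g(2) t(2) by (intro sum.cong) auto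
    also have "\<dots> = Re (w ^ (k * i))"
    proof -
      have "Re (of_rat q * z) = of_rat q * Re z" for q z
      proof -
        have "complex_of_rat q = of_real (of_rat q)" by (cases q) (simp add: of_rat_rat)
        then show ?thesis by simp
      qed
      then show ?thesis unfolding c by simp
    qed
    finally show ?thesis .
  qed
  then show thesis using that g.add by blast
qed

lemma cnj_root:
  assumes "w ^ N = 1" "N > 0"
  shows "cnj w * w = 1"
proof -
  have "cmod w ^ N = 1" using assms(1) by (metis norm_one norm_power)
  then have "cmod w = 1" using assms(2) power_eq_1_iff[of "cmod w" N] by simp
  then show ?thesis using complex_norm_square[of w] by (simp add: mult.commute)
qed

lemma sum_periodic_shift:
  fixes f :: "nat \<Rightarrow> complex"
  assumes "f N = f 0"
  shows "(\<Sum>j<N. f (Suc j)) = (\<Sum>j<N. f j)"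
  using sum.lessThan_Suc[of f N] sum.lessThan_Suc_shift[of f N] assms by simp

text \<open>A Reynolds operator turns the functional into a semilinear map.\<close>

theorem conjugation_map:
  fixes w :: complex
  assumes w: "w ^ N = 1" "N > 0" and k: "coprime k N"
  obtains \<Phi> :: "complex \<Rightarrow> complex" where "\<And>x y. \<Phi> (x + y) = \<Phi> x + \<Phi> y"
    "\<And>z. \<Phi> (w * z) = w ^ k * \<Phi> z" "\<And>t. \<Phi> (of_real t) \<in> \<real>" "\<Phi> 1 \<noteq> 0"
proof -
  obtain g :: "complex \<Rightarrow> real" where g: "\<And>x y. g (x + y) = g x + g y" "\<And>i. g (w ^ i) = Re (w ^ (k * i))"
    by (rule conjugate_functional[OF w k]) blast
  \<comment> \<open>Symmetric under complex conjugation; this makes the averaged map real on the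
    real axis.\<close>
  define G where "G z = g z + g (cnj z)" for z
  have Gadd: "G (x + y) = G x + G y" for x y by (simp add: G_def g(1))
  have Gcnj: "G (cnj z) = G z" for z by (simp add: G_def)
  \<comment> \<open>\<open>cnj w\<close> is the inverse of \<open>w\<close>. The terms are averaged
    over rotations by powers of \<open>w\<close> with a twist by powers of \<open>w ^ k\<close>; as
    they are periodic in \<open>j\<close>, a shift of \<open>j\<close> pulls out one factor
    \<open>w ^ k\<close>.\<close>
  define f where "f z j = of_real (G (z * cnj w ^ j)) * w ^ (k * j)" for z j
  define \<Phi> where "\<Phi> z = (\<Sum>j<N. f z j)" for z
  have cw: "cnj w * w = 1" by (rule cnj_root[OF w])
  have cwN: "cnj w ^ N = 1" using w(1) by (metis complex_cnj_one complex_cnj_power)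
  have wkN: "w ^ (k * N) = 1" by (simp add: w(1) power_mult mult.commute[of k])
  have per: "f z N = f z 0" for z by (simp add: f_def cwN wkN)
  have add: "\<Phi> (x + y) = \<Phi> x + \<Phi> y" for x y
    by (simp add: \<Phi>_def f_def Gadd distrib_right sum.distrib)
  have mult: "\<Phi> (w * z) = w ^ k * \<Phi> z" for z
  proof -
    have "f (w * z) (Suc j) = w ^ k * f z j" for j
    proof -
      have "w * z * cnj w ^ Suc j = z * cnj w ^ j * (cnj w * w)" by (simp add: mult_ac)
      then have e: "w * z * cnj w ^ Suc j = z * cnj w ^ j" by (simp only: cw mult_1_right)
      show ?thesis unfolding f_def e by (simp add: power_add mult_ac)
    qed
    then show ?thesis unfolding \<Phi>_def sum_distrib_left by (subst sum_periodic_shift[symmetric, OF per]) simp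
  qed
  have real: "\<Phi> (of_real t) \<in> \<real>" for t
  proof -
    have wc: "w ^ (N - j) = cnj w ^ j" if "j \<le> N" for j
    proof -
      have "w ^ (N - j) * w ^ j * cnj w ^ j = cnj w ^ j" using that w(1) by (simp add: power_add[symmetric])
      moreover have "w ^ j * cnj w ^ j = 1" using cw by (simp add: power_mult_distrib[symmetric] mult.commute)
      ultimately show ?thesis by (simp add: mult.assoc)
    qed
    have cf: "cnj (f (of_real t) j) = f (of_real t) (N - j)" if "j \<le> N" for j
    proof -
      have "cnj (of_real t * cnj w ^ (N - j)) = of_real t * cnj w ^ j" using wc[OF that] by simp
      then have 1: "G (of_real t * cnj w ^ (N - j)) = G (of_real t * cnj w ^ j)" by (metis Gcnj)
      have "w ^ (k * (N - j)) = (w ^ (N - j)) ^ k" by (metis mult.commute power_mult)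
      also have "\<dots> = cnj (w ^ (k * j))" unfolding wc[OF that] by (simp add: power_mult mult.commute[of k] flip: power_mult)
      finally show ?thesis by (simp add: f_def 1)
    qed
    have "cnj (\<Phi> (of_real t)) = (\<Sum>j<N. f (of_real t) (N - j))" unfolding \<Phi>_def by (simp add: cf)
    also have "\<dots> = (\<Sum>j<N. f (of_real t) (Suc j))"
      by (rule sum.reindex_bij_witness[of _ "\<lambda>j. N - Suc j" "\<lambda>j. N - Suc j"]) (auto simp: Suc_diff_Suc)
    also have "\<dots> = \<Phi> (of_real t)" unfolding \<Phi>_def by (rule sum_periodic_shift[OF per])
    finally show ?thesis by (simp add: Reals_cnj_iff)
  qed
  \<comment> \<open>The summands have real parts that are twice squares, and the one for
    \<open>j = 0\<close> is 2.\<close>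
  have "\<Phi> 1 \<noteq> 0"
  proof
    assume 0: "\<Phi> 1 = 0"
    have "Re (f 1 j) = 2 * (Re (w ^ (k * j)))\<^sup>2" for j
    proof -
      have "cnj w ^ j = w ^ ((N - 1) * j)"
      proof -
        have "cnj w = w ^ (N - 1)"
        proof -
          have "w ^ (N - 1) * w = 1" using w power_Suc2[of w "N - 1"] by simp
          then have "cnj w = (w ^ (N - 1) * w) * cnj w" by (simp only: mult_1_left)
          also have "\<dots> = w ^ (N - 1) * (cnj w * w)" by (simp only: mult_ac)
          finally show ?thesis by (simp only: cw mult_1_right)
        qed
        then show ?thesis by (simp add: power_mult)
      qed
      then have "g (cnj w ^ j) = Re (w ^ (k * ((N - 1) * j)))" using g(2) by simp
      also have "w ^ (k * ((N - 1) * j)) = (w ^ ((N - 1) * j)) ^ k" by (metis mult.commute power_mult)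
      also have "\<dots> = cnj (w ^ (k * j))" unfolding \<open>cnj w ^ j = w ^ ((N - 1) * j)\<close>[symmetric] by (simp add: mult.commute[of k] flip: power_mult)
      finally have "g (cnj w ^ j) = Re (w ^ (k * j))" by (simp only: cnj.sel)
      moreover have "g (cnj (cnj w ^ j)) = Re (w ^ (k * j))" using g(2) by simp
      ultimately have "G (cnj w ^ j) = 2 * Re (w ^ (k * j))" by (simp add: G_def)
      then show ?thesis by (simp add: f_def power2_eq_square)
    qed
    then have "Re (\<Phi> 1) = (\<Sum>j<N. 2 * (Re (w ^ (k * j)))\<^sup>2)" by (simp add: \<Phi>_def)
    also have "\<dots> \<ge> 2 * (Re (w ^ (k * 0)))\<^sup>2"
      using w(2) by (intro member_le_sum) auto
    finally have "Re (\<Phi> 1) \<ge> 2" by simp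
    then show False using 0 by simp
  qed
  then show thesis using that add mult real by blast
qed

section \<open>Dissections into congruent triangles\<close>

lemma edge_rotation:
  assumes "ccw v"
  shows "v (i + 2) - v i = of_real (dist (v i) (v (i + 2)) / dist (v i) (v (i + 1))) * cis (ang v i) * (v (i + 1) - v i)"
proof -
  let ?q = "v (i + 2) - v i" and ?p = "v (i + 1) - v i"
  have p: "?p \<noteq> 0" using ccw_distinct[OF assms, of i] by simp
  have "?q / ?p = of_real (cmod (?q / ?p)) * cis (Arg (?q / ?p))"
    by (metis rcis_cmod_Arg rcis_def)
  then have "?q = of_real (cmod (?q / ?p)) * cis (ang v i) * ?p"
    unfolding ang_def using p by (metis nonzero_eq_divide_eq)
  moreover have "cmod (?q / ?p) = dist (v i) (v (i + 2)) / dist (v i) (v (i + 1))"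
    by (simp add: norm_divide dist_norm norm_minus_commute)
  ultimately show ?thesis by simp
qed

lemma crs_cis: "crs p (of_real r * cis t * p) = r * sin t * (cmod p)\<^sup>2"
  unfolding cmod_power2 by (simp add: crs_def power2_eq_square algebra_simps)

lemma area_sine:
  assumes "ccw v"
  shows "side v 1 (v 3) = dist (v i) (v (i + 1)) * dist (v i) (v (i + 2)) * sin (ang v i)"
proof -
  have p: "dist (v i) (v (i + 1)) \<noteq> 0" using ccw_distinct[OF assms, of i] by simp
  have "side v 1 (v 3) = crs (v (i + 1) - v i) (v (i + 2) - v i)"
    using side_opposite[of v i] by (simp add: side_def)
  also have "\<dots> = dist (v i) (v (i + 2)) / dist (v i) (v (i + 1)) * sin (ang v i) * (dist (v i) (v (i + 1)))\<^sup>2"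
    by (subst edge_rotation[OF assms]) (simp only: crs_cis, simp add: dist_norm norm_minus_commute)
  finally show ?thesis using p by (simp add: power2_eq_square)
qed

text \<open>The Chebyshev polynomial of the second kind as the sum of all
  \<open>w ^ (j - 2 s)\<close>, with exponents shifted by multiples of \<open>N\<close> to stay
  natural. It places the tile sides, in a suitable unit, in the ring generated by \<open>w\<close>,
  so that their conjugates can be computed.\<close>

lemma power_sum_sine:
  fixes x :: real
  assumes "w = cis x" "w ^ N = 1" "N \<ge> 2" "sin x \<noteq> 0"
  shows "(\<Sum>s<Suc j. w ^ (j + (N - 2) * s)) = of_real (sin (Suc j * x) / sin x)"
proof -
  have w2: "w ^ (N - 2) = cis (- 2 * x)"
  proof -
    have "w ^ (N - 2) * w ^ 2 = w ^ (N - 2 + 2)" by (simp only: power_add)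
    also have "N - 2 + 2 = N" using assms(3) by simp
    finally have "w ^ (N - 2) * w ^ 2 = 1" by (simp only: assms(2))
    then have "w ^ (N - 2) * cis (2 * x) * cis (- (2 * x)) = cis (- (2 * x))" by (simp add: assms(1) Complex.DeMoivre)
    then show ?thesis by (simp add: cis_mult mult.assoc)
  qed
  have t: "w ^ (j + (N - 2) * s) = cis ((real j - 2 * s) * x)" for s
  proof -
    have "w ^ (j + (N - 2) * s) = w ^ j * (w ^ (N - 2)) ^ s" by (simp add: power_add power_mult)
    also have "\<dots> = cis (real j * x) * cis (real s * (- 2 * x))" unfolding w2 by (simp add: assms(1) Complex.DeMoivre)
    finally show ?thesis by (simp add: cis_mult algebra_simps)
  qed
  have two: "2 * \<i> * of_real (sin y) = cis y - cis (- y)" for y by (simp add: complex_eq_iff)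
  have "(\<Sum>s<Suc j. w ^ (j + (N - 2) * s)) * (2 * \<i> * of_real (sin x)) =
      (\<Sum>s<Suc j. cis ((real j + 1 - 2 * s) * x) - cis ((real j + 1 - 2 * Suc s) * x))"
    unfolding two t sum_distrib_right by (intro sum.cong refl) (simp add: right_diff_distrib cis_mult algebra_simps)
  also have "\<dots> = cis ((real j + 1) * x) - cis (- ((real j + 1) * x))"
    by (subst sum_lessThan_telescope') (simp add: algebra_simps)
  also have "\<dots> = 2 * \<i> * of_real (sin (Suc j * x))" unfolding two[symmetric] by (simp add: add.commute)
  finally have "(\<Sum>s<Suc j. w ^ (j + (N - 2) * s)) * of_real (sin x) = of_real (sin (Suc j * x))"
    by (simp add: mult.left_commute[of _ "2 * \<i>"] mult.assoc)
  then show ?thesis using assms(4) by (simp add: field_simps)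
qed

text \<open>All triangles are listed counterclockwise, so that reflected tiles list their corners in a different order:
  corner \<open>i\<close> of the tile \<open>T\<close> is the corner \<open>lb T i\<close> of the prototile.\<close>

locale congruent_dissection = dissection I vt \<Delta>
  for I :: "'t set" and vt :: "'t \<Rightarrow> 3 \<Rightarrow> complex" and \<Delta> :: "3 \<Rightarrow> complex" +
  fixes lb :: "'t \<Rightarrow> 3 \<Rightarrow> 3" and \<theta> :: "3 \<Rightarrow> real" and sd :: "3 \<Rightarrow> real"
  assumes lb_bij: "T \<in> I \<Longrightarrow> bij (lb T)"
    and tile_ang: "T \<in> I \<Longrightarrow> ang (vt T) i = \<theta> (lb T i)"
    and tile_side: "T \<in> I \<Longrightarrow> dist (vt T (i + 1)) (vt T (i + 2)) = sd (lb T i)"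
begin

lemma tile_side': "T \<in> I \<Longrightarrow> dist (vt T i) (vt T (i + 1)) = sd (lb T (i + 2))"
  "T \<in> I \<Longrightarrow> dist (vt T i) (vt T (i + 2)) = sd (lb T (i + 1))"
  using tile_side[of T "i + 2"] tile_side[of T "i + 1"] by (simp_all add: dist_commute)

lemma I_nonempty: "I \<noteq> {}"
  using cover vertex_in_tri[OF ccw_big] by force

lemma lb_surj:
  assumes "T \<in> I" obtains i where "lb T i = x"
  using lb_bij[OF assms] by (metis bij_pointE)

lemma sum_lb: "T \<in> I \<Longrightarrow> (\<Sum>i\<in>UNIV. h (lb T i)) = (\<Sum>x\<in>UNIV. h x)"
  by (rule sum.reindex_bij_betw[OF lb_bij])

lemma theta_bounds: "0 < \<theta> x" "\<theta> x < pi"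
proof -
  obtain T where T: "T \<in> I" using I_nonempty by blast
  then obtain i where "lb T i = x" by (rule lb_surj)
  then show "0 < \<theta> x" "\<theta> x < pi" using ang_bounds[OF ccw_tile[OF T], of i] tile_ang[OF T] by auto
qed

lemma theta_sum: "(\<Sum>x\<in>UNIV. \<theta> x) = pi"
proof -
  obtain T where T: "T \<in> I" using I_nonempty by blast
  then show ?thesis using ang_sum[OF ccw_tile[OF T]] by (simp add: tile_ang sum_lb)
qed

lemma sd_pos: "sd x > 0"
proof -
  obtain T where T: "T \<in> I" using I_nonempty by blast
  then obtain i where "lb T i = x" by (rule lb_surj)
  then show ?thesis using tile_side[OF T, of i] ccw_distinct[OF ccw_tile[OF T], of "i + 1"] by (metis three_index(1) zero_less_dist_iff)
qed

lemma sine_rule: "\<exists>R>0. \<forall>x. sd x = R * sin (\<theta> x)"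
proof -
  obtain T where T: "T \<in> I" using I_nonempty by blast
  let ?v = "vt T"
  define P where "P = sd (lb T 1) * sd (lb T 2) * sd (lb T 3)"
  define D where "D = side ?v 1 (?v 3)"
  have D: "D > 0" using ccw_tile[OF T] by (simp add: D_def ccw_def)
  have P: "P > 0" by (simp add: P_def sd_pos)
  have e: "sd (lb T i) = P / D * sin (\<theta> (lb T i))" for i
  proof -
    have "D = sd (lb T (i + 2)) * sd (lb T (i + 1)) * sin (\<theta> (lb T i))"
      using area_sine[OF ccw_tile[OF T], of i] tile_ang[OF T] tile_side'[OF T] by (simp add: D_def)
    moreover have "P = sd (lb T i) * sd (lb T (i + 1)) * sd (lb T (i + 2))"
      using exhaust_3[of i] by (auto simp: P_def mult_ac)
    ultimately have "P * sin (\<theta> (lb T i)) = sd (lb T i) * D" by (simp add: mult_ac)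
    then show ?thesis using D by (simp add: field_simps)
  qed
  have "sd x = P / D * sin (\<theta> x)" for x
  proof -
    obtain i where "lb T i = x" using lb_surj[OF T] by blast
    then show ?thesis using e[of i] by simp
  qed
  then show ?thesis using P D by (intro exI[of _ "P / D"]) auto
qed

definition cnt :: "complex \<Rightarrow> 3 \<Rightarrow> nat" where
  "cnt V x = card {(T, i) \<in> corners V. lb T i = x}"

lemma corners_cnt:
  fixes h :: "3 \<Rightarrow> 'b::comm_semiring_1"
  shows "(\<Sum>(T, i)\<in>corners V. h (lb T i)) = (\<Sum>x\<in>UNIV. of_nat (cnt V x) * h x)"
proof -
  have "(\<Sum>(T, i)\<in>corners V. h (lb T i)) = (\<Sum>x\<in>UNIV. \<Sum>e\<in>{e \<in> corners V. (\<lambda>(T, i). lb T i) e = x}. (\<lambda>(T, i). h (lb T i)) e)"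
    by (rule sum.group[symmetric]) (auto simp: fin_corners)
  also have "\<dots> = (\<Sum>x\<in>UNIV. of_nat (cnt V x) * h x)"
  proof (intro sum.cong refl)
    fix x
    have "{e \<in> corners V. (\<lambda>(T, i). lb T i) e = x} = {(T, i) \<in> corners V. lb T i = x}" by auto
    moreover have "(\<Sum>e\<in>{(T, i) \<in> corners V. lb T i = x}. (\<lambda>(T, i). h (lb T i)) e) = (\<Sum>e\<in>{(T, i) \<in> corners V. lb T i = x}. h x)"
      by (intro sum.cong) auto
    ultimately show "(\<Sum>e\<in>{e \<in> corners V. (\<lambda>(T, i). lb T i) e = x}. (\<lambda>(T, i). h (lb T i)) e) = of_nat (cnt V x) * h x"
      by (simp add: cnt_def)
  qed
  finally show ?thesis .
qed

lemma card_corners: "card (corners V) = (\<Sum>x\<in>UNIV. cnt V x)"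
  using corners_cnt[of "\<lambda>_. 1 :: nat" V] by (simp add: case_prod_unfold)

lemma angle_sum_cnt: "angle_sum V = (\<Sum>x\<in>UNIV. cnt V x * \<theta> x)"
proof -
  have "angle_sum V = (\<Sum>(T, i)\<in>corners V. \<theta> (lb T i))"
    unfolding angle_sum_def by (intro sum.cong) (auto simp: corners_def tile_ang)
  then show ?thesis by (simp add: corners_cnt)
qed

text \<open>Every tile carries each label once, and every tile corner is at one vertex. This permits
  a global count over all vertices when a single vertex is not conclusive.\<close>

lemma cnt_total: "(\<Sum>V\<in>S. cnt V x) = card I"
proof -
  have "(\<Sum>V\<in>S. cnt V x) = card (\<Union>V\<in>S. {(T, i) \<in> corners V. lb T i = x})"
    unfolding cnt_def by (rule card_UN_disjoint[symmetric])
      (auto simp: fin_S corners_def intro: finite_subset[OF _ fin_corners])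
  also have "(\<Union>V\<in>S. {(T, i) \<in> corners V. lb T i = x}) = {(T, i). T \<in> I \<and> lb T i = x}"
    by (auto simp: corners_def S_def)
  also have "card \<dots> = card I"
  proof (rule bij_betw_same_card[of fst])
    show "bij_betw fst {(T, i). T \<in> I \<and> lb T i = x} I"
      unfolding bij_betw_def
    proof
      show "inj_on fst {(T, i). T \<in> I \<and> lb T i = x}"
        using lb_bij by (auto simp: inj_on_def bij_def)
      show "fst ` {(T, i). T \<in> I \<and> lb T i = x} = I"
      proof
        show "I \<subseteq> fst ` {(T, i). T \<in> I \<and> lb T i = x}"
        proof
          fix T assume T: "T \<in> I"
          obtain i where "lb T i = x" using lb_surj[OF T] by blast
          then have "(T, i) \<in> {(T, i). T \<in> I \<and> lb T i = x}" using T by simp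
          then show "T \<in> fst ` {(T, i). T \<in> I \<and> lb T i = x}" by force
        qed
      qed auto
    qed
  qed
  finally show ?thesis .
qed

end

section \<open>Tile angles that are multiples of \<pi> / n\<close>

locale rational_dissection = congruent_dissection I vt \<Delta> lb \<theta> sd
  for I :: "'t set" and vt :: "'t \<Rightarrow> 3 \<Rightarrow> complex" and \<Delta> :: "3 \<Rightarrow> complex"
    and lb :: "'t \<Rightarrow> 3 \<Rightarrow> 3" and \<theta> :: "3 \<Rightarrow> real" and sd :: "3 \<Rightarrow> real" +
  fixes n :: nat and j :: "3 \<Rightarrow> nat"
  assumes n_pos: "n > 0" and theta_j: "\<theta> x = j x * pi / n"
begin

lemma j_pos: "j x > 0"
  using theta_bounds(1)[of x] theta_j[of x] n_pos by (cases "j x") auto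

lemma j_less: "j x < n"
  using theta_bounds(2)[of x] theta_j[of x] n_pos by (simp add: divide_simps)

lemma j_sum: "(\<Sum>x\<in>UNIV. j x) = n"
proof -
  have "(\<Sum>x\<in>UNIV. \<theta> x) = (\<Sum>x\<in>UNIV. real (j x)) * (pi / n)"
    unfolding sum_distrib_right by (simp add: theta_j)
  then have "(\<Sum>x\<in>UNIV. real (j x)) * (pi / n) = pi" by (simp only: theta_sum)
  then have "(\<Sum>x\<in>UNIV. real (j x)) = real n" using n_pos by (simp add: field_simps)
  then show ?thesis by (metis of_nat_eq_iff of_nat_sum)
qed

lemma n_ge: "n \<ge> 3"
  using j_sum j_pos[of 1] j_pos[of 2] j_pos[of 3] by (simp add: sum_3)

lemma angle_sum_j: "angle_sum V = (\<Sum>x\<in>UNIV. cnt V x * j x) * pi / n"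
  by (simp add: angle_sum_cnt theta_j sum_distrib_right sum_divide_distrib mult.assoc)

definition w :: complex where "w = cis (pi / n)"

lemma w_power: "w ^ m = cis (m * pi / n)"
  by (simp only: w_def Complex.DeMoivre times_divide_eq_right)

lemma w_n: "w ^ n = - 1" and w_2n: "w ^ (2 * n) = 1"
  using n_pos by (simp_all add: w_power)

definition dirn :: "complex \<Rightarrow> bool" where
  "dirn z \<longleftrightarrow> (\<exists>m r. z = of_real r * w ^ m * (\<Delta> 2 - \<Delta> 1))"

lemma dirn_scale: "dirn z \<Longrightarrow> dirn (of_real r * w ^ m * z)"
proof -
  assume "dirn z"
  then obtain m' r' where "z = of_real r' * w ^ m' * (\<Delta> 2 - \<Delta> 1)" by (auto simp: dirn_def)
  then have "of_real r * w ^ m * z = of_real (r * r') * w ^ (m + m') * (\<Delta> 2 - \<Delta> 1)" by (simp add: power_add)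
  then show ?thesis unfolding dirn_def by blast
qed

lemma dirn_real: "dirn z \<Longrightarrow> dirn (of_real r * z)"
  using dirn_scale[of z r 0] by simp

lemma dirn_minus: "dirn z \<Longrightarrow> dirn (- z)"
  using dirn_real[of z "- 1"] by simp

lemma dirn_edges:
  assumes v: "ccw v" and ang: "\<And>i. \<exists>m :: nat. ang v i = m * pi / n" and d: "dirn (v (i + 1) - v i)"
  shows "dirn (v (l + 1) - v l)"
proof -
  have step: "dirn (v i - v (i + 2))" if d: "dirn (v (i + 1) - v i)" for i
  proof -
    obtain m :: nat where m: "ang v i = m * pi / n" using ang by blast
    have "v (i + 2) - v i = of_real (dist (v i) (v (i + 2)) / dist (v i) (v (i + 1))) * w ^ m * (v (i + 1) - v i)"
      using edge_rotation[OF v, of i] by (simp only: m w_power)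
    then have "dirn (v (i + 2) - v i)" by (simp only: dirn_scale[OF d])
    from dirn_minus[OF this] show ?thesis by simp
  qed
  have 2: "dirn (v (i + 2 + 1) - v (i + 2))" using step[OF d] by simp
  have "dirn (v (i + 1 + 1) - v (i + 1))" using step[OF 2] by simp
  then show ?thesis using three_cases[of l i] d 2 by auto
qed

lemma dirn_big: "dirn (\<Delta> (i + 1) - \<Delta> i)"
proof (rule dirn_edges[OF ccw_big, of 1])
  fix i
  have "ang \<Delta> i = (\<Sum>x\<in>UNIV. cnt (\<Delta> i) x * j x) * pi / n" by (simp add: angle_sum_corner[symmetric] angle_sum_j)
  then show "\<exists>m :: nat. ang \<Delta> i = m * pi / n" by blast
next
  have "\<Delta> 2 - \<Delta> 1 = of_real 1 * w ^ 0 * (\<Delta> 2 - \<Delta> 1)" by simp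
  then have "dirn (\<Delta> 2 - \<Delta> 1)" unfolding dirn_def by blast
  then show "dirn (\<Delta> (1 + 1) - \<Delta> 1)" by simp
qed

lemma dirn_bd:
  assumes "ccw v" "\<And>i. \<exists>m :: nat. ang v i = m * pi / n" "(p, q) \<in> bd v"
  shows "dirn (q - p) \<longleftrightarrow> (\<forall>i. dirn (v (i + 1) - v i))"
  using assms(3,1)
proof (rule bdD)
  fix i c assume c: "c > 0" "q - p = of_real c * (v (i + 1) - v i)"
  show ?thesis
  proof
    assume "dirn (q - p)"
    then have "dirn (of_real (1 / c) * (q - p))" by (rule dirn_real)
    then have "dirn (v (i + 1) - v i)" using c by simp
    then show "\<forall>l. dirn (v (l + 1) - v l)" using dirn_edges[OF assms(1,2)] by blast
  qed (use c dirn_real in auto)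
qed

text \<open>Tiles not reached from the side \<open>\<Delta> 1 \<Delta> 2\<close> by multiples of \<open>pi / n\<close> could be removed without changing winding numbers.\<close>

lemma dirn_tile:
  assumes "T \<in> I" shows "dirn (vt T (i + 1) - vt T i)"
proof (rule ccontr)
  assume nd: "\<not> dirn (vt T (i + 1) - vt T i)"
  \<comment> \<open>Weights for \<open>weighted_cancellation\<close>. All angles are multiples of
    \<pi> / n, so one edge of an admissible direction makes all edges of the tile admissible, and
    tiles with a common piece have equal weight.\<close>
  define wt where "wt T = (of_bool (\<forall>i. dirn (vt T (i + 1) - vt T i)) :: real)" for T
  have ra: "\<exists>m :: nat. ang (vt T) i = m * pi / n" if "T \<in> I" for T i
    using tile_ang[OF that, of i] theta_j[of "lb T i"] by auto
  have wtb: "wt T = of_bool (dirn (q - p))" if "T \<in> I" "(p, q) \<in> bd (vt T)" for T p q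
    unfolding wt_def using dirn_bd[OF ccw_tile ra, OF that(1) that(1) that(2)] by simp
  \<comment> \<open>The centroid of the allegedly bad tile. The tiles of weight 0 have total winding
    number 0 there, although this tile alone contributes 2 \<pi>.\<close>
  define z where "z = (vt T 1 + vt T 2 + vt T 3) / 3"
  have z: "z \<in> otri (vt T)"
  proof -
    have "side (vt T) i z = side (vt T) 1 (vt T 3) / 3" for i
      using exhaust_3[of i] by (auto simp: side_def crs_def z_def field_simps)
    moreover have "side (vt T) 1 (vt T 3) / 3 > 0" using ccw_tile[OF assms] by (simp add: ccw_def)
    ultimately show ?thesis by (simp only: otri_def mem_Collect_eq simp_thms)
  qed
  have "(\<Sum>T\<in>I. wt T * wind z (vt T)) = wind z \<Delta>"
    unfolding wind_def
  proof (rule weighted_cancellation)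
    fix T T' p q assume a: "T \<in> I" "T' \<in> I" "(p, q) \<in> bd (vt T)" "(q, p) \<in> bd (vt T')"
    have "dirn (q - p) \<longleftrightarrow> dirn (p - q)" using dirn_minus[of "q - p"] dirn_minus[of "p - q"] by auto
    then show "wt T = wt T'" using wtb[OF a(1,3)] wtb[OF a(2,4)] by simp
  next
    fix T p q assume a: "T \<in> I" "(p, q) \<in> bd (vt T)" "(p, q) \<in> bd \<Delta>"
    from a(3) ccw_big have "dirn (q - p)" by (rule bdD) (use dirn_big dirn_real in auto)
    then show "wt T = 1" using wtb[OF a(1,2)] by simp
  qed (auto intro: subt_swap additive_along_sub)
  then have "(\<Sum>T\<in>I. (1 - wt T) * wind z (vt T)) = 0"
    using wind_total[of z] by (simp add: left_diff_distrib sum_subtractf)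
  then have "(1 - wt T) * wind z (vt T) = 0"
    using sum_nonneg_eq_0_iff[OF fin, of "\<lambda>T. (1 - wt T) * wind z (vt T)"] assms wind_nonneg(1)[OF ccw_tile]
    by (auto simp: wt_def)
  moreover have "wt T = 0" using nd by (auto simp: wt_def)
  ultimately show False using wind_otri[OF z] by simp
qed

end

section \<open>The image of a tiling under a conjugation\<close>

locale conjugated_dissection = rational_dissection I vt \<Delta> lb \<theta> sd n j
  for I :: "'t set" and vt :: "'t \<Rightarrow> 3 \<Rightarrow> complex" and \<Delta> :: "3 \<Rightarrow> complex"
    and lb :: "'t \<Rightarrow> 3 \<Rightarrow> 3" and \<theta> :: "3 \<Rightarrow> real" and sd :: "3 \<Rightarrow> real" and n :: nat and j :: "3 \<Rightarrow> nat" +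
  fixes k :: nat and r :: "3 \<Rightarrow> nat"
  assumes k_coprime: "coprime k (2 * n)" and r_def: "r x = k * j x mod n" and r_sum: "(\<Sum>x\<in>UNIV. r x) = n"
begin

lemma k_odd: "odd k"
  using k_coprime by simp

lemma r_pos: "r x > 0"
proof (rule ccontr)
  assume "\<not> r x > 0"
  then have "n dvd k * j x" by (simp add: r_def mod_eq_0_iff_dvd)
  moreover have "coprime n k" using k_coprime by (simp add: coprime_commute)
  ultimately have "n dvd j x" by (simp add: coprime_dvd_mult_right_iff)
  then show False using j_pos[of x] j_less[of x] by (auto dest: dvd_imp_le)
qed

lemma r_less: "r x < n"
  using n_pos by (simp add: r_def)

lemma sin_conj: "sin (k * (j x * pi / n)) = (- 1) ^ (k * j x div n) * sin (r x * pi / n)"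
  and cis_conj: "cis (k * (j x * pi / n)) = (- 1) ^ (k * j x div n) * cis (r x * pi / n)"
proof -
  have "real (k * j x) = real (r x) + real n * real (k * j x div n)"
    unfolding r_def by (metis of_nat_add of_nat_mult mod_mult_div_eq)
  moreover have "k * (j x * pi / n) = real (k * j x) * pi / n" by simp
  ultimately have "k * (j x * pi / n) = (real (r x) + real n * real (k * j x div n)) * pi / n" by (simp only:)
  also have "\<dots> = r x * pi / n + (k * j x div n) * pi" using n_pos by (simp add: field_simps)
  finally have e: "k * (j x * pi / n) = r x * pi / n + (k * j x div n) * pi" .
  show "sin (k * (j x * pi / n)) = (- 1) ^ (k * j x div n) * sin (r x * pi / n)"
    unfolding e by (simp add: sin_add)
  have "cis (real m * pi) = (- 1) ^ m" for m by (simp add: Complex.DeMoivre[symmetric])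
  then show "cis (k * (j x * pi / n)) = (- 1) ^ (k * j x div n) * cis (r x * pi / n)"
    unfolding e cis_mult[symmetric] by simp
qed

text \<open>The quotients sum to \<open>k - 1\<close>, and \<open>k\<close> is odd. This parity
  removes the signs that arise when \<open>k * j x\<close> is reduced modulo \<open>n\<close> inside
  sines and \<open>cis\<close>.\<close>

lemma div_even: "even (\<Sum>x\<in>UNIV. k * j x div n)"
proof -
  have "k * n = (\<Sum>x\<in>UNIV. k * j x)" by (simp add: j_sum[symmetric] sum_distrib_left)
  also have "\<dots> = (\<Sum>x\<in>UNIV. n * (k * j x div n) + r x)" by (simp add: r_def)
  also have "\<dots> = n * ((\<Sum>x\<in>UNIV. k * j x div n) + 1)" by (simp add: sum.distrib r_sum sum_distrib_left)
  finally have "n * k = n * ((\<Sum>x\<in>UNIV. k * j x div n) + 1)" by (simp only: mult.commute[of n k])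
  then have "k = (\<Sum>x\<in>UNIV. k * j x div n) + 1" using n_pos by (simp only: nat_mult_eq_cancel1)
  then show ?thesis using k_odd by presburger
qed

lemma sin_r: "sin (r x * pi / n) > 0"
  using r_pos[of x] r_less[of x] by (intro sin_gt_zero) (auto simp: field_simps)

lemma sin_k: "sin (k * (pi / n)) \<noteq> 0"
proof
  assume "sin (k * (pi / n)) = 0"
  then obtain i :: int where i: "k * (pi / n) = i * pi" by (auto simp: sin_zero_iff_int2)
  then have "real k = real n * i" using n_pos by (simp add: field_simps)
  then have "int k = int n * i" by (metis of_int_eq_iff of_int_mult of_int_of_nat_eq)
  then have "n dvd k" by (metis dvd_triv_left int_dvd_int_iff)
  moreover have "coprime n k" using k_coprime by (simp add: coprime_commute)
  ultimately show False using n_ge by (simp add: coprime_absorb_left)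
qed

text \<open>By the sine rule the sides are proportional to sines of the angles, and these are
  conjugated along with the directions. Up to signs, which cancel by \<open>div_even\<close>, the
  result is the sine rule of a triangle with angles \<open>r x * pi / n\<close>; that the
  \<open>r x\<close> sum to \<open>n\<close> selects the positive orientation.\<close>

theorem conjugate_tiling:
  obtains f :: "complex \<Rightarrow> complex" where "\<And>T i. T \<in> I \<Longrightarrow> line_map f (vt T (i + 1) - vt T i)"
    "\<And>i. line_map f (\<Delta> (i + 1) - \<Delta> i)"
    "\<And>T. T \<in> I \<Longrightarrow> ccw (f \<circ> vt T)" "\<And>T i. T \<in> I \<Longrightarrow> ang (f \<circ> vt T) i = r (lb T i) * pi / n"
proof -
  have N: "2 * n > 0" using n_pos by simp
  obtain \<Phi> :: "complex \<Rightarrow> complex" where add: "\<And>x y. \<Phi> (x + y) = \<Phi> x + \<Phi> y"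
    and mult: "\<And>z. \<Phi> (w * z) = w ^ k * \<Phi> z" and real: "\<And>t. \<Phi> (of_real t) \<in> \<real>" and one: "\<Phi> 1 \<noteq> 0"
    using conjugation_map[OF w_2n N k_coprime] by blast
  obtain R where R: "R > 0" "\<And>x. sd x = R * sin (\<theta> x)" using sine_rule by blast
  define u where "u = \<Delta> 2 - \<Delta> 1"
  have u: "u \<noteq> 0" using ccw_distinct[OF ccw_big, of 1] by (simp add: u_def)
  have sn: "sin (pi / n) > 0" using n_ge by (intro sin_gt_zero) (auto simp: field_simps)
  \<comment> \<open>Normalises direction and length: divided by \<open>c\<close>, the edge vectors
    of the tiles become integer combinations of powers of \<open>w\<close>.\<close>
  define c where "c = of_real (R * sin (pi / n)) * sgn u"
  have c: "c \<noteq> 0" using R(1) sn u by (simp add: c_def sgn_zero_iff)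
  define f where "f z = \<Phi> (z / c)" for z
  have pmult: "\<Phi> (w ^ m * z) = w ^ (k * m) * \<Phi> z" for m z
    by (induction m) (simp_all add: mult mult.assoc power_add)
  have psum: "\<Phi> (sum g A) = (\<Sum>i\<in>A. \<Phi> (g i))" if "finite A" "A \<noteq> {}" for g :: "nat \<Rightarrow> complex" and A
    using that by (induction rule: finite_ne_induct) (simp_all add: add)
  have fadd: "f (x + y) = f x + f y" for x y by (simp add: f_def add add_divide_distrib)
  have f0: "f 0 = 0" using fadd[of 0 0] by simp
  have fm: "f (- x) = - f x" for x using fadd[of x "- x"] f0 by (simp add: add_eq_0_iff2)
  have fdiff: "f (x - y) = f x - f y" for x y using fadd[of x "- y"] fm by simp
  have lm: "line_map f d" if dd: "dirn d" for d
  proof -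
    obtain m a where d: "d = of_real a * w ^ m * u" using dd by (auto simp: dirn_def u_def)
    define b where "b = a * cmod u / (R * sin (pi / n))"
    have dc: "d / c = w ^ m * of_real b"
      using u R(1) sn by (simp add: d c_def b_def sgn_eq field_simps)
    have "\<exists>r'. f (x + of_real t * d) = f x + of_real r' * w ^ (k * m)" for x t
    proof -
      have "of_real t * d / c = w ^ m * of_real (t * b)" using dc by (metis mult.left_commute of_real_mult times_divide_eq_right)
      then have "f (of_real t * d) = w ^ (k * m) * \<Phi> (of_real (t * b))" by (simp only: f_def pmult)
      moreover obtain y where "\<Phi> (of_real (t * b)) = of_real y" using real by (metis Reals_cases)
      ultimately show ?thesis by (auto simp: fadd mult.commute)
    qed
    then show ?thesis unfolding line_map_def by blast
  qed
  define \<kappa> where "\<kappa> = \<Phi> 1 / of_real (sin (k * (pi / n)))"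
  have \<kappa>: "\<kappa> \<noteq> 0" using one sin_k by (simp add: \<kappa>_def)
  have side: "f (of_real (sd x) * w ^ m * sgn u) = of_real (sin (k * (j x * pi / n))) * w ^ (k * m) * \<kappa>" for x m
  proof -
    obtain l where l: "j x = Suc l" using j_pos[of x] by (cases "j x") auto
    have "of_real (sd x) * w ^ m * sgn u / c = w ^ m * of_real (sin (Suc l * (pi / n)) / sin (pi / n))"
      using R sn u by (simp add: c_def theta_j l sgn_zero_iff field_simps)
    also have "of_real (sin (Suc l * (pi / n)) / sin (pi / n)) = (\<Sum>s<Suc l. w ^ (l + (2 * n - 2) * s))"
      using power_sum_sine[OF w_def w_2n, of l] n_ge sn by simp
    finally have e: "of_real (sd x) * w ^ m * sgn u / c = w ^ m * (\<Sum>s<Suc l. w ^ (l + (2 * n - 2) * s) * 1)" by simp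
    have "f (of_real (sd x) * w ^ m * sgn u) = w ^ (k * m) * (\<Sum>s<Suc l. (w ^ k) ^ (l + (2 * n - 2) * s)) * \<Phi> 1"
      unfolding f_def e pmult by (subst psum) (auto simp only: pmult sum_distrib_right power_mult mult.assoc finite_lessThan)
    also have "(\<Sum>s<Suc l. (w ^ k) ^ (l + (2 * n - 2) * s)) = of_real (sin (Suc l * (k * (pi / n))) / sin (k * (pi / n)))"
    proof (rule power_sum_sine)
      show "w ^ k = cis (k * (pi / n))" by (simp add: w_power)
      show "(w ^ k) ^ (2 * n) = 1" using w_2n by (metis power_mult mult.commute power_one)
    qed (use n_ge sin_k in auto)
    finally show ?thesis by (simp add: \<kappa>_def l mult_ac)
  qed
  have su: "u = of_real (cmod u) * sgn u" by (simp add: sgn_eq u)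
  have corner: "Im ((f (vt T (i + 2)) - f (vt T i)) / (f (vt T (i + 1)) - f (vt T i))) > 0"
    "Arg ((f (vt T (i + 2)) - f (vt T i)) / (f (vt T (i + 1)) - f (vt T i))) = r (lb T i) * pi / n"
    if T: "T \<in> I" for T i
  proof -
    let ?v = "vt T" and ?a = "lb T i" and ?b = "lb T (i + 1)" and ?c = "lb T (i + 2)"
    obtain m a where e0: "?v (i + 1) - ?v i = of_real a * w ^ m * u"
      using dirn_tile[OF T, of i] by (auto simp: dirn_def u_def)
    have len: "cmod (?v (i + 1) - ?v i) = sd ?c" using tile_side'(1)[OF T, of i] by (simp add: dist_norm norm_minus_commute)
    have "\<exists>m. ?v (i + 1) - ?v i = of_real (sd ?c) * w ^ m * sgn u"
    proof -
      have cw: "cmod (w ^ m) = 1" by (simp add: w_power)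
      have l: "\<bar>a\<bar> * cmod u = sd ?c" using len cw by (simp add: e0 norm_mult)
      have e1: "?v (i + 1) - ?v i = of_real (a * cmod u) * w ^ m * sgn u"
        unfolding e0 by (subst su) (simp add: mult_ac)
      show ?thesis
      proof (cases "a \<ge> 0")
        case True
        then have "a * cmod u = sd ?c" using l by simp
        then show ?thesis using e1 by (simp only:) blast
      next
        \<comment> \<open>A negative real factor is absorbed by \<open>w ^ n = - 1\<close>.\<close>
        case False
        then have "a * cmod u = - sd ?c" using l by simp
        then have "?v (i + 1) - ?v i = of_real (- sd ?c) * w ^ m * sgn u" using e1 by (simp only:)
        then have "?v (i + 1) - ?v i = of_real (sd ?c) * w ^ (m + n) * sgn u" by (simp add: power_add w_n)
        then show ?thesis by blast
      qed
    qed
    then obtain m where e1: "?v (i + 1) - ?v i = of_real (sd ?c) * w ^ m * sgn u" by blast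
    have e2: "?v (i + 2) - ?v i = of_real (sd ?b) * w ^ (m + j ?a) * sgn u"
    proof -
      have "?v (i + 2) - ?v i = of_real (sd ?b / sd ?c) * w ^ j ?a * (of_real (sd ?c) * w ^ m * sgn u)"
        using edge_rotation[OF ccw_tile[OF T], of i] tile_side'[OF T, of i] tile_ang[OF T, of i] e1
        by (simp add: theta_j w_power)
      then show ?thesis using sd_pos[of ?c] by (simp add: power_add field_simps)
    qed
    have g1: "f (?v (i + 1)) - f (?v i) = of_real (sin (k * (j ?c * pi / n))) * w ^ (k * m) * \<kappa>"
      unfolding fdiff[symmetric] e1 by (rule side)
    have g2: "f (?v (i + 2)) - f (?v i) = of_real (sin (k * (j ?b * pi / n))) * w ^ (k * (m + j ?a)) * \<kappa>"
      unfolding fdiff[symmetric] e2 by (rule side)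
    let ?q = "\<lambda>x. k * j x div n"
    have wk: "w ^ (k * j ?a) = cis (k * (j ?a * pi / n))" by (simp add: w_power mult.assoc)
    have w0: "w ^ (k * m) \<noteq> 0" by (simp add: w_power)
    have nz: "sin (k * (j ?c * pi / n)) \<noteq> 0" unfolding sin_conj using sin_r[of ?c] by simp
    have "(f (?v (i + 2)) - f (?v i)) / (f (?v (i + 1)) - f (?v i)) =
        of_real (sin (k * (j ?b * pi / n)) / sin (k * (j ?c * pi / n))) * cis (k * (j ?a * pi / n))"
    proof -
      have fc: "(y * (W * C) * q) / (x * W * q) = (y / x) * C" if "W \<noteq> 0" "q \<noteq> 0" for x y W C q :: complex
        using that by simp
      have "w ^ (k * (m + j ?a)) = w ^ (k * m) * cis (k * (j ?a * pi / n))"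
        by (simp only: distrib_left power_add wk)
      then show ?thesis unfolding g1 g2 of_real_divide by (simp only: fc[OF w0 \<kappa>])
    qed
    also have "\<dots> = of_real ((- 1) ^ ?q ?b / (- 1) ^ ?q ?c * (- 1) ^ ?q ?a * (sin (r ?b * pi / n) / sin (r ?c * pi / n))) * cis (r ?a * pi / n)"
      unfolding sin_conj cis_conj by simp
    also have "(- 1) ^ ?q ?b / (- 1) ^ ?q ?c * (- 1) ^ ?q ?a = (1 :: real)"
    proof -
      have "?q ?a + ?q ?b + ?q ?c = (\<Sum>x\<in>UNIV. ?q x)"
        using sum_lb[OF T, of ?q] by (simp add: sum_three[of _ i])
      then have "even (?q ?a + ?q ?b + ?q ?c)" using div_even by simp
      then show ?thesis by (cases "even (?q ?a)"; cases "even (?q ?b)"; cases "even (?q ?c)") auto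
    qed
    finally have e: "(f (?v (i + 2)) - f (?v i)) / (f (?v (i + 1)) - f (?v i)) =
      of_real (sin (r ?b * pi / n) / sin (r ?c * pi / n)) * cis (r ?a * pi / n)" by simp
    have p: "sin (r ?b * pi / n) / sin (r ?c * pi / n) > 0" using sin_r by simp
    show "Im ((f (?v (i + 2)) - f (?v i)) / (f (?v (i + 1)) - f (?v i))) > 0"
    proof -
      have "Im (of_real y * cis t) = y * sin t" for y t by simp
      then show ?thesis unfolding e using mult_pos_pos[OF p sin_r[of ?a]] by (simp only:)
    qed
    have "r ?a * pi / n \<le> pi" using r_less[of ?a] by (simp add: field_simps)
    then show "Arg ((f (?v (i + 2)) - f (?v i)) / (f (?v (i + 1)) - f (?v i))) = r ?a * pi / n"
    proof -
      assume ub: "r ?a * pi / n \<le> pi"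
      have "0 < r ?a * pi / n" using r_pos[of ?a] n_pos by simp
      then have lb: "- pi < r ?a * pi / n" using pi_gt_zero by linarith
      show ?thesis unfolding e by (rule Arg_unique'[OF p]) (use lb ub in \<open>auto simp: rcis_def\<close>)
    qed
  qed
  have "ccw (f \<circ> vt T)" if T: "T \<in> I" for T
  proof -
    have "crs (f (vt T (1 + 1)) - f (vt T 1)) (f (vt T (1 + 2)) - f (vt T 1)) > 0"
      using corner(1)[OF T, of 1] unfolding Im_divide_crs by (simp add: zero_less_divide_iff)
    then show ?thesis by (simp add: ccw_def side_def)
  qed
  moreover have "ang (f \<circ> vt T) i = r (lb T i) * pi / n" if "T \<in> I" for T i
    using corner(2)[OF that] by (simp add: ang_def)
  ultimately show thesis using that lm dirn_tile dirn_big by blast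
qed

definition conj_sum :: "complex \<Rightarrow> nat" where
  "conj_sum V = (\<Sum>x\<in>UNIV. cnt V x * r x)"

lemma conj_sum_pos: "V \<in> S \<Longrightarrow> conj_sum V > 0"
proof -
  assume "V \<in> S"
  then have "card (corners V) > 0" using corners_nonempty fin_corners by (simp add: card_gt_0_iff)
  then obtain x where "cnt V x > 0" unfolding card_corners by (metis (no_types, lifting) gr0I sum.neutral less_irrefl)
  then have "cnt V x * r x > 0" using r_pos by simp
  also have "cnt V x * r x \<le> conj_sum V" unfolding conj_sum_def by (rule member_le_sum) auto
  finally show ?thesis .
qed

lemma conj_sum_cong: "[conj_sum V = k * (\<Sum>x\<in>UNIV. cnt V x * j x)] (mod n)"
proof -
  have "[(\<Sum>x\<in>UNIV. cnt V x * r x) = (\<Sum>x\<in>UNIV. cnt V x * (k * j x))] (mod n)"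
    by (intro cong_sum cong_mult cong_refl) (simp add: r_def cong_def)
  then show ?thesis by (simp add: conj_sum_def sum_distrib_left mult.left_commute)
qed

text \<open>Modulo \<open>n\<close> the conjugated sum is \<open>k\<close> times the original one,
  which yields divisibility by \<open>n\<close>. It is positive, and \<open>map_angle_le\<close>
  bounds it by a winding number of the image of the big triangle; for a point of a side this number
  is at most \<pi>, because its image lies on the line of the image side.\<close>

theorem conj_sum_bounds:
  shows "V \<in> S \<Longrightarrow> V \<in> oedge \<Delta> i \<Longrightarrow> conj_sum V = n"
    and "conj_sum (\<Delta> i) < n" and "(\<Sum>i\<in>UNIV. conj_sum (\<Delta> i)) = n"
    and "V \<in> S \<Longrightarrow> V \<in> otri \<Delta> \<Longrightarrow> conj_sum V = n \<or> conj_sum V = 2 * n"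
proof -
  obtain f where f: "\<And>T i. T \<in> I \<Longrightarrow> line_map f (vt T (i + 1) - vt T i)"
    "\<And>i. line_map f (\<Delta> (i + 1) - \<Delta> i)"
    "\<And>T. T \<in> I \<Longrightarrow> ccw (f \<circ> vt T)" "\<And>T i. T \<in> I \<Longrightarrow> ang (f \<circ> vt T) i = r (lb T i) * pi / n"
    by (rule conjugate_tiling) blast
  have le: "conj_sum V * pi / n \<le> wind (f V) (f \<circ> \<Delta>)" for V
  proof -
    have "(\<Sum>(T, i)\<in>corners V. ang (f \<circ> vt T) i) = (\<Sum>(T, i)\<in>corners V. r (lb T i) * pi / n)"
      by (intro sum.cong) (auto simp: corners_def f(4))
    also have "\<dots> = conj_sum V * pi / n"
      using corners_cnt[of "\<lambda>x. r x * pi / n" V]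
      by (simp add: conj_sum_def sum_distrib_right sum_divide_distrib mult.assoc)
    finally show ?thesis using map_angle_le[of f V] f(1-3) by simp
  qed
  have n0: "real n > 0" using n_pos by simp
  \<comment> \<open>The orientation of the image of the big triangle is not known beforehand; it is
    read off from the positive winding number at a corner.\<close>
  have "conj_sum (\<Delta> 1) * pi / n > 0" using conj_sum_pos[OF corner_S] n_pos by simp
  then have "wind ((f \<circ> \<Delta>) 1) (f \<circ> \<Delta>) > 0" using le[of "\<Delta> 1"] by simp
  then have cc: "ccw (f \<circ> \<Delta>)" by (rule wind_vertex_pos_imp_ccw)
  have c1: "conj_sum (\<Delta> i) * pi / n \<le> ang (f \<circ> \<Delta>) i" for i
    using le[of "\<Delta> i"] wind_vertex[OF cc, of i] by simp
  have lt: "conj_sum (\<Delta> i) < n" for i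
  proof -
    have "conj_sum (\<Delta> i) * pi / n < pi" using c1[of i] ang_bounds[OF cc, of i] by linarith
    then show ?thesis using n_pos by (simp add: divide_simps)
  qed
  then show "conj_sum (\<Delta> i) < n" .
  have nle: "x = n" if "n dvd x" "0 < x" "x * pi / n \<le> pi" for x :: nat
  proof -
    have "x \<le> n" using that(3) n_pos by (simp add: divide_simps)
    then show ?thesis using that(1,2) by (auto dest: dvd_imp_le)
  qed
  show "(\<Sum>i\<in>UNIV. conj_sum (\<Delta> i)) = n"
  proof (rule nle)
    have "(\<Sum>i\<in>UNIV. \<Sum>x\<in>UNIV. cnt (\<Delta> i) x * j x) = n"
    proof -
      have "(\<Sum>i\<in>UNIV. ang \<Delta> i) = pi" by (rule ang_sum[OF ccw_big])
      moreover have "(\<Sum>i\<in>UNIV. ang \<Delta> i) = (\<Sum>i\<in>UNIV. real (\<Sum>x\<in>UNIV. cnt (\<Delta> i) x * j x)) * (pi / n)"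
        unfolding sum_distrib_right[of _ _ "pi / n"] by (simp only: angle_sum_corner[symmetric] angle_sum_j times_divide_eq_right)
      ultimately have "(\<Sum>i\<in>UNIV. real (\<Sum>x\<in>UNIV. cnt (\<Delta> i) x * j x)) * (pi / n) = pi" by (simp only:)
      then have "(\<Sum>i\<in>UNIV. real (\<Sum>x\<in>UNIV. cnt (\<Delta> i) x * j x)) = n" using n_pos by (simp add: field_simps)
      then show ?thesis by (metis (mono_tags, lifting) of_nat_eq_iff of_nat_sum sum.cong)
    qed
    moreover have "[(\<Sum>i\<in>UNIV. conj_sum (\<Delta> i)) = (\<Sum>i\<in>UNIV. k * (\<Sum>x\<in>UNIV. cnt (\<Delta> i) x * j x))] (mod n)"
      by (intro cong_sum conj_sum_cong)
    ultimately have "[(\<Sum>i\<in>UNIV. conj_sum (\<Delta> i)) = k * n] (mod n)" by (simp add: sum_distrib_left[symmetric])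
    then show "n dvd (\<Sum>i\<in>UNIV. conj_sum (\<Delta> i))" by (simp add: cong_def mod_eq_0_iff_dvd)
    show "(\<Sum>i\<in>UNIV. conj_sum (\<Delta> i)) > 0" using conj_sum_pos[OF corner_S] by (simp add: sum_3)
    have "(\<Sum>i\<in>UNIV. conj_sum (\<Delta> i) * pi / n) \<le> (\<Sum>i\<in>UNIV. ang (f \<circ> \<Delta>) i)" by (intro sum_mono c1)
    then show "real (\<Sum>i\<in>UNIV. conj_sum (\<Delta> i)) * pi / n \<le> pi"
      using ang_sum[OF cc] by (simp add: sum_distrib_right sum_divide_distrib)
  qed
  have dv: "n dvd conj_sum V" if "angle_sum V = real m * pi" for V and m :: nat
  proof -
    have "(\<Sum>x\<in>UNIV. cnt V x * j x) * pi / n = m * pi" using that angle_sum_j[of V] by simp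
    then have "real (\<Sum>x\<in>UNIV. cnt V x * j x) = real (m * n)" using n_pos by (simp add: field_simps)
    then have "(\<Sum>x\<in>UNIV. cnt V x * j x) = m * n" by (rule of_nat_eq_iff[THEN iffD1])
    then show ?thesis using conj_sum_cong[of V] by (simp add: cong_def mod_eq_0_iff_dvd)
  qed
  show "conj_sum V = n" if V: "V \<in> S" "V \<in> oedge \<Delta> i" for V i
  proof (rule nle[OF _ conj_sum_pos[OF V(1)]])
    show "n dvd conj_sum V" using dv[of V 1] angle_sum_side[OF V] by simp
    have "side (f \<circ> \<Delta>) i (f V) = 0"
    proof -
      obtain t where "V = of_real (1 - t) * \<Delta> i + of_real t * \<Delta> (i + 1)" using oedge_iff[OF ccw_big] V(2) by blast
      then have t: "V = \<Delta> i + of_real t * (\<Delta> (i + 1) - \<Delta> i)" by (simp add: algebra_simps)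
      obtain d' where d': "\<And>x r. \<exists>r'. f (x + of_real r * (\<Delta> (i + 1) - \<Delta> i)) = f x + of_real r' * d'"
        using f(2)[of i] unfolding line_map_def by blast
      obtain a where a: "f V = f (\<Delta> i) + of_real a * d'" using d'[of "\<Delta> i" t] t by auto
      obtain b where b: "f (\<Delta> (i + 1)) = f (\<Delta> i) + of_real b * d'" using d'[of "\<Delta> i" 1] by auto
      show ?thesis by (simp add: side_def a b crs_scale)
    qed
    then have "wind (f V) (f \<circ> \<Delta>) \<le> pi" by (rule wind_line[OF cc])
    then show "conj_sum V * pi / n \<le> pi" using le[of V] by linarith
  qed
  show "conj_sum V = n \<or> conj_sum V = 2 * n" if V: "V \<in> S" "V \<in> otri \<Delta>" for V
  proof -
    have "n dvd conj_sum V" using angle_sum_inner[OF V] dv[of V 1] dv[of V 2] by auto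
    then obtain m where m: "conj_sum V = n * m" by (auto simp: dvd_def)
    have "conj_sum V * pi / n \<le> 2 * pi" using le[of V] wind_nonneg(2)[OF cc] by (meson order_trans)
    then have "m \<le> 2" using n_pos by (simp add: m divide_simps)
    moreover have "m > 0" using conj_sum_pos[OF V(1)] m by (cases m) auto
    ultimately have "m = 1 \<or> m = 2" by auto
    then show ?thesis using m by auto
  qed
qed

end

section \<open>Conjugates close to a right angle\<close>

text \<open>\<open>t\<close> is coprime to \<open>n\<close> and as close to \<open>n / 2\<close> as
  possible, and \<open>k\<close> is \<open>t\<close> times an inverse of \<open>j\<close> modulo
  \<open>n\<close>, made odd by adding \<open>n\<close> if necessary. Both the residue and its
  complement are bounded, because \<open>k\<close> may later be replaced by its negative.\<close>

lemma near_half: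
  fixes n j :: nat
  assumes n: "n > 2" and j: "coprime j n"
  obtains k where "coprime k (2 * n)" "2 * (k * j mod n) + 4 \<ge> n" "2 * (n - k * j mod n) + 4 \<ge> n"
    "odd n \<Longrightarrow> 2 * (k * j mod n) + 1 \<ge> n \<and> 2 * (n - k * j mod n) + 1 \<ge> n"
proof -
  define t where "t = (if odd n then (n - 1) div 2 else if 4 dvd n then n div 2 + 1 else n div 2 + 2)"
  have t: "coprime t n \<and> t < n \<and> 2 * t + 4 \<ge> n \<and> 2 * (n - t) + 4 \<ge> n \<and> (odd n \<longrightarrow> 2 * t + 1 \<ge> n \<and> 2 * (n - t) + 1 \<ge> n)"
  proof -
    consider (1) a where "n = 2 * a + 1" | (2) a where "n = 4 * a" | (3) a where "n = 4 * a + 2"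
    proof -
      have "\<exists>m. n = 4 * m \<or> n = 4 * m + 1 \<or> n = 4 * m + 2 \<or> n = 4 * m + 3" by presburger
      then obtain m where "n = 4 * m \<or> n = 4 * m + 1 \<or> n = 4 * m + 2 \<or> n = 4 * m + 3" ..
      then consider "n = 4 * m" | "n = 2 * (2 * m) + 1" | "n = 4 * m + 2" | "n = 2 * (2 * m + 1) + 1" by fastforce
      then show thesis using that by cases blast+
    qed
    then show ?thesis
    proof cases
      case 1
      have "t = a" by (simp add: t_def 1)
      moreover have "coprime a (2 * a + 1)" using coprime_add_one_right[of "2 * a"] by (simp only: coprime_mult_left_iff simp_thms)
      ultimately have "coprime t n" by (simp only: 1)
      moreover have "t < n" "2 * t + 4 \<ge> n" "2 * (n - t) + 4 \<ge> n" "2 * t + 1 \<ge> n" "2 * (n - t) + 1 \<ge> n"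
        using 1 \<open>t = a\<close> by auto
      ultimately show ?thesis by blast
    next
      case 2
      have tt: "t = 2 * a + 1" by (simp add: t_def 2)
      have "coprime (2 * a + 1) (4 * a)"
      proof -
        have "coprime (2 * a + 1) (2 * a)" using coprime_add_one_right[of "2 * a"] by (simp only: coprime_commute)
        moreover have "coprime (2 * a + 1) 2" by simp
        ultimately have "coprime (2 * a + 1) (2 * a * 2)" by (simp only: coprime_mult_right_iff)
        then show ?thesis by (simp add: mult.commute)
      qed
      then show ?thesis using 2 tt n by auto
    next
      case 3
      have tt: "t = 2 * a + 3"
      proof -
        have "\<not> 4 dvd n" using 3 by presburger
        then show ?thesis by (simp add: t_def 3)
      qed
      have "coprime (2 * a + 3) (4 * a + 2)"
      proof (rule coprimeI)
        fix c assume c: "c dvd 2 * a + 3" "c dvd 4 * a + 2"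
        then have "c dvd 2 * (2 * a + 3) - (4 * a + 2)" by (intro dvd_diff_nat dvd_mult) auto
        then have "c dvd 2 ^ 2" by simp
        moreover have "coprime c (2 ^ 2)"
        proof -
          have "odd c" using c(1) by (metis dvd_trans even_add even_mult_iff odd_numeral even_numeral numeral_3_eq_3 even_Suc)
          then have "coprime c 2" by simp
          then show ?thesis using coprime_power_right_iff[of c 2 2] by blast
        qed
        ultimately show "is_unit c" by (metis coprime_absorb_left)
      qed
      then show ?thesis using 3 tt n by auto
    qed
  qed
  obtain u where u: "[j * u = 1] (mod n)" using cong_solve_coprime_nat[OF j] by auto
  have ju: "coprime u n"
    using cong_imp_coprime[OF cong_sym[OF u]] by (simp add: coprime_mult_left_iff)
  have ut: "coprime (u * t) n" using ju t by simp
  define k where "k = (if odd (u * t) then u * t else u * t + n)"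
  have kn: "[k = u * t] (mod n)" by (simp add: k_def cong_def)
  have cop: "coprime k (2 * n)"
  proof -
    have "coprime k n" using cong_imp_coprime[OF cong_sym[OF kn] ut] .
    moreover have "odd k"
    proof (cases "odd (u * t)")
      case False
      then have "odd n" using ut n by (metis coprime_common_divisor odd_one)
      then show ?thesis using False by (simp add: k_def)
    qed (simp add: k_def)
    ultimately show ?thesis by simp
  qed
  have "[k * j = u * t * j] (mod n)" by (rule cong_mult[OF kn cong_refl])
  also have "u * t * j = (j * u) * t" by (simp add: mult_ac)
  also have "[j * u * t = 1 * t] (mod n)" by (rule cong_mult[OF u cong_refl])
  finally have "k * j mod n = t" using t by (simp add: cong_def)
  then show thesis using that[OF cop] t by simp
qed

text \<open>The three residues lie strictly between 0 and \<open>n\<close>, and their sum is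
  divisible by \<open>n\<close>, hence \<open>n\<close> or \<open>2 * n\<close>. In the second case
  the negative of \<open>k\<close>, represented by \<open>2 * n - k1\<close>, turns every residue
  into its complement.\<close>

lemma conjugate_sign:
  fixes j :: "3 \<Rightarrow> nat"
  assumes n: "n > 0" and k: "coprime k (2 * n)" and j: "\<And>x. 0 < j x" "(\<Sum>x\<in>UNIV. j x) = n"
  obtains k' where "coprime k' (2 * n)" "(\<Sum>x\<in>UNIV. k' * j x mod n) = n"
    "\<And>x. k' * j x mod n = k * j x mod n \<or> k' * j x mod n = n - k * j x mod n"
proof -
  define k1 where "k1 = k mod (2 * n)"
  have k1: "k1 < 2 * n" using n by (simp add: k1_def)
  have k1c: "coprime k1 (2 * n)"
  proof -
    have "2 * n \<noteq> 0" using n by simp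
    then show ?thesis using k coprime_mod_left_iff[of "2 * n" k] unfolding k1_def by blast
  qed
  have k1m: "k1 * i mod n = k * i mod n" for i
  proof -
    have "[k1 = k] (mod n)" unfolding k1_def by (simp add: cong_def mod_mod_cancel)
    then have "[k1 * i = k * i] (mod n)" by (rule cong_mult[OF _ cong_refl])
    then show ?thesis by (simp add: cong_def)
  qed
  have jn: "j x < n" for x
    using j(2) j(1)[of 1] j(1)[of 2] j(1)[of 3] exhaust_3[of x] by (auto simp: sum_3)
  have pos: "0 < k * j x mod n" for x
  proof (rule ccontr)
    assume "\<not> 0 < k * j x mod n"
    then have "n dvd k * j x" by (simp add: mod_eq_0_iff_dvd)
    moreover have "coprime n k" using k by (simp add: coprime_commute)
    ultimately have "n dvd j x" by (simp add: coprime_dvd_mult_right_iff)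
    then show False using j(1)[of x] jn[of x] by (auto dest: dvd_imp_le)
  qed
  have lt: "k * j x mod n < n" for x using n by simp
  have "[(\<Sum>x\<in>UNIV. k * j x mod n) = (\<Sum>x\<in>UNIV. k * j x)] (mod n)"
    by (intro cong_sum) (simp add: cong_def)
  moreover have "(\<Sum>x\<in>UNIV. k * j x) = k * n" using j(2) by (simp add: sum_distrib_left[symmetric])
  ultimately have "n dvd (\<Sum>x\<in>UNIV. k * j x mod n)" by (simp add: cong_def mod_eq_0_iff_dvd)
  then obtain c where c: "(\<Sum>x\<in>UNIV. k * j x mod n) = n * c" by (auto simp: dvd_def)
  have s3: "(\<Sum>x\<in>UNIV. k * j x mod n) = k * j 1 mod n + k * j 2 mod n + k * j 3 mod n" by (simp add: sum_3)
  have "n * c < n * 3" using lt[of 1] lt[of 2] lt[of 3] c s3 by linarith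
  then have "c < 3" by simp
  moreover have "c \<noteq> 0" using c s3 pos[of 1] by (cases c) auto
  ultimately consider "c = 1" | "c = 2" by linarith
  then show thesis
  proof cases
    case 1
    then show thesis using that[OF k] c by simp
  next
    case 2
    define k' where "k' = 2 * n - k1"
    have neg: "k' * j x mod n = n - k * j x mod n" for x
    proof -
      have "k' * j x + k1 * j x = (2 * j x) * n" using k1 by (simp add: k'_def distrib_right[symmetric])
      then have "(k' * j x mod n + k1 * j x mod n) mod n = 0" by (simp add: mod_add_eq)
      then have "n dvd k' * j x mod n + k * j x mod n" by (simp add: k1m mod_eq_0_iff_dvd)
      then obtain e where e: "k' * j x mod n + k * j x mod n = n * e" by (auto simp: dvd_def)
      have "k' * j x mod n < n" using n by simp
      then have "n * e < n * 2" using e lt[of x] by linarith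
      then have "e < 2" by simp
      moreover have "e \<noteq> 0" using e pos[of x] by (cases e) auto
      ultimately have "e = 1" by simp
      then show ?thesis using e by simp
    qed
    have "(\<Sum>x\<in>UNIV. k' * j x mod n) = n"
      unfolding neg using c 2 s3 lt[of 1] lt[of 2] lt[of 3] by (simp add: sum_3)
    moreover have "coprime k' (2 * n)"
    proof (rule coprimeI)
      fix d assume d: "d dvd k'" "d dvd 2 * n"
      have "k1 = 2 * n - k'" using k1 by (simp add: k'_def)
      then have "d dvd k1" using d by (simp add: dvd_diff_nat)
      then show "is_unit d" using coprime_common_divisor[OF k1c _ d(2)] by blast
    qed
    ultimately show thesis using that neg by blast
  qed
qed

lemma mod_eqI: "(x :: nat) = n * c + r \<Longrightarrow> r < n \<Longrightarrow> x mod n = r"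
  by simp

definition triple :: "nat \<Rightarrow> nat \<Rightarrow> nat \<Rightarrow> 3 \<Rightarrow> nat" where
  "triple a b c x = (if x = 1 then a else if x = 2 then b else c)"

lemma triple_simps [simp]: "triple a b c 1 = a" "triple a b c 2 = b" "triple a b c 3 = c"
  by (simp_all add: triple_def)

context congruent_dissection
begin

text \<open>Restates the bounds on conjugated angle sums with explicit residues, ready for concrete
  \<open>n\<close>, \<open>j\<close> and \<open>k\<close>.\<close>

lemma conjugate_counts:
  assumes n: "n > 0" and j: "\<And>x. \<theta> x = real (j x) * pi / real n" and k: "coprime k (2 * n)"
    and sum: "(\<Sum>x\<in>UNIV. k * j x mod n) = n"
  shows "V \<in> S \<Longrightarrow> V \<in> oedge \<Delta> i \<Longrightarrow> (\<Sum>x\<in>UNIV. cnt V x * (k * j x mod n)) = n"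
    and "(\<Sum>x\<in>UNIV. cnt (\<Delta> i) x * (k * j x mod n)) < n"
    and "(\<Sum>i\<in>UNIV. \<Sum>x\<in>UNIV. cnt (\<Delta> i) x * (k * j x mod n)) = n"
    and "V \<in> S \<Longrightarrow> V \<in> otri \<Delta> \<Longrightarrow> (\<Sum>x\<in>UNIV. cnt V x * (k * j x mod n)) = n \<or>
      (\<Sum>x\<in>UNIV. cnt V x * (k * j x mod n)) = 2 * n"
proof -
  interpret c: conjugated_dissection I vt \<Delta> lb \<theta> sd n j k "\<lambda>x. k * j x mod n"
    by unfold_locales (use assms in auto)
  note b = c.conj_sum_bounds[unfolded c.conj_sum_def]
  show "V \<in> S \<Longrightarrow> V \<in> oedge \<Delta> i \<Longrightarrow> (\<Sum>x\<in>UNIV. cnt V x * (k * j x mod n)) = n" by (rule b(1))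
  show "(\<Sum>x\<in>UNIV. cnt (\<Delta> i) x * (k * j x mod n)) < n" by (rule b(2))
  show "(\<Sum>i\<in>UNIV. \<Sum>x\<in>UNIV. cnt (\<Delta> i) x * (k * j x mod n)) = n" by (rule b(3))
  show "V \<in> S \<Longrightarrow> V \<in> otri \<Delta> \<Longrightarrow> (\<Sum>x\<in>UNIV. cnt V x * (k * j x mod n)) = n \<or>
      (\<Sum>x\<in>UNIV. cnt V x * (k * j x mod n)) = 2 * n" by (rule b(4))
qed

lemma cnt_term_le: "cnt V x * h x \<le> (\<Sum>x\<in>UNIV. cnt V x * h x)"
  by (rule member_le_sum) auto

lemma multiples_pos_sum:
  assumes n: "n > 0" and j: "\<And>x. \<theta> x = real (j x) * pi / real n"
  shows "0 < j x" "(\<Sum>x\<in>UNIV. j x) = n"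
proof -
  interpret r: rational_dissection I vt \<Delta> lb \<theta> sd n j
    by unfold_locales (use assms in auto)
  show "0 < j x" "(\<Sum>x\<in>UNIV. j x) = n" by (rule r.j_pos, rule r.j_sum)
qed

lemma near_half_conj:
  assumes n: "n > 0" and j: "\<And>x. \<theta> x = real (j x) * pi / real n" and x: "coprime (j x) n"
  obtains k where "coprime k (2 * n)" "(\<Sum>x\<in>UNIV. k * j x mod n) = n" "2 * (k * j x mod n) + 4 \<ge> n"
    "odd n \<Longrightarrow> 2 * (k * j x mod n) + 1 \<ge> n"
proof -
  note jj = multiples_pos_sum[of n j, OF n j]
  have n2: "n > 2" using jj(2) jj(1)[of 1] jj(1)[of 2] jj(1)[of 3] by (simp add: sum_3)
  obtain k where k: "coprime k (2 * n)" "2 * (k * j x mod n) + 4 \<ge> n" "2 * (n - k * j x mod n) + 4 \<ge> n"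
    "odd n \<Longrightarrow> 2 * (k * j x mod n) + 1 \<ge> n \<and> 2 * (n - k * j x mod n) + 1 \<ge> n"
    using near_half[OF n2 x] by metis
  obtain k' where k': "coprime k' (2 * n)" "(\<Sum>x\<in>UNIV. k' * j x mod n) = n"
    "\<And>x. k' * j x mod n = k * j x mod n \<or> k' * j x mod n = n - k * j x mod n"
    using conjugate_sign[OF n k(1) jj] by metis
  show thesis
  proof (rule that[OF k'(1,2)])
    show "2 * (k' * j x mod n) + 4 \<ge> n" using k'(3)[of x] k(2,3) by (elim disjE) (simp_all only:)
    show "2 * (k' * j x mod n) + 1 \<ge> n" if "odd n" using k'(3)[of x] k(4)[OF that] by (elim disjE) (simp_all only:)
  qed
qed

text \<open>In a conjugate where angle \<open>x\<close> is close to \<pi> / 2, only about two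
  corners with this angle fit at a point of a side.\<close>

lemma near_half_side:
  assumes n: "n > 0" and j: "\<And>x. \<theta> x = real (j x) * pi / real n" and x: "coprime (j x) n"
    and V: "V \<in> S" "V \<in> oedge \<Delta> i"
  obtains r where "2 * r + 4 \<ge> n" "odd n \<Longrightarrow> 2 * r + 1 \<ge> n" "cnt V x * r \<le> n"
proof -
  obtain k where k: "coprime k (2 * n)" "(\<Sum>x\<in>UNIV. k * j x mod n) = n" "2 * (k * j x mod n) + 4 \<ge> n"
    "odd n \<Longrightarrow> 2 * (k * j x mod n) + 1 \<ge> n" using near_half_conj[of n j, OF n j x] by metis
  have "cnt V x * (k * j x mod n) \<le> n"
    using cnt_term_le[of V x "\<lambda>x. k * j x mod n"] conjugate_counts(1)[of n j, OF n j k(1,2) V] by simp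
  then show thesis using that[OF k(3,4)] by blast
qed

lemma near_half_corner:
  assumes n: "n > 0" and j: "\<And>x. \<theta> x = real (j x) * pi / real n" and x: "coprime (j x) n"
  obtains r where "2 * r + 4 \<ge> n" "odd n \<Longrightarrow> 2 * r + 1 \<ge> n" "cnt (\<Delta> i) x * r < n"
proof -
  obtain k where k: "coprime k (2 * n)" "(\<Sum>x\<in>UNIV. k * j x mod n) = n" "2 * (k * j x mod n) + 4 \<ge> n"
    "odd n \<Longrightarrow> 2 * (k * j x mod n) + 1 \<ge> n" using near_half_conj[of n j, OF n j x] by metis
  have "cnt (\<Delta> i) x * (k * j x mod n) < n"
    using cnt_term_le[of "\<Delta> i" x "\<lambda>x. k * j x mod n"] conjugate_counts(2)[of n j k i, OF n j k(1,2)] by simp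
  then show thesis using that[OF k(3,4)] by blast
qed

end

section \<open>Parities at boundary vertices\<close>

text \<open>The labels 1, 2, 3 stand for \<alpha>, \<beta>, \<gamma>. \<open>nsim\<close> is the
  combinatorial form of non-similarity: the corners of the big triangle do not use, taken together,
  every tile angle exactly once.\<close>

locale special_dissection = congruent_dissection I vt \<Delta> lb \<theta> sd
  for I :: "'t set" and vt :: "'t \<Rightarrow> 3 \<Rightarrow> complex" and \<Delta> :: "3 \<Rightarrow> complex"
    and lb :: "'t \<Rightarrow> 3 \<Rightarrow> 3" and \<theta> :: "3 \<Rightarrow> real" and sd :: "3 \<Rightarrow> real" +
  assumes rel: "3 * \<theta> 1 + 2 * \<theta> 2 = pi"
    and nsim: "\<not> (\<forall>x. (\<Sum>i\<in>UNIV. cnt (\<Delta> i) x) = 1)"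
begin

lemma theta_3: "\<theta> 3 = 2 * \<theta> 1 + \<theta> 2"
  using theta_sum rel by (simp add: sum_3)

lemma theta_pos: "0 < \<theta> 1" "0 < \<theta> 2" "0 < \<theta> 3"
  using theta_bounds(1) by auto

lemma triple_angles:
  assumes "n > 0" "n * \<theta> 1 = a * pi" "n * \<theta> 2 = b * pi" "n = a + b + c"
  shows "\<theta> x = real (triple a b c x) * pi / real n"
proof -
  have 1: "\<theta> 1 = a * pi / n" "\<theta> 2 = b * pi / n" using assms(1-3) by (simp_all add: field_simps)
  have "real n * (\<theta> 1 + \<theta> 2 + \<theta> 3) = real n * pi" using theta_sum by (simp add: sum_3)
  then have "real n * \<theta> 3 = real n * pi - a * pi - b * pi" using assms(2,3) by (simp add: algebra_simps)
  also have "\<dots> = c * pi" using assms(4) by (simp add: algebra_simps)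
  finally have "\<theta> 3 = c * pi / n" using assms(1) by (simp add: field_simps)
  then show ?thesis using 1 exhaust_3[of x] by auto
qed

text \<open>A \<gamma> is worth two \<alpha> and one \<beta>, that is three units, so the sum of the
  two coefficients has the parity of the number of tiles. For the coefficients 3 and 2 it is
  odd.\<close>

lemma side_relation:
  assumes "V \<in> S" "V \<in> oedge \<Delta> i"
  shows "(cnt V 1 + 2 * cnt V 3) * \<theta> 1 + (cnt V 2 + cnt V 3) * \<theta> 2 = pi"
  using angle_sum_side[OF assms] by (simp add: angle_sum_cnt sum_3 theta_3 algebra_simps)

text \<open>The two relations give the angles \<open>1\<close>, \<open>P - 3\<close>,
  \<open>P - 1\<close> in units of \<pi> / (2 P - 3). Conjugated close to \<pi> / 2, \<alpha> would
  need \<open>(P - 2) * (P - 2)\<close> units, more than are available from \<open>P = 5\<close>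
  on.\<close>

lemma no_alpha_one_beta_side:
  assumes V: "V \<in> S" "V \<in> oedge \<Delta> i" and P: "P \<ge> 5" "cnt V 1 + 2 \<ge> P" "P * \<theta> 1 + \<theta> 2 = pi"
  shows False
proof -
  define n where "n = 2 * P - 3"
  have n: "n > 0" "n = 1 + (P - 3) + (P - 1)" using P by (auto simp: n_def)
  have rn: "real n = 2 * real P - 3" using P by (simp add: n_def of_nat_diff)
  have 1: "n * \<theta> 1 = (1::nat) * pi" using P(3) rel by (simp add: rn algebra_simps)
  have 2: "n * \<theta> 2 = (P - 3) * pi"
  proof -
    have "2 * (n * \<theta> 2) = n * pi - 3 * (n * \<theta> 1)"
      using arg_cong[OF rel, of "\<lambda>x. n * x"] by (simp add: algebra_simps)
    also have "\<dots> = 2 * ((real P - 3) * pi)" by (simp add: 1) (simp add: rn algebra_simps)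
    finally show ?thesis using P by (simp add: of_nat_diff)
  qed
  note j = triple_angles[OF n(1) 1 2 n(2)]
  obtain r where r: "odd n \<Longrightarrow> 2 * r + 1 \<ge> n" "cnt V 1 * r \<le> n"
    by (rule near_half_side[of n "triple 1 (P - 3) (P - 1)" 1 V i, OF n(1) j _ V]) auto
  have "odd n" using P by (simp add: n_def)
  then have "r \<ge> P - 2" using r(1) P by (simp add: n_def)
  then have "(P - 2) * (P - 2) \<le> cnt V 1 * r" using P by (intro mult_le_mono) auto
  then have "(P - 2) * (P - 2) \<le> 2 * P - 3" using r(2) by (simp add: n_def)
  moreover obtain t where "P = 5 + t" using P(1) le_Suc_ex by blast
  ultimately show False by (simp add: algebra_simps)
qed

text \<open>The denominator depends on \<open>Q\<close> modulo 3. If \<open>Q\<close> is 2 modulo 3,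
  \<beta> is one unit of \<pi> / Q and can be moved close to \<pi> / 2. Otherwise \<beta> is 3 units
  with a denominator divisible by 3; then an explicit \<open>k\<close> produces the residues
  \<open>2\<close>, \<open>n - 3\<close>, \<open>1\<close>, and an angle so close to \<pi> cannot
  occur \<open>Q\<close> times.\<close>

lemma no_even_beta_side:
  assumes V: "V \<in> S" "V \<in> oedge \<Delta> i" and Q: "even Q" "Q \<ge> 4" "cnt V 2 = Q" "Q * \<theta> 2 = pi"
  shows False
proof -
  have 3: "3 * Q * \<theta> 1 = (Q - 2) * pi"
  proof -
    have "3 * Q * \<theta> 1 = Q * pi - 2 * (Q * \<theta> 2)" using arg_cong[OF rel, of "\<lambda>x. Q * x"] by (simp add: algebra_simps)
    then show ?thesis using Q by (simp add: of_nat_diff algebra_simps)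
  qed
  consider (0) a where "Q = 3 * a" | (1) a where "Q = 3 * a + 1" | (2) a where "Q = 3 * a + 2"
  proof -
    have "Q = 3 * (Q div 3) + Q mod 3" "Q mod 3 < 3" by simp_all
    then have "Q = 3 * (Q div 3) \<or> Q = 3 * (Q div 3) + 1 \<or> Q = 3 * (Q div 3) + 2" by linarith
    then show thesis using that by blast
  qed
  then show False
  proof cases
    case 2
    have n: "Q > 0" "Q = a + 1 + (2 * a + 1)" using 2 Q by auto
    have q1: "Q * \<theta> 1 = a * pi" using 3 2 by (simp add: algebra_simps)
    have q2: "Q * \<theta> 2 = (1::nat) * pi" using Q by simp
    note j = triple_angles[OF n(1) q1 q2 n(2)]
    obtain r where r: "2 * r + 4 \<ge> Q" "cnt V 2 * r \<le> Q"
      by (rule near_half_side[of Q "triple a 1 (2 * a + 1)" 2 V i, OF n(1) j _ V]) auto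
    have "Q * r \<le> Q * 1" using r(2) Q(3) by simp
    then have "r \<le> 1" using n(1) by (simp only: mult_le_cancel1)
    then have "Q \<le> 6" using r(1) by simp
    then have "a = 1 \<or> a = 0" using 2 by auto
    then show False using 2 Q by auto
  next
    case 0
    obtain b where b: "a = 2 * b" "b > 0" using 0 Q by (auto simp: elim!: evenE)
    define n where "n = 18 * b"
    have n: "n > 0" "n = (6 * b - 2) + 3 + (12 * b - 1)" using b by (auto simp: n_def)
    have Qb: "Q = 6 * b" using 0 b by simp
    have q1: "n * \<theta> 1 = (6 * b - 2) * pi" using 3 b by (simp add: n_def Qb of_nat_diff)
    have q2: "n * \<theta> 2 = (3::nat) * pi" using Q(4) by (simp add: n_def Qb)
    note j = triple_angles[OF n(1) q1 q2 n(2)]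
    \<comment> \<open>Chosen so that \<open>3 * k\<close> is -3 modulo
      \<open>18 * b\<close>.\<close>
    let ?k = "6 * b - 1"
    obtain c where c: "b = Suc c" using b(2) by (cases b) auto
    have m: "?k * triple (6 * b - 2) 3 (12 * b - 1) 1 mod n = 2" "?k * triple (6 * b - 2) 3 (12 * b - 1) 2 mod n = 18 * b - 3"
      "?k * triple (6 * b - 2) 3 (12 * b - 1) 3 mod n = 1"
      by (rule mod_eqI[of _ _ "2 * b - 1"] mod_eqI[of _ _ 0] mod_eqI[of _ _ "4 * b - 1"];
        simp add: n_def c algebra_simps)+
    have k: "coprime ?k (2 * n)"
    proof -
      have "coprime ?k (6 * b)" by (rule coprime_diff_one_left_nat) (use b(2) in simp)
      then have "coprime ?k (6 * b * 6)" by (simp only: coprime_mult_right_iff simp_thms)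
      then show ?thesis by (simp add: n_def mult.commute)
    qed
    have sm: "(\<Sum>x\<in>UNIV. ?k * triple (6 * b - 2) 3 (12 * b - 1) x mod n) = n"
      unfolding sum_3 m using b(2) by (simp add: n_def)
    have "cnt V 2 * (18 * b - 3) \<le> n"
      using cnt_term_le[of V 2 "\<lambda>x. ?k * triple (6 * b - 2) 3 (12 * b - 1) x mod n"]
      unfolding conjugate_counts(1)[of n "triple (6 * b - 2) 3 (12 * b - 1)" ?k, OF n(1) j k sm V] m .
    then show False using Q(3) Qb c by (simp add: n_def algebra_simps)
  next
    case 1
    obtain b where b: "a = 2 * b + 1" using 1 Q by (auto elim!: oddE)
    define n where "n = 18 * b + 12"
    have n: "n > 0" "n = (6 * b + 2) + 3 + (12 * b + 7)" by (auto simp: n_def)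
    have Qb: "Q = 6 * b + 4" using 1 b by simp
    have q1: "n * \<theta> 1 = (6 * b + 2) * pi" using 3 by (simp add: n_def Qb algebra_simps)
    have q2: "n * \<theta> 2 = (3::nat) * pi" using Q(4) by (simp add: n_def Qb algebra_simps)
    note j = triple_angles[OF n(1) q1 q2 n(2)]
    \<comment> \<open>Again \<open>3 * k\<close> is -3 modulo \<open>n\<close>, since it equals
      \<open>2 * n - 3\<close>.\<close>
    let ?k = "12 * b + 7"
    have m: "?k * triple (6 * b + 2) 3 (12 * b + 7) 1 mod n = 2" "?k * triple (6 * b + 2) 3 (12 * b + 7) 2 mod n = 18 * b + 9"
      "?k * triple (6 * b + 2) 3 (12 * b + 7) 3 mod n = 1"
      by (rule mod_eqI[of _ _ "4 * b + 1"] mod_eqI[of _ _ 1] mod_eqI[of _ _ "8 * b + 4"];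
        simp add: n_def algebra_simps)+
    have k: "coprime ?k (2 * n)"
    proof -
      have "coprime ?k (12 * b + 8)" using coprime_add_one_right[of ?k] by (simp add: add.commute)
      moreover have "coprime ?k 3"
      proof -
        have "?k mod 3 = 1" by presburger
        then show ?thesis using coprime_mod_left_iff[of 3 ?k] by simp
      qed
      ultimately have "coprime ?k ((12 * b + 8) * 3)" by (simp only: coprime_mult_right_iff simp_thms)
      then show ?thesis by (simp add: n_def algebra_simps)
    qed
    have sm: "(\<Sum>x\<in>UNIV. ?k * triple (6 * b + 2) 3 (12 * b + 7) x mod n) = n"
      unfolding sum_3 m by (simp add: n_def)
    have "cnt V 2 * (18 * b + 9) \<le> n"
      using cnt_term_le[of V 2 "\<lambda>x. ?k * triple (6 * b + 2) 3 (12 * b + 7) x mod n"]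
      unfolding conjugate_counts(1)[of n "triple (6 * b + 2) 3 (12 * b + 7)" ?k, OF n(1) j k sm V] m .
    then show False using Q(3) Qb by (simp add: n_def algebra_simps)
  qed
qed

text \<open>With \<open>Q = 2 * b + 1\<close> the unit is \<pi> / (6 b + 1) and \<beta> is 2 units,
  coprime to the odd denominator. A conjugate takes it to at least \<open>3 * b\<close> units, too
  much for \<open>2 * b + 1\<close> copies.\<close>

lemma no_one_alpha_odd_beta_side:
  assumes V: "V \<in> S" "V \<in> oedge \<Delta> i" and Q: "odd Q" "Q \<ge> 3" "cnt V 2 = Q" "\<theta> 1 + Q * \<theta> 2 = pi"
  shows False
proof -
  obtain b where b: "Q = 2 * b + 1" "b > 0" using Q by (auto elim!: oddE)
  define n where "n = 6 * b + 1"
  have n: "n > 0" "n = (2 * b - 1) + 2 + 4 * b" using b by (auto simp: n_def)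
  have e: "\<theta> 1 = pi - Q * \<theta> 2" using Q(4) by simp
  have q2: "n * \<theta> 2 = (2::nat) * pi" using rel unfolding e by (simp add: n_def b algebra_simps)
  have q1: "n * \<theta> 1 = (2 * b - 1) * pi"
  proof -
    have "n * \<theta> 1 = n * pi - Q * (n * \<theta> 2)" unfolding e by (simp add: algebra_simps)
    then show ?thesis unfolding q2 using b(2) by (simp add: n_def b(1) of_nat_diff algebra_simps)
  qed
  note j = triple_angles[OF n(1) q1 q2 n(2)]
  have on: "odd n" by (simp add: n_def)
  obtain r where r: "odd n \<Longrightarrow> 2 * r + 1 \<ge> n" "cnt V 2 * r \<le> n"
    by (rule near_half_side[of n "triple (2 * b - 1) 2 (4 * b)" 2 V i, OF n(1) j _ V]) (use on in auto)
  have "r \<ge> 3 * b" using r(1)[OF on] by (simp add: n_def)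
  then have "(2 * b + 1) * (3 * b) \<le> n" using r(2) Q(3) b(1) mult_le_mono2[of "3 * b" r "2 * b + 1"] by simp
  moreover obtain c where "b = Suc c" using b(2) by (cases b) auto
  ultimately show False by (simp add: n_def algebra_simps)
qed

text \<open>With \<open>Q = 2 * b + 4\<close> the unit is \<pi> / (6 b + 8), and \<beta> is a single
  unit. At most one \<beta> can hide in a \<gamma>, so at least \<open>Q - 1\<close> of them occur
  openly.\<close>

lemma no_two_alpha_even_beta_side:
  assumes V: "V \<in> S" "V \<in> oedge \<Delta> i" and Q: "even Q" "Q \<ge> 4" "cnt V 2 + 1 \<ge> Q" "2 * \<theta> 1 + Q * \<theta> 2 = pi"
  shows False
proof -
  obtain b where b: "Q = 2 * b + 4" using Q by (metis evenE le_Suc_ex dvd_diffD1 even_numeral add.commute dvd_add_right_iff)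
  define n where "n = 6 * b + 8"
  have n: "n > 0" "n = (2 * b + 2) + 1 + (4 * b + 5)" by (auto simp: n_def)
  have e: "\<theta> 1 = (pi - Q * \<theta> 2) / 2" using Q(4) by simp
  have q2: "n * \<theta> 2 = (1::nat) * pi" using rel unfolding e by (simp add: n_def b field_simps)
  have q1: "n * \<theta> 1 = (2 * b + 2) * pi"
  proof -
    have "n * \<theta> 1 = (n * pi - Q * (n * \<theta> 2)) / 2" unfolding e by (simp add: algebra_simps)
    then show ?thesis unfolding q2 by (simp add: n_def b(1) algebra_simps)
  qed
  note j = triple_angles[OF n(1) q1 q2 n(2)]
  show False
  proof (cases "b = 0")
    \<comment> \<open>The denominator is 8 and the angles are 2, 1, 5 units. The general bound near
      one half is too weak here; \<open>k = 5\<close> takes \<beta> to 5 units, and three of these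
      exceed 8.\<close>
    case True
    let ?j = "triple (2 * b + 2) 1 (4 * b + 5)"
    have m: "5 * ?j 1 mod n = 2" "5 * ?j 2 mod n = 5" "5 * ?j 3 mod n = 1" by (simp_all add: True n_def)
    have k: "coprime 5 (2 * n)" by (simp add: n_def True coprime_iff_gcd_eq_1 gcd_nat.simps)
    have sm: "(\<Sum>x\<in>UNIV. 5 * ?j x mod n) = n" unfolding sum_3 m by (simp add: n_def True)
    have "cnt V 2 * 5 \<le> n" using cnt_term_le[of V 2 "\<lambda>x. 5 * ?j x mod n"]
      unfolding conjugate_counts(1)[of n ?j 5, OF n(1) j k sm V] m .
    then show False using Q(3) b by (simp add: n_def True)
  next
    case False
    then obtain c where c: "b = Suc c" by (cases b) auto
    obtain r where r: "2 * r + 4 \<ge> n" "cnt V 2 * r \<le> n"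
      by (rule near_half_side[of n "triple (2 * b + 2) 1 (4 * b + 5)" 2 V i, OF n(1) j _ V]) auto
    have "r \<ge> 3 * b + 2" using r(1) by (simp add: n_def)
    then have "(2 * b + 3) * (3 * b + 2) \<le> cnt V 2 * r" using Q(3) b by (intro mult_le_mono) auto
    then show False using r(2) c by (simp add: n_def algebra_simps)
  qed
qed

text \<open>Excludes that an even number of \<beta> replaces one \<alpha> at a corner, which would
  change the parity. The tile angles are those of \<open>no_two_alpha_even_beta_side\<close>, now
  used with the strict bound at a corner.\<close>

lemma no_alpha_even_beta_corner:
  assumes q: "even q" "q \<ge> 2" "\<theta> 1 = q * \<theta> 2" "cnt (\<Delta> i) 2 \<ge> q"
  shows False
proof -
  obtain b where b: "q = 2 * b + 2" using q by (metis evenE le_Suc_ex dvd_diffD1 even_numeral add.commute dvd_add_right_iff)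
  define n where "n = 6 * b + 8"
  have n: "n > 0" "n = (2 * b + 2) + 1 + (4 * b + 5)" by (auto simp: n_def)
  have q2: "n * \<theta> 2 = (1::nat) * pi" using rel unfolding q(3) by (simp add: n_def b algebra_simps)
  have q1: "n * \<theta> 1 = (2 * b + 2) * pi"
    using q2 unfolding q(3) by (simp add: b mult.left_commute)
  note j = triple_angles[OF n(1) q1 q2 n(2)]
  show False
  proof (cases "b = 0")
    case True
    let ?j = "triple (2 * b + 2) 1 (4 * b + 5)"
    have m: "5 * ?j 1 mod n = 2" "5 * ?j 2 mod n = 5" "5 * ?j 3 mod n = 1" by (simp_all add: True n_def)
    have k: "coprime 5 (2 * n)" by (simp add: n_def True coprime_iff_gcd_eq_1 gcd_nat.simps)
    have sm: "(\<Sum>x\<in>UNIV. 5 * ?j x mod n) = n" unfolding sum_3 m by (simp add: n_def True)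
    have "cnt (\<Delta> i) 2 * 5 < n"
      using le_less_trans[OF cnt_term_le[of "\<Delta> i" 2 "\<lambda>x. 5 * ?j x mod n"] conjugate_counts(2)[of n ?j 5 i, OF n(1) j k sm]]
      unfolding m .
    then show False using q(4) b by (simp add: n_def True)
  next
    case False
    then obtain c where c: "b = Suc c" by (cases b) auto
    obtain r where r: "2 * r + 4 \<ge> n" "cnt (\<Delta> i) 2 * r < n"
      by (rule near_half_corner[of n "triple (2 * b + 2) 1 (4 * b + 5)" 2 i, OF n(1) j]) auto
    have "r \<ge> 3 * b + 2" using r(1) by (simp add: n_def)
    then have "(2 * b + 2) * (3 * b + 2) \<le> cnt (\<Delta> i) 2 * r" using q(4) b by (intro mult_le_mono) auto
    then show False using r(2) c by (simp add: n_def algebra_simps)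
  qed
qed

text \<open>The counterpart for an even number of \<alpha> replacing one \<beta>: \<alpha> is one
  unit of \<pi> / (4 b + 7).\<close>

lemma no_beta_even_alpha_corner:
  assumes p: "even p" "p \<ge> 2" "\<theta> 2 = p * \<theta> 1" "cnt (\<Delta> i) 1 \<ge> p"
  shows False
proof -
  obtain b where b: "p = 2 * b + 2" using p by (metis evenE le_Suc_ex dvd_diffD1 even_numeral add.commute dvd_add_right_iff)
  define n where "n = 4 * b + 7"
  have n: "n > 0" "n = 1 + (2 * b + 2) + (2 * b + 4)" by (auto simp: n_def)
  have q1: "n * \<theta> 1 = (1::nat) * pi" using rel unfolding p(3) by (simp add: n_def b algebra_simps)
  have q2: "n * \<theta> 2 = (2 * b + 2) * pi"
    using q1 unfolding p(3) by (simp add: b mult.left_commute)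
  note j = triple_angles[OF n(1) q1 q2 n(2)]
  show False
  proof (cases "b = 0")
    \<comment> \<open>The denominator is 7 and the angles are 1, 2, 4 units. The odd number 11 is 4
      modulo 7 and takes \<alpha> to 4 units, of which two exceed 7.\<close>
    case True
    let ?j = "triple 1 (2 * b + 2) (2 * b + 4)"
    have m: "11 * ?j 1 mod n = 4" "11 * ?j 2 mod n = 1" "11 * ?j 3 mod n = 2" by (simp_all add: True n_def)
    have k: "coprime 11 (2 * n)" by (simp add: n_def True coprime_iff_gcd_eq_1 gcd_nat.simps)
    have sm: "(\<Sum>x\<in>UNIV. 11 * ?j x mod n) = n" unfolding sum_3 m by (simp add: n_def True)
    have "cnt (\<Delta> i) 1 * 4 < n"
      using le_less_trans[OF cnt_term_le[of "\<Delta> i" 1 "\<lambda>x. 11 * ?j x mod n"] conjugate_counts(2)[of n ?j 11 i, OF n(1) j k sm]]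
      unfolding m .
    then show False using p(4) b by (simp add: n_def True)
  next
    case False
    then obtain c where c: "b = Suc c" by (cases b) auto
    have on: "odd n" by (simp add: n_def)
    obtain r where r: "odd n \<Longrightarrow> 2 * r + 1 \<ge> n" "cnt (\<Delta> i) 1 * r < n"
      by (rule near_half_corner[of n "triple 1 (2 * b + 2) (2 * b + 4)" 1 i, OF n(1) j]) auto
    have "r \<ge> 2 * b + 3" using r(1)[OF on] by (simp add: n_def)
    then have "(2 * b + 2) * (2 * b + 3) \<le> cnt (\<Delta> i) 1 * r" using p(4) b by (intro mult_le_mono) auto
    then show False using r(2) c by (simp add: n_def algebra_simps)
  qed
qed

text \<open>With \<open>q = 2 * b + 1\<close> the denominator is \<open>6 * b + 7\<close>, odd and
  hence coprime to the 2 units of \<beta>. Moved to at least \<open>3 * b + 3\<close> units, \<beta>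
  does not fit \<open>q\<close> times.\<close>

lemma no_two_alpha_odd_beta_corner:
  assumes q: "odd q" "q \<ge> 3" "2 * \<theta> 1 = q * \<theta> 2" "cnt (\<Delta> i) 2 \<ge> q"
  shows False
proof -
  obtain b where b: "q = 2 * b + 1" "b > 0" using q by (auto elim!: oddE)
  define n where "n = 6 * b + 7"
  have n: "n > 0" "n = (2 * b + 1) + 2 + (4 * b + 4)" by (auto simp: n_def)
  have e: "\<theta> 1 = q * \<theta> 2 / 2" using q(3) by simp
  have q2: "n * \<theta> 2 = (2::nat) * pi" using rel unfolding e by (simp add: n_def b field_simps)
  have q1: "n * \<theta> 1 = (2 * b + 1) * pi"
  proof -
    have "n * \<theta> 1 = q * (n * \<theta> 2) / 2" unfolding e by simp
    then show ?thesis unfolding q2 by (simp add: b)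
  qed
  note j = triple_angles[OF n(1) q1 q2 n(2)]
  have on: "odd n" by (simp add: n_def)
  obtain r where r: "odd n \<Longrightarrow> 2 * r + 1 \<ge> n" "cnt (\<Delta> i) 2 * r < n"
    by (rule near_half_corner[of n "triple (2 * b + 1) 2 (4 * b + 4)" 2 i, OF n(1) j]) (use on in auto)
  have "r \<ge> 3 * b + 3" using r(1)[OF on] by (simp add: n_def)
  then have "(2 * b + 1) * (3 * b + 3) \<le> cnt (\<Delta> i) 2 * r" using q(4) b by (intro mult_le_mono) auto
  moreover obtain c where "b = Suc c" using b(2) by (cases b) auto
  ultimately show False using r(2) by (simp add: n_def algebra_simps)
qed

text \<open>The heptagonal triangle with angles in the ratio 1 : 2 : 4. The chosen \<open>k\<close>
  are odd and congruent to 1, 2, 4 modulo 7, and they permute the angles cyclically. Each gives a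
  linear equation for the multiplicities \<open>t x\<close> of the tile angles at the three corners;
  the only solution has all \<open>t x = 1\<close>, against \<open>nsim\<close>.\<close>

lemma beta_not_double: "\<theta> 2 \<noteq> 2 * \<theta> 1"
proof
  assume e: "\<theta> 2 = 2 * \<theta> 1"
  have n: "(7::nat) > 0" "(7::nat) = 1 + 2 + 4" by simp_all
  have q1: "(7::nat) * \<theta> 1 = (1::nat) * pi" and q2: "(7::nat) * \<theta> 2 = (2::nat) * pi" using rel e by simp_all
  note j = triple_angles[OF n(1) q1 q2 n(2)]
  let ?j = "triple 1 2 4"
  have k: "coprime 15 (2 * (7::nat))" "coprime 9 (2 * (7::nat))" "coprime 11 (2 * (7::nat))"
    by (simp_all add: coprime_iff_gcd_eq_1 gcd_nat.simps)
  have s: "(\<Sum>x\<in>UNIV. 15 * ?j x mod 7) = 7" "(\<Sum>x\<in>UNIV. 9 * ?j x mod 7) = 7" "(\<Sum>x\<in>UNIV. 11 * ?j x mod 7) = 7"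
    by (simp_all add: sum_3)
  define t where "t x = (\<Sum>i\<in>UNIV. cnt (\<Delta> i) x)" for x
  note f = conjugate_counts(3)[of 7 ?j, OF n(1) j]
  have "t 1 + 2 * t 2 + 4 * t 3 = 7" "2 * t 1 + 4 * t 2 + t 3 = 7" "4 * t 1 + t 2 + 2 * t 3 = 7"
    using f[OF k(1) s(1)] f[OF k(2) s(2)] f[OF k(3) s(3)] by (simp_all add: t_def sum_3)
  then have "t 1 = 1" "t 2 = 1" "t 3 = 1" by linarith+
  then have "\<forall>x. t x = 1" by (simp add: forall_3)
  then show False using nsim by (simp add: t_def)
qed

end

section \<open>Arithmetic with the square root of 2 for the tile with angles \<pi> / 4, \<pi> / 8, 5
  \<pi> / 8\<close>

lemma sqrt2_irrational: "sqrt 2 \<notin> \<rat>"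
proof
  assume "sqrt 2 \<in> \<rat>"
  then have "sqrt 2 \<in> \<int>" by (intro rational_algebraic_int_is_int) auto
  then obtain m :: int where m: "sqrt 2 = of_int m" by (auto elim: Ints_cases)
  have "1 < sqrt 2" "sqrt 2 < 2" by (simp_all add: real_less_rsqrt real_less_lsqrt)
  then show False unfolding m by simp
qed

lemma rational_sqrt2:
  assumes "a \<in> \<rat>" "b \<in> \<rat>" "a + b * sqrt 2 = 0"
  shows "a = 0" "b = 0"
proof -
  show b: "b = 0"
  proof (rule ccontr)
    assume "b \<noteq> 0"
    then have "sqrt 2 = - a / b" using assms(3) by (simp add: field_simps)
    also have "\<dots> \<in> \<rat>" using assms by simp
    finally show False using sqrt2_irrational by simp
  qed
  then show "a = 0" using assms(3) by simp
qed

lemma rational_square_sqrt2: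
  fixes a b :: real
  assumes "a \<in> \<rat>" "b \<in> \<rat>" "a\<^sup>2 = 2 * b\<^sup>2"
  shows "a = 0" "b = 0"
proof -
  have "(a - b * sqrt 2) * (a + b * sqrt 2) = a\<^sup>2 - 2 * b\<^sup>2" by (simp add: algebra_simps power2_eq_square)
  then have "a + (- b) * sqrt 2 = 0 \<or> a + b * sqrt 2 = 0" using assms(3) by auto
  moreover have "- b \<in> \<rat>" using assms(2) by simp
  ultimately have "a = 0 \<and> b = 0" using rational_sqrt2[of a b] rational_sqrt2[of a "- b"] assms(1,2) by fastforce
  then show "a = 0" "b = 0" by auto
qed

lemma sin_cos_pi8:
  "(sin (pi / 8))\<^sup>2 = (2 - sqrt 2) / 4" "(cos (pi / 8))\<^sup>2 = (2 + sqrt 2) / 4" "sin (pi / 8) * cos (pi / 8) = sqrt 2 / 4"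
proof -
  have c: "cos (pi / 4) = sqrt 2 / 2" "sin (pi / 4) = sqrt 2 / 2" by (simp_all add: cos_45 sin_45)
  have "cos (2 * (pi / 8)) = 2 * (cos (pi / 8))\<^sup>2 - 1" by (rule cos_double_cos)
  then show 1: "(cos (pi / 8))\<^sup>2 = (2 + sqrt 2) / 4" using c by simp
  then show "(sin (pi / 8))\<^sup>2 = (2 - sqrt 2) / 4" unfolding sin_squared_eq by (simp add: field_simps)
  have "sin (2 * (pi / 8)) = 2 * sin (pi / 8) * cos (pi / 8)" by (rule sin_double)
  then show "sin (pi / 8) * cos (pi / 8) = sqrt 2 / 4" using c by simp
qed

text \<open>The three numbers are the sides of the exceptional tile divided by its circumdiameter.
  For nonzero \<open>x\<close> a rational square puts \<open>u\<close> into the field generated by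
  \<open>sqrt 2\<close>, so the norm of \<open>u\<^sup>2\<close> is the square of a rational. This
  norm is \<open>C\<^sup>2 / 8\<close>, and irrationality of \<open>sqrt 2\<close> makes
  \<open>C\<close> vanish.\<close>

lemma pi8_length_square_rational:
  fixes x y z :: nat
  assumes "(x * (sqrt 2 / 2) + y * sin (pi / 8) + z * cos (pi / 8))\<^sup>2 \<in> \<rat>"
  shows "y = 0 \<and> z = 0"
proof -
  define u where "u = y * sin (pi / 8) + z * cos (pi / 8)"
  define A B where "A = real y ^ 2 + real z ^ 2" and "B = real z ^ 2 + 2 * real y * real z - real y ^ 2"
  have rat: "A \<in> \<rat>" "B \<in> \<rat>" by (simp_all add: A_def B_def)
  have u2: "u\<^sup>2 = A / 2 + B / 4 * sqrt 2"
  proof -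
    have "u\<^sup>2 = real y ^ 2 * (sin (pi / 8))\<^sup>2 + real z ^ 2 * (cos (pi / 8))\<^sup>2 + 2 * real y * real z * (sin (pi / 8) * cos (pi / 8))"
      by (simp add: u_def power2_eq_square algebra_simps)
    then show ?thesis unfolding sin_cos_pi8 by (simp add: A_def B_def field_simps)
  qed
  obtain q where q: "q \<in> \<rat>" "(x * (sqrt 2 / 2) + u)\<^sup>2 = q" using assms by (auto simp: u_def add.assoc)
  have e: "real x ^ 2 / 2 + real x * sqrt 2 * u + u\<^sup>2 = q"
    unfolding q(2)[symmetric] by (simp add: power2_eq_square algebra_simps)
  \<comment> \<open>The quadratic form has no nontrivial rational zero, as completing the square
    shows.\<close>
  have fin: "y = 0 \<and> z = 0" if "real y ^ 2 + 2 * real y * real z - real z ^ 2 = 0"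
  proof -
    have "(real y + real z)\<^sup>2 = 2 * (real z)\<^sup>2" using that by (simp add: power2_eq_square algebra_simps)
    then have "real z = 0" "real y + real z = 0" using rational_square_sqrt2[of "real y + real z" "real z"] by auto
    then show ?thesis by simp
  qed
  show ?thesis
  proof (cases "x = 0")
    case True
    then have "(A / 2 - q) + B / 4 * sqrt 2 = 0" using e u2 by simp
    then have "B / 4 = 0" using rational_sqrt2(2)[of "A / 2 - q" "B / 4"] rat q(1) by simp
    then have "(real y + real z)\<^sup>2 = 2 * (real y)\<^sup>2" by (simp add: B_def power2_eq_square algebra_simps)
    then have "real y = 0" "real y + real z = 0" using rational_square_sqrt2[of "real y + real z" "real y"] by auto
    then show ?thesis by simp
  next
    case False
    define \<alpha> \<beta> where "\<alpha> = - B / (4 * real x)" and "\<beta> = (q - real x ^ 2 / 2 - A / 2) / (2 * real x)"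
    have r: "\<alpha> \<in> \<rat>" "\<beta> \<in> \<rat>" using rat q(1) by (simp_all add: \<alpha>_def \<beta>_def)
    have "real x * sqrt 2 * u = (q - real x ^ 2 / 2 - A / 2) - B / 4 * sqrt 2" using e u2 by simp
    then have "sqrt 2 * (real x * sqrt 2 * u) = sqrt 2 * ((q - real x ^ 2 / 2 - A / 2) - B / 4 * sqrt 2)" by simp
    then have "2 * real x * u = (q - real x ^ 2 / 2 - A / 2) * sqrt 2 - B / 2" by (simp add: algebra_simps)
    moreover have "2 * real x * \<alpha> = - B / 2" "2 * real x * \<beta> = q - real x ^ 2 / 2 - A / 2"
      using False by (simp_all add: \<alpha>_def \<beta>_def)
    ultimately have "2 * real x * u = 2 * real x * (\<alpha> + \<beta> * sqrt 2)" by (simp add: distrib_left mult.assoc[symmetric])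
    then have "u = \<alpha> + \<beta> * sqrt 2" using False by simp
    then have "u\<^sup>2 = (\<alpha>\<^sup>2 + 2 * \<beta>\<^sup>2) + 2 * \<alpha> * \<beta> * sqrt 2" by (simp add: power2_eq_square algebra_simps)
    then have "(\<alpha>\<^sup>2 + 2 * \<beta>\<^sup>2 - A / 2) + (2 * \<alpha> * \<beta> - B / 4) * sqrt 2 = 0" using u2 by (simp add: algebra_simps)
    then have "\<alpha>\<^sup>2 + 2 * \<beta>\<^sup>2 - A / 2 = 0" "2 * \<alpha> * \<beta> - B / 4 = 0"
      using rational_sqrt2[of "\<alpha>\<^sup>2 + 2 * \<beta>\<^sup>2 - A / 2" "2 * \<alpha> * \<beta> - B / 4"] r rat by simp_all
    then have AB: "A = 2 * (\<alpha>\<^sup>2 + 2 * \<beta>\<^sup>2)" "B = 8 * \<alpha> * \<beta>" by simp_all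
    define C where "C = real y ^ 2 + 2 * real y * real z - real z ^ 2"
    have "C\<^sup>2 = 2 * A\<^sup>2 - B\<^sup>2" by (simp add: A_def B_def C_def power2_eq_square algebra_simps)
    also have "\<dots> = 2 * (2 * (\<alpha>\<^sup>2 - 2 * \<beta>\<^sup>2))\<^sup>2" unfolding AB by (simp add: power2_eq_square algebra_simps)
    finally have "C\<^sup>2 = 2 * (2 * (\<alpha>\<^sup>2 - 2 * \<beta>\<^sup>2))\<^sup>2" .
    then have "C = 0" using rational_square_sqrt2(1)[of C "2 * (\<alpha>\<^sup>2 - 2 * \<beta>\<^sup>2)"] r by (simp add: C_def)
    then show ?thesis using fin by (simp add: C_def)
  qed
qed

section \<open>Side lengths and area of the big triangle\<close>

context dissection
begin

text \<open>One common piece makes the tile edge lie on the line of the side. The edge stays in the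
  big triangle, and midpoints of pieces are no corners, so all its pieces are on the open
  side.\<close>

lemma edge_in_side:
  assumes T: "T \<in> I" and e: "(p, q) \<in> pieces S (vt T k) (vt T (k + 1))" "(p, q) \<in> pieces S (\<Delta> i) (\<Delta> (i + 1))"
  shows "pieces S (vt T k) (vt T (k + 1)) \<subseteq> pieces S (\<Delta> i) (\<Delta> (i + 1))"
proof
  let ?P = "vt T k" and ?Q = "vt T (k + 1)"
  fix f assume f: "f \<in> pieces S ?P ?Q"
  obtain p' q' where pq: "f = (p', q')" by (cases f)
  obtain c1 where c1: "c1 > 0" "q - p = of_real c1 * (?Q - ?P)" "mid p q \<in> open_seg ?P ?Q" by (rule piecesD[OF e(1)])
  obtain c2 where c2: "c2 > 0" "q - p = of_real c2 * (\<Delta> (i + 1) - \<Delta> i)" "mid p q \<in> open_seg (\<Delta> i) (\<Delta> (i + 1))" by (rule piecesD[OF e(2)])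
  obtain c3 where c3: "piece S p' q'" "c3 > 0" "q' - p' = of_real c3 * (?Q - ?P)" "mid p' q' \<in> open_seg ?P ?Q"
    using f unfolding pq by (rule piecesD)
  have m0: "side \<Delta> i (mid p q) = 0" using c2(3) open_seg_oedge[OF ccw_big, of i] by (auto simp: oedge_def)
  have d: "?Q - ?P = of_real (c2 / c1) * (\<Delta> (i + 1) - \<Delta> i)" using c1 c2 by (simp add: field_simps)
  obtain t where t: "mid p q = ?P + of_real t * (?Q - ?P)" using c1(3) by (auto simp: open_seg_def)
  obtain s where s: "mid p' q' = ?P + of_real s * (?Q - ?P)" using c3(4) by (auto simp: open_seg_def)
  have z: "crs (\<Delta> (i + 1) - \<Delta> i) (?Q - ?P) = 0" unfolding d crs_scale by simp
  have m1: "side \<Delta> i (mid p' q') = 0" using m0 unfolding s t side_shift z by simp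
  have "mid p' q' \<in> oedge (vt T) k" using c3(4) open_seg_oedge[OF ccw_tile[OF T]] by blast
  then have "mid p' q' \<in> tri \<Delta>" using oedge_subset tile_subset[OF T] by blast
  then have "mid p' q' \<in> oedge \<Delta> i"
  proof (rule tri_cases[OF ccw_big])
    assume "mid p' q' \<in> otri \<Delta>"
    then show ?thesis using m1 by (auto simp: otri_def less_le)
  next
    fix l assume "mid p' q' = \<Delta> l"
    then show ?thesis using corner_S[of l] piece_mid[OF c3(1)] by simp
  next
    fix l assume l: "mid p' q' \<in> oedge \<Delta> l"
    then have "l = i" using m1 three_cases[of i l] by (auto simp: oedge_def)
    then show ?thesis using l by simp
  qed
  then have mi: "mid p' q' \<in> open_seg (\<Delta> i) (\<Delta> (i + 1))" using open_seg_oedge[OF ccw_big] by blast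
  have "q' - p' = of_real (c3 * (c2 / c1)) * (\<Delta> (i + 1) - \<Delta> i)" unfolding c3(3) d by simp
  then show "f \<in> pieces S (\<Delta> i) (\<Delta> (i + 1))"
    unfolding pq by (rule piecesI[OF c3(1) corner_S corner_S _ _ mi]) (use c1 c2 c3 in simp)
qed

lemma side_is_union_of_edges:
  obtains J where "J \<subseteq> I \<times> UNIV" "dist (\<Delta> i) (\<Delta> (i + 1)) = (\<Sum>(T, k)\<in>J. dist (vt T k) (vt T (k + 1)))"
proof -
  let ?E = "pieces S (\<Delta> i) (\<Delta> (i + 1))" and ?e = "\<lambda>(T, k). pieces S (vt T k) (vt T (k + 1))"
  define J where "J = {x \<in> I \<times> UNIV. ?e x \<subseteq> ?E}"
  have U: "?E = (\<Union>x\<in>J. ?e x)"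
  proof
    show "?E \<subseteq> (\<Union>x\<in>J. ?e x)"
    proof
      fix f assume f: "f \<in> ?E"
      obtain p q where pq: "f = (p, q)" by (cases f)
      have "(p, q) \<in> bd \<Delta>" using f pq by (auto simp: bd_def)
      then obtain T where T: "T \<in> I" "(p, q) \<in> bd (vt T)" using bd_big_owner by blast
      then obtain k where k: "(p, q) \<in> pieces S (vt T k) (vt T (k + 1))" by (auto simp: bd_def)
      then have "(T, k) \<in> J" using edge_in_side[OF T(1) k] f pq T(1) by (auto simp: J_def)
      then show "f \<in> (\<Union>x\<in>J. ?e x)" using k pq by force
    qed
  qed (auto simp: J_def)
  have fJ: "finite J" unfolding J_def by (rule finite_subset[of _ "I \<times> UNIV"]) (auto simp: fin)
  have "dist (\<Delta> i) (\<Delta> (i + 1)) = (\<Sum>(p, q)\<in>?E. dist p q)"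
    using pieces_dist_sum[OF corner_S corner_S ccw_distinct(1)[OF ccw_big]] by simp
  also have "\<dots> = (\<Sum>x\<in>J. \<Sum>(p, q)\<in>?e x. dist p q)"
    unfolding U
  proof (rule sum.UNION_disjoint[OF fJ])
    show "\<forall>x\<in>J. finite (?e x)" by (auto simp: pieces_finite[OF fin_S])
    show "\<forall>x\<in>J. \<forall>y\<in>J. x \<noteq> y \<longrightarrow> ?e x \<inter> ?e y = {}"
    proof (intro ballI impI)
      fix x y assume xy: "x \<in> J" "y \<in> J" "x \<noteq> y"
      obtain T k T' k' where x: "x = (T, k)" and y: "y = (T', k')" by (cases x, cases y)
      have TI: "T \<in> I" "T' \<in> I" using xy x y by (auto simp: J_def)
      have False if "(p, q) \<in> ?e x" "(p, q) \<in> ?e y" for p q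
      proof -
        have "(p, q) \<in> bd (vt T)" "(p, q) \<in> bd (vt T')" using that x y by (auto simp: bd_def)
        then have TT: "T = T'" using bd_unique[OF TI] by blast
        have "(p, q) \<in> pieces S (vt T k) (vt T (k + 1))" "(p, q) \<in> pieces S (vt T k') (vt T (k' + 1))"
          using that x y TT by simp_all
        then have "mid p q \<in> open_seg (vt T k) (vt T (k + 1))" "mid p q \<in> open_seg (vt T k') (vt T (k' + 1))"
          by (auto elim: piecesD)
        then have "mid p q \<in> oedge (vt T) k" "mid p q \<in> oedge (vt T) k'"
          by (simp_all only: open_seg_oedge[OF ccw_tile[OF TI(1)]])
        then have "k = k'" using three_cases[of k' k] by (auto simp: oedge_def)
        then show False using xy(3) x y TT by simp
      qed
      then show "?e x \<inter> ?e y = {}" by auto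
    qed
  qed
  also have "\<dots> = (\<Sum>(T, k)\<in>J. dist (vt T k) (vt T (k + 1)))"
  proof (rule sum.cong[OF refl])
    fix x assume "x \<in> J"
    moreover obtain T k where x: "x = (T, k)" by (cases x)
    ultimately have T: "T \<in> I" by (auto simp: J_def)
    show "(\<Sum>(p, q)\<in>?e x. dist p q) = (case x of (T, k) \<Rightarrow> dist (vt T k) (vt T (k + 1)))"
      using pieces_dist_sum[OF vt_S[OF T] vt_S[OF T] ccw_distinct(1)[OF ccw_tile[OF T]]] by (simp add: x)
  qed
  finally show thesis using that[of J] by (auto simp: J_def)
qed

lemma area_total: "(\<Sum>T\<in>I. side (vt T) 1 (vt T 3)) = side \<Delta> 1 (\<Delta> 3)"
proof -
  have "(\<Sum>i\<in>UNIV. crs (v i) (v (i + 1))) = side v 1 (v 3)" for v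
    by (simp add: sum_3 side_def crs_def algebra_simps)
  then show ?thesis using crs_total by simp
qed

end

context congruent_dissection
begin

lemma side_combination: "\<exists>m :: 3 \<Rightarrow> nat. dist (\<Delta> i) (\<Delta> (i + 1)) = (\<Sum>x\<in>UNIV. m x * sd x)"
proof -
  obtain J where J: "J \<subseteq> I \<times> UNIV" "dist (\<Delta> i) (\<Delta> (i + 1)) = (\<Sum>(T, k)\<in>J. dist (vt T k) (vt T (k + 1)))"
    by (rule side_is_union_of_edges)
  have fJ: "finite J" using J(1) fin by (meson finite_SigmaI finite_code finite_subset)
  let ?l = "\<lambda>(T, k). lb T (k + 2)"
  have "dist (\<Delta> i) (\<Delta> (i + 1)) = (\<Sum>y\<in>J. sd (?l y))"
    unfolding J(2) using J(1) tile_side'(1) by (intro sum.cong) auto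
  also have "\<dots> = (\<Sum>x\<in>UNIV. \<Sum>y\<in>{y \<in> J. ?l y = x}. sd (?l y))"
    by (rule sum.group[symmetric]) (use fJ in auto)
  also have "\<dots> = (\<Sum>x\<in>UNIV. card {y \<in> J. ?l y = x} * sd x)"
  proof (rule sum.cong[OF refl])
    fix x
    have "(\<Sum>y\<in>{y \<in> J. ?l y = x}. sd (?l y)) = (\<Sum>y\<in>{y \<in> J. ?l y = x}. sd x)" by (rule sum.cong) auto
    then show "(\<Sum>y\<in>{y \<in> J. ?l y = x}. sd (?l y)) = card {y \<in> J. ?l y = x} * sd x" by simp
  qed
  finally show ?thesis by (rule exI[of _ "\<lambda>x. card {y \<in> J. ?l y = x}"])
qed

lemma tile_area:
  assumes "R > 0" "\<And>x. sd x = R * sin (\<theta> x)" "T \<in> I"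
  shows "side (vt T) 1 (vt T 3) = R\<^sup>2 * (\<Prod>x\<in>UNIV. sin (\<theta> x))"
proof -
  obtain i where i: "lb T i = 1" using lb_surj[OF assms(3)] by blast
  have ne: "lb T (i + 1) \<noteq> lb T i" "lb T (i + 2) \<noteq> lb T i" "lb T (i + 1) \<noteq> lb T (i + 2)"
    using lb_bij[OF assms(3)] by (auto simp: bij_def inj_eq)
  then have c: "lb T (i + 1) = 2 \<and> lb T (i + 2) = 3 \<or> lb T (i + 1) = 3 \<and> lb T (i + 2) = 2"
    using i exhaust_3[of "lb T (i + 1)"] exhaust_3[of "lb T (i + 2)"] by auto
  have "side (vt T) 1 (vt T 3) = sd (lb T (i + 2)) * sd (lb T (i + 1)) * sin (\<theta> (lb T i))"
    using area_sine[OF ccw_tile[OF assms(3)], of i] tile_side'[OF assms(3)] tile_ang[OF assms(3)] by simp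
  moreover have "(\<Prod>x\<in>UNIV. sin (\<theta> x)) = sin (\<theta> 1) * sin (\<theta> 2) * sin (\<theta> 3)"
    unfolding UNIV_3 by simp
  ultimately show ?thesis using c by (elim disjE conjE) (simp_all add: i assms(2) power2_eq_square)
qed

end

context special_dissection
begin

text \<open>A global count. The conjugate with residues \<open>2\<close>, \<open>n - 3\<close>,
  \<open>1\<close> has \<beta> close to \<pi>, so a vertex with conjugated sum \<open>n\<close> or
  \<open>2 * n\<close> has at most one or two \<beta>; thus \<open>n * cnt V 2 \<le> F V\<close> off
  the corners, and the corners together obey the same bound. Summed over all vertices both sides are
  \<open>n * card I\<close>, but at \<open>V\<close> the inequality is strict. That three \<beta>
  exceed \<open>2 * n\<close> holds for \<open>n > 9\<close>; for \<alpha> = \<pi> / 4 one would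
  have \<open>n = 8\<close>.\<close>

lemma no_even_alpha_side:
  fixes P :: nat
  assumes V: "V \<in> S" "V \<in> oedge \<Delta> i" and P: "even P" "P \<ge> 6" "cnt V 2 = 0" "P * \<theta> 1 = pi"
  shows False
proof -
  obtain b where b: "P = 2 * b + 6"
  proof -
    obtain m where "P = 2 * m" using P(1) by (rule evenE)
    then have "P = 2 * (m - 3) + 6" using P(2) by simp
    then show thesis by (rule that)
  qed
  define n where "n = 4 * b + 12"
  have n: "n > 0" "n = 2 + (2 * b + 3) + (2 * b + 7)" by (auto simp: n_def)
  have nP: "real n = 2 * real P" by (simp add: n_def b)
  have q1: "n * \<theta> 1 = (2::nat) * pi" using P(4) by (simp add: nP)
  have q2: "n * \<theta> 2 = (2 * b + 3) * pi"
  proof -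
    have "2 * (n * \<theta> 2) = n * pi - 3 * (n * \<theta> 1)"
      using arg_cong[OF rel, of "\<lambda>x. n * x"] by (simp add: algebra_simps)
    then show ?thesis unfolding q1 by (simp add: n_def algebra_simps)
  qed
  note j = triple_angles[OF n(1) q1 q2 n(2)]
  let ?k = "2 * b + 7" and ?j = "triple 2 (2 * b + 3) (2 * b + 7)"
  have m: "?k * ?j 1 mod n = 2" "?k * ?j 2 mod n = 4 * b + 9" "?k * ?j 3 mod n = 1"
    by (rule mod_eqI[of _ _ 1] mod_eqI[of _ _ "b + 1"] mod_eqI[of _ _ "b + 4"]; simp add: n_def algebra_simps)+
  have k: "coprime ?k (2 * n)"
  proof -
    have "coprime ?k (2 * b + 6)" using coprime_add_one_right[of "2 * b + 6"] by (simp add: coprime_commute add.commute)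
    moreover have "coprime ?k (2 ^ 2)" using coprime_power_right_iff[of ?k 2 2] by simp
    ultimately have "coprime ?k ((2 * b + 6) * 2 ^ 2)" by (simp only: coprime_mult_right_iff simp_thms)
    then show ?thesis by (simp add: n_def algebra_simps)
  qed
  define F where "F V = (\<Sum>x\<in>UNIV. cnt V x * (?k * ?j x mod n))" for V
  have sm: "(\<Sum>x\<in>UNIV. ?k * ?j x mod n) = n" unfolding sum_3 m by (simp add: n_def)
  have le: "cnt V 2 * (4 * b + 9) \<le> F V" for V
    using cnt_term_le[of V 2 "\<lambda>x. ?k * ?j x mod n"] unfolding m F_def .
  note cf = conjugate_counts[of n ?j, OF n(1) j k sm, folded F_def]
  let ?D = "\<Delta> ` UNIV"
  have DS: "?D \<subseteq> S" using corner_S by auto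
  have inj: "inj \<Delta>" using ccw_inj[OF ccw_big] by (auto simp: inj_def)
  have c1: "n * cnt V 2 \<le> F V" if "V \<in> S - ?D" for V
  proof -
    have "F V = n \<or> F V = 2 * n"
      using that S_cases[of V] cf(1)[of V] cf(4)[of V] by (metis Diff_iff rangeI)
    then show ?thesis
    proof
      assume e: "F V = n"
      have "cnt V 2 \<le> 1"
      proof (rule ccontr)
        assume "\<not> cnt V 2 \<le> 1"
        then have "2 * (4 * b + 9) \<le> cnt V 2 * (4 * b + 9)" by (intro mult_le_mono1) simp
        then show False using le[of V] e by (simp add: n_def)
      qed
      then show ?thesis using e by simp
    next
      assume e: "F V = 2 * n"
      have "cnt V 2 \<le> 2"
      proof (rule ccontr)
        assume "\<not> cnt V 2 \<le> 2"
        then have "3 * (4 * b + 9) \<le> cnt V 2 * (4 * b + 9)" by (intro mult_le_mono1) simp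
        then show False using le[of V] e by (simp add: n_def)
      qed
      then show ?thesis using e by simp
    qed
  qed
  have c2: "(\<Sum>V\<in>?D. n * cnt V 2) \<le> (\<Sum>V\<in>?D. F V)"
  proof -
    have t: "(\<Sum>V\<in>?D. F V) = n" using cf(3) by (simp add: sum.reindex[OF inj] o_def)
    have "(\<Sum>V\<in>?D. cnt V 2) * (4 * b + 9) \<le> (\<Sum>V\<in>?D. F V)"
      unfolding sum_distrib_right by (intro sum_mono le)
    then have u: "(\<Sum>V\<in>?D. cnt V 2) * (4 * b + 9) \<le> 4 * b + 12" unfolding t n_def .
    have "(\<Sum>V\<in>?D. cnt V 2) \<le> 1"
    proof (rule ccontr)
      assume "\<not> (\<Sum>V\<in>?D. cnt V 2) \<le> 1"
      then have "2 * (4 * b + 9) \<le> (\<Sum>V\<in>?D. cnt V 2) * (4 * b + 9)" by (intro mult_le_mono1) linarith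
      then show False using u by simp
    qed
    then show ?thesis unfolding t sum_distrib_left[symmetric] by simp
  qed
  have VD: "V \<in> S - ?D"
  proof -
    have "V \<noteq> \<Delta> l" for l
      using V(2) three_cases[of l i] side_vertex[of \<Delta> i] side_vertex[of \<Delta> "i + 1"] side_vertex[of \<Delta> "i + 2"] by (auto simp: oedge_def)
    then show ?thesis using V(1) by auto
  qed
  have "(\<Sum>V\<in>S - ?D. n * cnt V 2) < (\<Sum>V\<in>S - ?D. F V)"
  proof (rule sum_strict_mono_ex1)
    show "\<exists>V\<in>S - ?D. n * cnt V 2 < F V" using VD P(3) cf(1)[OF V] n(1) by (intro bexI[of _ V]) auto
  qed (use fin_S c1 in auto)
  then have "(\<Sum>V\<in>S. n * cnt V 2) < (\<Sum>V\<in>S. F V)"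
    using c2 sum.subset_diff[OF DS fin_S, of "\<lambda>V. n * cnt V 2"] sum.subset_diff[OF DS fin_S, of F] by linarith
  moreover have "(\<Sum>V\<in>S. n * cnt V 2) = n * card I" by (simp add: sum_distrib_left[symmetric] cnt_total)
  moreover have "(\<Sum>V\<in>S. F V) = n * card I"
  proof -
    have "(\<Sum>V\<in>S. F V) = (\<Sum>x\<in>UNIV. \<Sum>V\<in>S. cnt V x * (?k * ?j x mod n))" unfolding F_def by (rule sum.swap)
    also have "\<dots> = (\<Sum>x\<in>UNIV. card I * (?k * ?j x mod n))" by (simp only: sum_distrib_right[symmetric] cnt_total)
    also have "\<dots> = card I * n" by (simp only: sum_distrib_left[symmetric] sm)
    finally show ?thesis by (simp add: mult.commute)
  qed
  ultimately show False by simp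
qed

text \<open>The conjugations with \<open>k\<close> equal to 1 and 5 modulo 8 leave two possibilities
  at the corners: every tile angle once, against \<open>nsim\<close>, or four \<alpha>, which is a
  right isosceles triangle. Its area is a multiple of the tile area, so leg and hypotenuse over the
  circumdiameter of the tile have rational squares. Hence both are integer multiples of the side
  opposite \<alpha>, although their quotient is \<open>sqrt 2\<close>.\<close>

lemma alpha_not_pi4: "4 * \<theta> 1 \<noteq> pi"
proof
  assume a: "4 * \<theta> 1 = pi"
  have n: "(8::nat) > 0" "(8::nat) = 2 + 1 + 5" by simp_all
  have q1: "(8::nat) * \<theta> 1 = (2::nat) * pi" and q2: "(8::nat) * \<theta> 2 = (1::nat) * pi" using rel a by simp_all
  note j = triple_angles[OF n(1) q1 q2 n(2)]
  let ?j = "triple 2 1 5"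
  have k: "coprime 17 (2 * (8::nat))" "coprime 5 (2 * (8::nat))" by (simp_all add: coprime_iff_gcd_eq_1 gcd_nat.simps)
  have s: "(\<Sum>x\<in>UNIV. 17 * ?j x mod 8) = 8" "(\<Sum>x\<in>UNIV. 5 * ?j x mod 8) = 8" by (simp_all add: sum_3)
  define t where "t x = (\<Sum>i\<in>UNIV. cnt (\<Delta> i) x)" for x
  note f = conjugate_counts(3)[of 8 ?j, OF n(1) j]
  have "2 * t 1 + t 2 + 5 * t 3 = 8" "2 * t 1 + 5 * t 2 + t 3 = 8"
    using f[OF k(1) s(1)] f[OF k(2) s(2)] by (simp_all add: t_def sum_3)
  then have tt: "t 2 = t 3" "t 1 + 3 * t 2 = 4" by linarith+
  then have "t 2 = 0 \<or> t 2 = 1" by linarith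
  then consider "t 1 = 4" "t 2 = 0" "t 3 = 0" | "t 1 = 1" "t 2 = 1" "t 3 = 1" using tt by fastforce
  then show False
  proof cases
    case 2
    then have "\<forall>x. t x = 1" by (simp add: forall_3)
    then show False using nsim by (simp add: t_def)
  next
    case 1
    define c where "c i = cnt (\<Delta> i) 1" for i
    have z: "cnt (\<Delta> i) 2 = 0" "cnt (\<Delta> i) 3 = 0" for i using 1 by (auto simp: t_def)
    have cp: "c i > 0" for i
    proof -
      have "card (corners (\<Delta> i)) > 0" using corners_nonempty[OF corner_S] fin_corners by (simp add: card_gt_0_iff)
      then show ?thesis using z[of i] by (simp add: card_corners sum_3 c_def)
    qed
    have ca: "ang \<Delta> i = c i * pi / 4" for i
    proof -
      have "\<theta> 1 = pi / 4" using a by simp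
      then show ?thesis using angle_sum_corner[of i, symmetric] by (simp add: angle_sum_cnt sum_3 z c_def)
    qed
    have cs: "c 1 + c 2 + c 3 = 4" using 1(1) by (simp add: t_def sum_3 c_def)
    obtain i where i: "c i = 2" "c (i + 1) = 1" "c (i + 2) = 1"
    proof -
      have "c 1 = 2 \<and> c 2 = 1 \<and> c 3 = 1 \<or> c 2 = 2 \<and> c 3 = 1 \<and> c 1 = 1 \<or> c 3 = 2 \<and> c 1 = 1 \<and> c 2 = 1"
        using cs cp[of 1] cp[of 2] cp[of 3] by linarith
      then show thesis using that[of 1] that[of 2] that[of 3] by auto
    qed
    define L where "L = dist (\<Delta> i) (\<Delta> (i + 1))"
    define H where "H = dist (\<Delta> (i + 1)) (\<Delta> (i + 2))"
    define D where "D = side \<Delta> 1 (\<Delta> 3)"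
    have D: "D > 0" using ccw_big by (simp add: ccw_def D_def)
    have LH: "L > 0" "H > 0" using ccw_distinct(1)[OF ccw_big] ccw_distinct(1)[OF ccw_big, of "i + 1"] by (simp_all add: L_def H_def)
    have e1: "D = L * dist (\<Delta> i) (\<Delta> (i + 2))"
      using area_sine[OF ccw_big, of i] ca[of i] i by (simp add: D_def L_def)
    have e2: "D = H * L * (sqrt 2 / 2)"
      using area_sine[OF ccw_big, of "i + 1"] ca[of "i + 1"] i by (simp add: D_def L_def H_def dist_commute sin_45)
    have e3: "D = dist (\<Delta> i) (\<Delta> (i + 2)) * H * (sqrt 2 / 2)"
      using area_sine[OF ccw_big, of "i + 2"] ca[of "i + 2"] i by (simp add: D_def L_def H_def dist_commute sin_45)
    have "dist (\<Delta> i) (\<Delta> (i + 2)) = L" using e2 e3 LH by simp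
    then have DL: "D = L\<^sup>2" using e1 by (simp add: power2_eq_square)
    then have HL: "H * sqrt 2 = 2 * L" using e2 LH by (simp add: power2_eq_square field_simps)
    then have HL2: "H = sqrt 2 * L"
    proof -
      have "H * (sqrt 2 * sqrt 2) = 2 * L * sqrt 2" using HL by (simp only: mult.assoc[symmetric])
      then have "H * 2 = 2 * L * sqrt 2" by (simp only: real_sqrt_mult_self abs_numeral)
      then show ?thesis by simp
    qed
    obtain R where R: "R > 0" "\<And>x. sd x = R * sin (\<theta> x)" using sine_rule by blast
    have th: "\<theta> 1 = pi / 4" "\<theta> 2 = pi / 8" "\<theta> 3 = pi / 2 + pi / 8" using a rel theta_3 by simp_all
    have sn: "sin (\<theta> 1) = sqrt 2 / 2" "sin (\<theta> 2) = sin (pi / 8)" "sin (\<theta> 3) = cos (pi / 8)"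
      unfolding th sin_add by (simp_all add: sin_45)
    have "(\<Prod>x\<in>UNIV. sin (\<theta> x)) = sqrt 2 / 2 * (sin (pi / 8) * cos (pi / 8))"
      unfolding UNIV_3 by (simp add: sn)
    also have "\<dots> = 1 / 4" unfolding sin_cos_pi8(3) by simp
    finally have pr: "(\<Prod>x\<in>UNIV. sin (\<theta> x)) = 1 / 4" .
    have "D = (\<Sum>T\<in>I. R\<^sup>2 * (1 / 4))"
      unfolding D_def area_total[symmetric] by (rule sum.cong[OF refl]) (simp only: tile_area[OF R] pr)
    then have "D = card I * (R\<^sup>2 * (1 / 4))" by simp
    then have L2: "(L / R)\<^sup>2 = card I / 4" using DL R(1) by (simp add: power_divide)
    \<comment> \<open>A side of the big triangle is composed of whole tile edges, and a rational
      square leaves only edges opposite \<alpha>.\<close>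
    have comb: "\<exists>x. d / R = real x * (sqrt 2 / 2)" if d: "d = dist (\<Delta> l) (\<Delta> (l + 1))" "(d / R)\<^sup>2 \<in> \<rat>" for l d
    proof -
      obtain m :: "3 \<Rightarrow> nat" where m: "d = (\<Sum>x\<in>UNIV. m x * sd x)" using side_combination[of l] d(1) by auto
      have e: "d / R = m 1 * (sqrt 2 / 2) + m 2 * sin (pi / 8) + m 3 * cos (pi / 8)"
        unfolding m R(2) using R(1) by (simp add: sum_3 sn field_simps)
      then have "m 2 = 0 \<and> m 3 = 0" using d(2) pi8_length_square_rational by simp
      then show ?thesis using e by auto
    qed
    have "(L / R)\<^sup>2 \<in> \<rat>" unfolding L2 by simp
    then obtain x where x: "L / R = real x * (sqrt 2 / 2)" using comb[OF L_def] by blast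
    have HR: "(H / R)\<^sup>2 = 2 * (card I / 4)" unfolding HL2 by (simp add: power_divide power_mult_distrib L2[symmetric])
    have "(H / R)\<^sup>2 \<in> \<rat>" unfolding HR by simp
    moreover have "H = dist (\<Delta> (i + 1)) (\<Delta> (i + 1 + 1))" by (simp add: H_def)
    ultimately obtain y where y: "H / R = real y * (sqrt 2 / 2)" using comb by blast
    have "real y = sqrt 2 * real x" using x y HL2 R(1) by (simp add: field_simps)
    then have yx: "real y + (- real x) * sqrt 2 = 0" by simp
    have "- real x = 0" by (rule rational_sqrt2(2)[OF _ _ yx]) simp_all
    then have "real x = 0" by simp
    then show False using x LH R(1) by simp
  qed
qed

text \<open>For an even number of tiles, \<open>(P, Q)\<close> is not \<open>(3, 2)\<close>, so
  there is a second relation. Subtracting \<open>rel\<close> shows that \<open>P - 3\<close> and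
  \<open>Q - 2\<close> have opposite signs, which leaves only the families already excluded.\<close>

theorem odd_side:
  assumes V: "V \<in> S" "V \<in> oedge \<Delta> i"
  shows "odd (card (corners V))"
proof (rule ccontr)
  assume "\<not> odd (card (corners V))"
  then have ev: "even (cnt V 1 + cnt V 2 + cnt V 3)" by (simp add: card_corners sum_3)
  define P Q where "P = cnt V 1 + 2 * cnt V 3" and "Q = cnt V 2 + cnt V 3"
  have e: "P * \<theta> 1 + Q * \<theta> 2 = pi" using side_relation[OF V] by (simp add: P_def Q_def)
  then have d: "(real P - 3) * \<theta> 1 + (real Q - 2) * \<theta> 2 = 0" using rel by (simp add: algebra_simps)
  have pq: "even (P + Q)" using ev by (simp add: P_def Q_def)
  consider "Q = 0" | "Q = 1" | "Q = 2" | "Q \<ge> 3" by linarith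
  then show False
  proof cases
    case 1
    then have Pp: "P * \<theta> 1 = pi" "even P" using e pq by simp_all
    have "(real P - 3) * \<theta> 1 > 0" using d 1 theta_pos by simp
    then have "P > 3" using theta_pos by (simp add: zero_less_mult_iff)
    then have "P = 4 \<or> P \<ge> 6" using Pp(2) by (cases "P = 5") auto
    then show False
    proof
      assume "P = 4"
      then show False using Pp(1) alpha_not_pi4 by simp
    next
      assume "P \<ge> 6"
      then show False using no_even_alpha_side[OF V Pp(2) _ _ Pp(1)] 1 by (simp add: Q_def)
    qed
  next
    case 2
    then have "(real P - 3) * \<theta> 1 > 0" using d theta_pos by simp
    then have "P > 3" using theta_pos by (simp add: zero_less_mult_iff)
    moreover have "odd P" using pq 2 by simp
    ultimately have "P \<ge> 5" by (cases "P = 4") auto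
    moreover have "cnt V 1 + 2 \<ge> P" using 2 by (simp add: P_def Q_def)
    ultimately show False using no_alpha_one_beta_side[OF V, of P] e 2 by simp
  next
    case 3
    then have "P = 3" using d theta_pos by simp
    then show False using pq 3 by simp
  next
    case 4
    have "(real Q - 2) * \<theta> 2 > 0" using 4 theta_pos by simp
    then have "(real P - 3) * \<theta> 1 < 0" using d by linarith
    then have "P < 3" using theta_pos by (simp add: mult_less_0_iff)
    then consider "P = 0" | "P = 1" | "P = 2" by linarith
    then show False
    proof cases
      case 1
      then have "even Q" "cnt V 2 = Q" "Q * \<theta> 2 = pi" using pq e by (simp_all add: P_def Q_def)
      moreover from this have "Q \<ge> 4" using 4 by (cases "Q = 3") auto
      ultimately show False using no_even_beta_side[OF V] by blast
    next
      case 2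
      then have "odd Q" "cnt V 2 = Q" "\<theta> 1 + Q * \<theta> 2 = pi" using pq e by (simp_all add: P_def Q_def)
      then show False using no_one_alpha_odd_beta_side[OF V] 4 by blast
    next
      case 3
      then have "even Q" "cnt V 2 + 1 \<ge> Q" "2 * \<theta> 1 + Q * \<theta> 2 = pi" using pq e by (simp_all add: P_def Q_def)
      moreover from this have "Q \<ge> 4" using 4 by (cases "Q = 3") auto
      ultimately show False using no_two_alpha_even_beta_side[OF V] by blast
    qed
  qed
qed

section \<open>Parities at the corners\<close>

lemma corner_relation:
  "(cnt (\<Delta> i) 1 + 2 * cnt (\<Delta> i) 3) * \<theta> 1 + (cnt (\<Delta> i) 2 + cnt (\<Delta> i) 3) * \<theta> 2 = ang \<Delta> i"
  using angle_sum_corner[of i] by (simp add: angle_sum_cnt sum_3 theta_3 algebra_simps)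

lemma no_gamma:
  assumes "ang \<Delta> i < 2 * \<theta> 1 + \<theta> 2"
  shows "cnt (\<Delta> i) 3 = 0"
proof (rule ccontr)
  assume n: "cnt (\<Delta> i) 3 \<noteq> 0"
  let ?p = "cnt (\<Delta> i) 1" and ?q = "cnt (\<Delta> i) 2" and ?r = "cnt (\<Delta> i) 3"
  have "2 * \<theta> 1 \<le> (real ?p + 2 * real ?r) * \<theta> 1" using n theta_pos by (intro mult_right_mono) auto
  moreover have "1 * \<theta> 2 \<le> (real ?q + real ?r) * \<theta> 2" using n theta_pos by (intro mult_right_mono) auto
  ultimately show False using corner_relation[of i] assms by simp
qed

lemma corner_relation':
  assumes "ang \<Delta> i < 2 * \<theta> 1 + \<theta> 2"
  shows "cnt (\<Delta> i) 1 * \<theta> 1 + cnt (\<Delta> i) 2 * \<theta> 2 = ang \<Delta> i"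
    "card (corners (\<Delta> i)) = cnt (\<Delta> i) 1 + cnt (\<Delta> i) 2"
  using corner_relation[of i] no_gamma[OF assms] by (simp_all add: card_corners sum_3)

lemma nat_mult_cases:
  fixes p :: nat and x :: real
  assumes "x > 0"
  obtains "p = 0" | "p = 1" "p * x = x" | "p \<ge> 2" "p * x \<ge> 2 * x"
proof -
  consider "p = 0" | "p = 1" | "p \<ge> 2" by linarith
  then show thesis
  proof cases
    case 3
    then have "2 * x \<le> real p * x" using assms by (intro mult_right_mono) auto
    then show thesis using that(3) 3 by blast
  qed (use that in auto)
qed

text \<open>If an \<alpha> occurs it fills the corner; otherwise there are only \<beta>, and an even
  number of them is excluded.\<close>

lemma corner_alpha_odd:
  assumes "ang \<Delta> i = \<theta> 1" shows "odd (card (corners (\<Delta> i)))"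
proof -
  let ?p = "cnt (\<Delta> i) 1" and ?q = "cnt (\<Delta> i) 2"
  have lt: "ang \<Delta> i < 2 * \<theta> 1 + \<theta> 2" using assms theta_pos by simp
  note e = corner_relation'[OF lt, unfolded assms]
  have q0: "real ?q * \<theta> 2 \<ge> 0" using theta_pos by simp
  show ?thesis
  proof (cases "?p = 0")
    case True
    then have e': "\<theta> 1 = ?q * \<theta> 2" using e by simp
    have "odd ?q"
    proof
      assume "even ?q"
      moreover have "?q \<noteq> 0" using e' theta_pos by (metis mult_zero_left of_nat_0 less_irrefl)
      ultimately have "?q \<ge> 2" by (cases "?q = 1") auto
      then show False using no_alpha_even_beta_corner[OF \<open>even ?q\<close> _ e', of i] by simp
    qed
    then show ?thesis using e(2) True by simp
  next
    case False
    then have "1 * \<theta> 1 \<le> real ?p * \<theta> 1" using theta_pos by (intro mult_right_mono) auto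
    then have "real ?q * \<theta> 2 = 0" "real ?p * \<theta> 1 = \<theta> 1" using e(1) q0 by linarith+
    then have "?q = 0" "?p = 1" using theta_pos by simp_all
    then show ?thesis using e(2) by simp
  qed
qed

lemma corner_beta_odd:
  assumes "ang \<Delta> i = \<theta> 2" shows "odd (card (corners (\<Delta> i)))"
proof -
  let ?p = "cnt (\<Delta> i) 1" and ?q = "cnt (\<Delta> i) 2"
  have lt: "ang \<Delta> i < 2 * \<theta> 1 + \<theta> 2" using assms theta_pos by simp
  note e = corner_relation'[OF lt, unfolded assms]
  have p0: "real ?p * \<theta> 1 \<ge> 0" using theta_pos by simp
  show ?thesis
  proof (cases "?q = 0")
    case True
    then have e': "\<theta> 2 = ?p * \<theta> 1" using e by simp
    have "odd ?p"
    proof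
      assume "even ?p"
      moreover have "?p \<noteq> 0" using e' theta_pos by (metis mult_zero_left of_nat_0 less_irrefl)
      ultimately have "?p \<ge> 2" by (cases "?p = 1") auto
      then show False using no_beta_even_alpha_corner[OF \<open>even ?p\<close> _ e', of i] by simp
    qed
    then show ?thesis using e(2) True by simp
  next
    case False
    then have "1 * \<theta> 2 \<le> real ?q * \<theta> 2" using theta_pos by (intro mult_right_mono) auto
    then have "real ?p * \<theta> 1 = 0" "real ?q * \<theta> 2 = \<theta> 2" using e(1) p0 by linarith+
    then have "?p = 0" "?q = 1" using theta_pos by simp_all
    then show ?thesis using e(2) by simp
  qed
qed

text \<open>By the number of \<alpha>: two fill the corner, one leaves an odd number of \<beta>, and
  none leaves an even number of \<beta>, where a single \<beta> is excluded by
  \<open>beta_not_double\<close>.\<close>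

lemma corner_two_alpha_even:
  assumes "ang \<Delta> i = 2 * \<theta> 1" shows "even (card (corners (\<Delta> i)))"
proof -
  let ?p = "cnt (\<Delta> i) 1" and ?q = "cnt (\<Delta> i) 2"
  have lt: "ang \<Delta> i < 2 * \<theta> 1 + \<theta> 2" using assms theta_pos by simp
  note e = corner_relation'[OF lt, unfolded assms]
  have q0: "real ?q * \<theta> 2 \<ge> 0" using theta_pos by simp
  from theta_pos(1) show ?thesis
  proof (rule nat_mult_cases[of _ ?p])
    assume p: "?p = 0"
    then have e': "2 * \<theta> 1 = ?q * \<theta> 2" using e by simp
    have "even ?q"
    proof (rule ccontr)
      assume o: "odd ?q"
      moreover have "?q \<noteq> 1" using e' beta_not_double by auto
      ultimately have "?q \<ge> 3" by (cases "?q = 2"; cases "?q = 0") auto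
      then show False using no_two_alpha_odd_beta_corner[OF o _ e', of i] by simp
    qed
    then show ?thesis using e(2) p by simp
  next
    assume p: "?p = 1" "?p * \<theta> 1 = \<theta> 1"
    then have e': "\<theta> 1 = ?q * \<theta> 2" using e by simp
    have "odd ?q"
    proof
      assume "even ?q"
      moreover have "?q \<noteq> 0" using e' theta_pos by (metis mult_zero_left of_nat_0 less_irrefl)
      ultimately have "?q \<ge> 2" by (cases "?q = 1") auto
      then show False using no_alpha_even_beta_corner[OF \<open>even ?q\<close> _ e', of i] by simp
    qed
    then show ?thesis using e(2) p by simp
  next
    assume p: "?p \<ge> 2" "?p * \<theta> 1 \<ge> 2 * \<theta> 1"
    then have "real ?q * \<theta> 2 = 0" "real ?p * \<theta> 1 = 2 * \<theta> 1" using e(1) q0 by linarith+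
    then have "?q = 0" "?p = 2" using theta_pos by simp_all
    then show ?thesis using e(2) by simp
  qed
qed

text \<open>Either one \<alpha> and one \<beta>, or tiles of one kind only. In the latter case one
  of the two angles is a multiple of the other, with a factor one less than the number of tiles, and
  that factor is odd.\<close>

lemma corner_alpha_beta_even:
  assumes "ang \<Delta> i = \<theta> 1 + \<theta> 2" shows "even (card (corners (\<Delta> i)))"
proof -
  let ?p = "cnt (\<Delta> i) 1" and ?q = "cnt (\<Delta> i) 2"
  have lt: "ang \<Delta> i < 2 * \<theta> 1 + \<theta> 2" using assms theta_pos by simp
  note e = corner_relation'[OF lt, unfolded assms]
  have q0: "real ?q * \<theta> 2 \<ge> 0" using theta_pos by simp
  from theta_pos(1) show ?thesis
  proof (rule nat_mult_cases[of _ ?p])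
    assume p: "?p = 0"
    then have q: "?q \<ge> 2"
    proof -
      have "(real ?q - 1) * \<theta> 2 > 0" using e p theta_pos by (simp add: algebra_simps)
      then show ?thesis using theta_pos by (simp add: zero_less_mult_iff)
    qed
    have e': "\<theta> 1 = (?q - 1) * \<theta> 2" using e p q by (simp add: of_nat_diff algebra_simps)
    have "even ?q"
    proof (rule ccontr)
      assume o: "odd ?q"
      then have "even (?q - 1)" "?q - 1 \<ge> 2" using q by (auto elim!: oddE)
      then show False using no_alpha_even_beta_corner[of "?q - 1" i] e' q by simp
    qed
    then show ?thesis using e(2) p by simp
  next
    assume p: "?p = 1" "?p * \<theta> 1 = \<theta> 1"
    then have "?q * \<theta> 2 = \<theta> 2" using e by simp
    then have "?q = 1" using theta_pos by simp
    then show ?thesis using e(2) p by simp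
  next
    assume p: "?p \<ge> 2" "?p * \<theta> 1 \<ge> 2 * \<theta> 1"
    have q: "?q = 0"
    proof (rule ccontr)
      assume "?q \<noteq> 0"
      then have "1 * \<theta> 2 \<le> real ?q * \<theta> 2" using theta_pos by (intro mult_right_mono) auto
      then show False using e(1) p theta_pos by linarith
    qed
    have e': "\<theta> 2 = (?p - 1) * \<theta> 1" using e p q by (simp add: of_nat_diff algebra_simps)
    have "even ?p"
    proof (rule ccontr)
      assume o: "odd ?p"
      then have "even (?p - 1)" "?p - 1 \<ge> 2" using p by (auto elim!: oddE)
      then show False using no_beta_even_alpha_corner[of "?p - 1" i] e' p by simp
    qed
    then show ?thesis using e(2) q by simp
  qed
qed

end

section \<open>Tilings of the Euclidean plane\<close>

text \<open>The plane as the complex numbers, reflected if \<open>b\<close> is false. The reflection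
  makes \<open>A\<close>, \<open>B\<close>, \<open>C\<close> counterclockwise without renaming them;
  the corners of tiles are permuted instead.\<close>

definition emb :: "bool \<Rightarrow> real^2 \<Rightarrow> complex" where
  "emb b x = Complex (x $ 1) (if b then x $ 2 else - (x $ 2))"

lemma emb_diff: "emb b x - emb b y = emb b (x - y)"
  by (simp add: emb_def complex_eq_iff)

lemma emb_linear: "linear (emb b)"
  by (rule linearI) (simp_all add: emb_def complex_eq_iff)

lemma emb_inner: "emb b x \<bullet> emb b y = x \<bullet> y"
  by (simp add: emb_def inner_complex_def inner_vec_def sum_2)

lemma emb_norm: "norm (emb b x) = norm x"
  by (simp add: norm_eq_sqrt_inner emb_inner)

lemma emb_dist: "dist (emb b x) (emb b y) = dist x y"
  by (simp add: dist_norm emb_diff emb_norm)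

lemma emb_inj: "inj (emb b)"
  by (rule injI) (metis emb_dist dist_eq_0_iff)

lemma emb_surj: "surj (emb b)"
proof (rule surjI)
  fix z
  show "emb b (vector [Re z, if b then Im z else - Im z]) = z"
    by (simp add: emb_def complex_eq_iff)
qed

definition vangle :: "(3 \<Rightarrow> real^2) \<Rightarrow> 3 \<Rightarrow> real" where
  "vangle w i = angle (w (i + 1)) (w i) (w (i + 2))"

lemma angle_commute: "angle P Q R = angle R Q P"
  by (simp add: angle_def inner_commute mult.commute)

lemma range_three: "range f = {f i, f (i + 1), f (i + 2)}" for i :: 3
proof -
  have "UNIV = {i, i + 1, i + 2}"
  proof (rule UNIV_eq_I)
    fix j show "j \<in> {i, i + 1, i + 2}" using three_cases[of j i] by simp
  qed
  then show ?thesis by (metis image_insert image_empty)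
qed

lemma bij_three_cases:
  assumes "bij (l :: 3 \<Rightarrow> 3)"
  obtains "l (i + 1) = l i + 1" "l (i + 2) = l i + 2" | "l (i + 1) = l i + 2" "l (i + 2) = l i + 1"
proof -
  have "l (i + 1) \<noteq> l i" "l (i + 2) \<noteq> l i" "l (i + 1) \<noteq> l (i + 2)"
    using assms by (auto simp: bij_def inj_eq)
  then show thesis using that three_cases[of "l (i + 1)" "l i"] three_cases[of "l (i + 2)" "l i"] by metis
qed

lemma vangle_perm: "bij l \<Longrightarrow> vangle (w \<circ> l) i = vangle w (l i)"
  by (erule bij_three_cases[of l i]) (simp_all add: vangle_def angle_commute)

lemma dist_perm: "bij l \<Longrightarrow> dist (w (l (i + 1))) (w (l (i + 2))) = dist (w (l i + 1)) (w (l i + 2))"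
  for l :: "3 \<Rightarrow> 3"
  by (erule bij_three_cases[of l i]) (simp_all add: dist_commute)

lemma Re_sgn_divide:
  assumes "p \<noteq> 0" shows "Re (sgn q / sgn p) = (p \<bullet> q) / (norm p * norm q)"
proof -
  have "sgn q / sgn p = of_real (norm p / norm q) * (q / p)"
    using assms by (simp add: sgn_eq field_simps)
  then have "Re (sgn q / sgn p) = norm p / norm q * Re (q / p)" by (simp only: times_complex.sel Re_complex_of_real Im_complex_of_real mult_zero_left diff_zero)
  also have "Re (q / p) = (p \<bullet> q) / (norm p)\<^sup>2"
    by (simp add: Re_divide inner_complex_def cmod_power2 mult.commute)
  finally show ?thesis using assms by (simp add: power2_eq_square)
qed

lemma ang_kap:
  assumes "ccw (emb b \<circ> w)" shows "ang (emb b \<circ> w) i = vangle w i"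
proof -
  let ?v = "emb b \<circ> w"
  let ?p = "?v (i + 1) - ?v i" and ?q = "?v (i + 2) - ?v i"
  have nz: "?p \<noteq> 0" "?q \<noteq> 0" using ccw_distinct[OF assms, of i] by auto
  have "cos (ang ?v i) = Re (cis (ang ?v i))" by simp
  also have "\<dots> = Re (sgn ?q / sgn ?p)" by (simp only: cis_ang[OF assms])
  also have "\<dots> = (?p \<bullet> ?q) / (norm ?p * norm ?q)" by (rule Re_sgn_divide[OF nz(1)])
  also have "\<dots> = ((w (i + 1) - w i) \<bullet> (w (i + 2) - w i)) / (norm (w (i + 1) - w i) * norm (w (i + 2) - w i))"
    by (simp add: emb_diff emb_inner emb_norm)
  finally have "arccos (cos (ang ?v i)) = vangle w i" by (simp add: vangle_def angle_def)
  then show ?thesis using ang_bounds[OF assms, of i] by (simp add: arccos_cos)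
qed

lemma tri_hull:
  assumes "ccw v" shows "tri v = convex hull (range v)"
proof -
  define D where "D = side v 1 (v 3)"
  have D: "D > 0" using assms by (simp add: ccw_def D_def)
  have c: "D * Re z = side v 2 z * Re (v 1) + side v 3 z * Re (v 2) + side v 1 z * Re (v 3)"
    "D * Im z = side v 2 z * Im (v 1) + side v 3 z * Im (v 2) + side v 1 z * Im (v 3)" for z
    by (simp_all add: D_def side_def crs_def algebra_simps)
  have sum: "side v 1 z + side v 2 z + side v 3 z = D" for z
    using side_sum[of v 1 z] by (simp add: D_def)
  have "z \<in> convex hull (range v)" if "z \<in> tri v" for z
  proof -
    have "z = (side v 2 z / D) *\<^sub>R v 1 + (side v 3 z / D) *\<^sub>R v 2 + (side v 1 z / D) *\<^sub>R v 3"
      using c[of z] D by (simp add: complex_eq_iff field_simps)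
    moreover have "side v i z / D \<ge> 0" for i using that D by (simp add: tri_def)
    moreover have "side v 2 z / D + side v 3 z / D + side v 1 z / D = 1"
      using sum[of z] D by (simp add: field_simps)
    ultimately show ?thesis unfolding range_three[of v 1] one_add_one convex_hull_3 by simp blast
  qed
  moreover have "z \<in> tri v" if "z \<in> convex hull (range v)" for z
  proof -
    have "convex (tri v)"
      unfolding convex_alt tri_def using side_comb[of v] by (auto simp: scaleR_conv_of_real)
    then have "convex hull (range v) \<subseteq> tri v"
      using vertex_in_tri[OF assms] by (intro hull_minimal) auto
    then show ?thesis using that by blast
  qed
  ultimately show ?thesis by blast
qed

lemma crs_squared: "(crs p q)\<^sup>2 = (norm p * norm q)\<^sup>2 - (p \<bullet> q)\<^sup>2"
  by (simp add: crs_def inner_complex_def power_mult_distrib cmod_power2) (simp add: power2_eq_square algebra_simps)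

lemma collinear_inner:
  fixes w :: "3 \<Rightarrow> 'a::euclidean_space"
  shows "collinear (range w) \<longleftrightarrow> \<bar>(w 2 - w 1) \<bullet> (w 3 - w 1)\<bar> = norm (w 2 - w 1) * norm (w 3 - w 1)"
proof -
  have "range w = {w 2, w 1, w 3}" using range_three[of w 1] by (simp add: insert_commute)
  moreover have "collinear {w 2, w 1, w 3} \<longleftrightarrow> collinear {0, w 2 - w 1, w 3 - w 1}"
    by (rule collinear_3) (simp add: NO_MATCH_def)
  ultimately show ?thesis by (simp only: norm_cauchy_schwarz_equal)
qed

lemma collinear_crs:
  "collinear (range w) \<longleftrightarrow> side (emb b \<circ> w) 1 (emb b (w 3)) = 0" for w :: "3 \<Rightarrow> real^2"
proof -
  let ?p = "w 2 - w 1" and ?q = "w 3 - w 1"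
  have "\<bar>?p \<bullet> ?q\<bar> = norm ?p * norm ?q \<longleftrightarrow> (norm ?p * norm ?q)\<^sup>2 - (?p \<bullet> ?q)\<^sup>2 = 0"
  proof
    assume "\<bar>?p \<bullet> ?q\<bar> = norm ?p * norm ?q"
    then show "(norm ?p * norm ?q)\<^sup>2 - (?p \<bullet> ?q)\<^sup>2 = 0" by (simp flip: power2_abs[of "?p \<bullet> ?q"])
  next
    assume "(norm ?p * norm ?q)\<^sup>2 - (?p \<bullet> ?q)\<^sup>2 = 0"
    then have "\<bar>?p \<bullet> ?q\<bar>\<^sup>2 = (norm ?p * norm ?q)\<^sup>2" by simp
    then show "\<bar>?p \<bullet> ?q\<bar> = norm ?p * norm ?q" by (rule power2_eq_imp_eq) simp_all
  qed
  also have "\<dots> \<longleftrightarrow> (crs (emb b ?p) (emb b ?q))\<^sup>2 = 0" by (simp only: crs_squared emb_norm emb_inner)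
  also have "\<dots> \<longleftrightarrow> side (emb b \<circ> w) 1 (emb b (w 3)) = 0" by (simp add: side_def emb_diff)
  finally show ?thesis by (simp only: collinear_inner)
qed

definition swap23 :: "3 \<Rightarrow> 3" where
  "swap23 i = (if i = 2 then 3 else if i = 3 then 2 else 1)"

lemma swap23 [simp]: "swap23 1 = 1" "swap23 2 = 3" "swap23 3 = 2"
  by (simp_all add: swap23_def)

lemma bij_swap23: "bij swap23"
  by (rule involuntory_imp_bij) (use exhaust_3 in \<open>auto simp: swap23_def\<close>)

lemma ex_ccw_perm:
  fixes w :: "3 \<Rightarrow> real^2"
  assumes "\<not> collinear (range w)" obtains l where "bij l" "ccw (emb b \<circ> w \<circ> l)"
proof (cases "ccw (emb b \<circ> w)")
  case True
  then show thesis using that[of id] by simp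
next
  case False
  then have "side (emb b \<circ> w) 1 (emb b (w 3)) < 0" using assms collinear_crs[of w b] by (simp add: ccw_def)
  then have "ccw (emb b \<circ> w \<circ> swap23)"
    by (simp add: ccw_def side_def crs_def algebra_simps)
  then show thesis by (rule that[OF bij_swap23])
qed

lemma ex_ccw_reflection:
  fixes w :: "3 \<Rightarrow> real^2"
  assumes "\<not> collinear (range w)" obtains b where "ccw (emb b \<circ> w)"
proof (cases "ccw (emb True \<circ> w)")
  case False
  then have "side (emb True \<circ> w) 1 (emb True (w 3)) < 0" using assms collinear_crs[of w True] by (simp add: ccw_def)
  then have "ccw (emb False \<circ> w)" by (simp add: ccw_def side_def crs_def emb_def algebra_simps)
  then show thesis by (rule that)
qed (rule that)

section \<open>Congruent and similar triangles\<close>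

lemma convex_hull_affine_image:
  assumes "linear g" shows "(\<lambda>x. a + g x) ` (convex hull A) = convex hull ((\<lambda>x. a + g x) ` A)"
proof -
  have "(\<lambda>x. a + g x) ` B = (+) a ` g ` B" for B by (simp add: image_image)
  then show ?thesis by (simp only: convex_hull_linear_image[OF assms] convex_hull_translation)
qed

lemma isometry_hull:
  fixes f :: "'a::real_inner \<Rightarrow> 'a"
  assumes "\<And>x y. dist (f x) (f y) = dist x y" shows "f ` (convex hull A) = convex hull (f ` A)"
proof -
  have "linear (\<lambda>x. f x - f 0)" using assms by (intro isometry_linear) (auto simp: dist_norm)
  then show ?thesis using convex_hull_affine_image[of "\<lambda>x. f x - f 0" "f 0" A] by simp
qed

lemma isometry_inner:
  fixes f :: "'a::real_inner \<Rightarrow> 'b::real_inner"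
  assumes "\<And>x y. dist (f x) (f y) = dist x y"
  shows "(f x - f z) \<bullet> (f y - f z) = (x - z) \<bullet> (y - z)"
proof -
  have "(f x - f z) \<bullet> (f y - f z) = ((dist (f x) (f z))\<^sup>2 + (dist (f y) (f z))\<^sup>2 - (dist (f x) (f y))\<^sup>2) / 2"
    by (simp add: dist_norm power2_norm_eq_inner inner_diff inner_commute)
  also have "\<dots> = (x - z) \<bullet> (y - z)"
    unfolding assms by (simp add: dist_norm power2_norm_eq_inner inner_diff inner_commute)
  finally show ?thesis .
qed

lemma isometry_angle:
  assumes "\<And>x y. dist (f x) (f y) = dist x y" shows "angle (f P) (f Q) (f R) = angle P Q R"
  unfolding angle_def isometry_inner[OF assms] by (simp add: assms flip: dist_norm)

lemma isometry_collinear: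
  fixes f :: "'a::euclidean_space \<Rightarrow> 'a" and w :: "3 \<Rightarrow> 'a"
  assumes "\<And>x y. dist (f x) (f y) = dist x y"
  shows "collinear (range (f \<circ> w)) \<longleftrightarrow> collinear (range w)"
  unfolding collinear_inner comp_apply isometry_inner[OF assms] by (simp add: assms flip: dist_norm)

text \<open>Recovers the vertices of a tile, which is given only as a set of points.\<close>

lemma extreme_point_triangle:
  fixes w :: "3 \<Rightarrow> 'a::euclidean_space"
  assumes "\<not> collinear (range w)" shows "x extreme_point_of (convex hull (range w)) \<longleftrightarrow> x \<in> range w"
proof (rule extreme_point_of_convex_hull_affine_independent)
  have "\<not> collinear {w 1, w (1 + 1), w (1 + 2)}" using assms by (simp add: range_three[of w 1])
  then have "\<not> affine_dependent {w 1, w (1 + 1), w (1 + 2)}"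
    using collinear_3_eq_affine_dependent[of "w 1" "w (1 + 1)" "w (1 + 2)"] by blast
  then show "\<not> affine_dependent (range w)" by (simp add: range_three[of w 1])
qed

text \<open>The permutation \<open>l\<close> reorders the corners of the prototile so that the copy
  is counterclockwise under \<open>emb b\<close>; it will serve as the labelling of the
  tile.\<close>

lemma tile_model:
  fixes w :: "3 \<Rightarrow> real^2"
  assumes "\<not> collinear (range w)" "congruent_sets (convex hull (range w)) T"
  obtains v l where "bij l" "ccw (emb b \<circ> v)" "T = convex hull (range v)" "\<not> collinear (range v)"
    "\<And>i. ang (emb b \<circ> v) i = vangle w (l i)"
    "\<And>i. dist (v (i + 1)) (v (i + 2)) = dist (w (l i + 1)) (w (l i + 2))"
proof -
  obtain f where f: "\<And>x y. dist (f x) (f y) = dist x y" and T: "f ` (convex hull (range w)) = T"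
    using assms(2) by (auto simp: congruent_sets_def)
  have nc: "\<not> collinear (range (f \<circ> w))" using assms(1) isometry_collinear[OF f] by blast
  then obtain l where l: "bij l" "ccw (emb b \<circ> (f \<circ> w) \<circ> l)" by (rule ex_ccw_perm)
  let ?v = "f \<circ> w \<circ> l"
  have r: "range ?v = range (f \<circ> w)" using l(1) by (metis bij_is_surj fun.set_map)
  have c: "ccw (emb b \<circ> ?v)" using l(2) by (simp add: comp_assoc)
  show thesis
  proof (rule that[OF l(1) c])
    show "T = convex hull (range ?v)" unfolding r T[symmetric] isometry_hull[OF f] by (simp add: image_comp)
    show "\<not> collinear (range ?v)" unfolding r by (rule nc)
    show "ang (emb b \<circ> ?v) i = vangle w (l i)" for i
      unfolding ang_kap[OF c] vangle_perm[OF l(1)] by (simp add: vangle_def isometry_angle[OF f])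
    show "dist (?v (i + 1)) (?v (i + 2)) = dist (w (l i + 1)) (w (l i + 2))" for i
      by (simp add: f dist_perm[OF l(1)])
  qed
qed


text \<open>Equal angles give, by the sine rule, equal quotients of complex edge vectors, so a
  complex affine map matches the vertices.\<close>

lemma ccw_similar:
  assumes "ccw v" "ccw v'" "\<And>i. ang v i = ang v' i"
  obtains c m where "c \<noteq> 0" "\<And>i. v' i = m + c * v i"
proof -
  define c where "c = (v' 2 - v' 1) / (v 2 - v 1)"
  have nz: "v 2 - v 1 \<noteq> 0" "v' 2 - v' 1 \<noteq> 0"
    using ccw_distinct(1)[OF assms(1), of 1] ccw_distinct(1)[OF assms(2), of 1] by auto
  have ratio: "dist (v 1) (v 3) / dist (v 1) (v 2) = sin (ang v 2) / sin (ang v 3)" if "ccw v" for v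
  proof -
    have s: "sin (ang v i) > 0" for i using ang_bounds[OF that, of i] by (intro sin_gt_zero) auto
    have "dist (v 2) (v 1) \<noteq> 0" "dist (v 2) (v 3) \<noteq> 0"
      using ccw_distinct[OF that, of 2] by auto
    moreover have "dist (v 2) (v 3) * dist (v 2) (v 1) * sin (ang v 2) = dist (v 3) (v 1) * dist (v 3) (v 2) * sin (ang v 3)"
      using area_sine[OF that, of 2] area_sine[OF that, of 3] by simp
    ultimately show ?thesis using s[of 2] s[of 3] by (simp add: field_simps dist_commute)
  qed
  have "v 3 - v 1 = of_real (dist (v 1) (v 3) / dist (v 1) (v 2)) * cis (ang v 1) * (v 2 - v 1)"
    "v' 3 - v' 1 = of_real (dist (v' 1) (v' 3) / dist (v' 1) (v' 2)) * cis (ang v' 1) * (v' 2 - v' 1)"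
    using edge_rotation[OF assms(1), of 1] edge_rotation[OF assms(2), of 1] by simp_all
  then have "(v' 3 - v' 1) * (v 2 - v 1) = (v 3 - v 1) * (v' 2 - v' 1)"
    unfolding ratio[OF assms(1)] ratio[OF assms(2)] by (simp add: assms(3))
  then have 3: "v' 3 - v' 1 = c * (v 3 - v 1)" using nz by (simp add: c_def field_simps)
  have 2: "v' 2 - v' 1 = c * (v 2 - v 1)" using nz by (simp add: c_def)
  show thesis
  proof
    show "c \<noteq> 0" using nz by (simp add: c_def)
    show "v' i = (v' 1 - c * v 1) + c * v i" for i
      using exhaust_3[of i] 2 3 by (auto simp: algebra_simps)
  qed
qed

text \<open>Each triangle is made counterclockwise by its own reflection, which covers mirror images
  as well.\<close>

lemma similar_of_angles:
  assumes "\<not> collinear (range w)" "\<not> collinear (range w')" "\<And>i. vangle w i = vangle w' i"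
  shows "similar (convex hull (range w)) (convex hull (range w'))"
proof -
  obtain b where b: "ccw (emb b \<circ> w)" using ex_ccw_reflection[OF assms(1)] .
  obtain b' where b': "ccw (emb b' \<circ> w')" using ex_ccw_reflection[OF assms(2)] .
  obtain c m where c: "c \<noteq> 0" and e: "\<And>i. (emb b' \<circ> w') i = m + c * (emb b \<circ> w) i"
    by (rule ccw_similar[OF b b']) (simp_all add: ang_kap[OF b] ang_kap[OF b'] assms(3))
  define f where "f = inv_into UNIV (emb b') \<circ> (\<lambda>z. m + c * z) \<circ> emb b"
  have kf: "emb b' (f x) = m + c * emb b x" for x by (simp add: f_def surj_f_inv_f[OF emb_surj])
  have d: "dist (f x) (f y) = cmod c * dist x y" for x y
  proof -
    have "dist (f x) (f y) = cmod (c * (emb b x - emb b y))"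
      unfolding emb_dist[of b', symmetric] kf by (simp add: dist_norm algebra_simps)
    then show ?thesis by (simp add: norm_mult emb_dist flip: dist_norm)
  qed
  have w': "w' = f \<circ> w"
  proof
    fix i show "w' i = (f \<circ> w) i" using e[of i] kf[of "w i"] injD[OF emb_inj, of b' "w' i" "f (w i)"] by simp
  qed
  have lin: "linear (\<lambda>x. inv_into UNIV (emb b') (c * emb b x))"
    by (rule linearI; rule injD[OF emb_inj[of b']])
      (simp_all add: linear_add[OF emb_linear] linear_scale[OF emb_linear] surj_f_inv_f[OF emb_surj] algebra_simps)
  have f: "f = (\<lambda>x. inv_into UNIV (emb b') m + inv_into UNIV (emb b') (c * emb b x))"
  proof
    fix x show "f x = inv_into UNIV (emb b') m + inv_into UNIV (emb b') (c * emb b x)"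
      by (rule injD[OF emb_inj[of b']]) (simp only: kf linear_add[OF emb_linear] surj_f_inv_f[OF emb_surj])
  qed
  have "f ` (convex hull (range w)) = convex hull (f ` range w)"
    unfolding f by (rule convex_hull_affine_image[OF lin])
  then have "f ` (convex hull (range w)) = convex hull (range w')" by (simp add: w' image_comp)
  then show ?thesis unfolding similar_def using d c by (intro exI[of _ f] exI[of _ "cmod c"]) simp
qed

lemma emb_interior: "emb b x \<in> interior (emb b ` A) \<longleftrightarrow> x \<in> interior A"
proof -
  have "ball (emb b x) e \<subseteq> emb b ` A \<longleftrightarrow> ball x e \<subseteq> A" for e
  proof -
    have "emb b ` ball x e = ball (emb b x) e"
      using emb_surj[of b] by (auto simp: emb_dist surj_def) (metis emb_dist imageI mem_ball)
    then show ?thesis using inj_image_subset_iff[OF emb_inj] by metis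
  qed
  then show ?thesis by (simp add: mem_interior)
qed

lemma otri_interior: "otri v \<subseteq> interior (tri v)"
proof (rule interior_maximal[OF otri_subset])
  have "otri v = (\<Inter>i. {z. 0 < side v i z})" by (auto simp: otri_def)
  also have "open \<dots>" unfolding side_def crs_def
    by (intro open_INT finite ballI open_Collect_less continuous_intros)
  finally show "open (otri v)" .
qed

lemma side_zero_not_interior:
  assumes "ccw v" "side v i z = 0" shows "z \<notin> interior (tri v)"
proof
  assume "z \<in> interior (tri v)"
  then obtain e where e: "e > 0" "ball z e \<subseteq> tri v" by (auto simp: mem_interior)
  define d where "d = v (i + 1) - v i"
  have d: "cmod d > 0" using ccw_distinct[OF assms(1), of i] by (simp add: d_def)
  define t where "t = - (e / (2 * cmod d))"
  have "cmod (of_real t * (\<i> * d)) = \<bar>t\<bar> * cmod d" by (simp only: norm_mult norm_of_real norm_ii mult_1)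
  also have "\<dots> < e" using e d by (simp add: t_def)
  finally have "z + of_real t * (\<i> * d) \<in> ball z e" by (simp add: dist_norm)
  then have "side v i (z + of_real t * (\<i> * d)) \<ge> 0" using e by (auto simp: tri_def)
  then have "t * (cmod d)\<^sup>2 \<ge> 0" unfolding side_shift d_def[symmetric] by (simp add: assms(2) crs_i_times)
  moreover have "t * (cmod d)\<^sup>2 < 0" by (rule mult_neg_pos) (use e d in \<open>simp_all add: t_def\<close>)
  ultimately show False by simp
qed

lemma edge_segment:
  assumes "ccw v" "z \<in> closed_segment (v i) (v (i + 1))" shows "z \<in> tri v" "side v i z = 0"
proof -
  have "convex (tri v)" by (simp add: tri_hull[OF assms(1)])
  then show "z \<in> tri v"
    using assms(2) closed_segment_subset[OF vertex_in_tri[OF assms(1)] vertex_in_tri[OF assms(1)]] by blast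
  obtain t where "z = of_real (1 - t) * v i + of_real t * v (i + 1)"
    using assms(2) by (auto simp: closed_segment_def scaleR_conv_of_real)
  then show "side v i z = 0" by (simp only: side_comb) simp
qed


text \<open>Three tile corners are distributed over three corners of the big triangle and none of
  these is empty, so each receives one. This turns a failure of \<open>nsim\<close> into equality of
  angles up to a permutation, that is, into similarity.\<close>

lemma (in congruent_dissection) corner_labels:
  assumes one: "\<And>x. (\<Sum>i\<in>UNIV. cnt (\<Delta> i) x) = 1"
  obtains l where "bij l" "\<And>i. ang \<Delta> i = \<theta> (l i)"
proof -
  have ge: "card (corners (\<Delta> i)) \<ge> 1" for i
    using corners_nonempty[OF corner_S] fin_corners by (simp add: Suc_le_eq card_gt_0_iff)
  have "(\<Sum>i\<in>UNIV. card (corners (\<Delta> i))) = (\<Sum>x\<in>UNIV. \<Sum>i\<in>UNIV. cnt (\<Delta> i) x)"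
    unfolding card_corners by (rule sum.swap)
  then have three: "card (corners (\<Delta> i)) + card (corners (\<Delta> (i + 1))) + card (corners (\<Delta> (i + 2))) = 3" for i
    by (simp add: one sum_three[of _ i])
  have "card (corners (\<Delta> i)) = 1" for i
    using three[of i] ge[of i] ge[of "i + 1"] ge[of "i + 2"] by linarith
  then have c: "cnt (\<Delta> i) 1 + cnt (\<Delta> i) 2 + cnt (\<Delta> i) 3 = 1" for i by (simp add: card_corners sum_3)
  have "\<forall>i. \<exists>y. \<forall>x. cnt (\<Delta> i) x = (if x = y then 1 else 0)"
  proof
    fix i
    consider "cnt (\<Delta> i) 1 = 1" "cnt (\<Delta> i) 2 = 0" "cnt (\<Delta> i) 3 = 0"
      | "cnt (\<Delta> i) 1 = 0" "cnt (\<Delta> i) 2 = 1" "cnt (\<Delta> i) 3 = 0"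
      | "cnt (\<Delta> i) 1 = 0" "cnt (\<Delta> i) 2 = 0" "cnt (\<Delta> i) 3 = 1"
      using c[of i] by linarith
    then show "\<exists>y. \<forall>x. cnt (\<Delta> i) x = (if x = y then 1 else 0)"
    proof cases
      case 1 then show ?thesis by (intro exI[of _ 1]) (simp add: forall_3)
    next
      case 2 then show ?thesis by (intro exI[of _ 2]) (simp add: forall_3)
    next
      case 3 then show ?thesis by (intro exI[of _ 3]) (simp add: forall_3)
    qed
  qed
  from choice[OF this] obtain l where l: "\<And>i x. cnt (\<Delta> i) x = (if x = l i then 1 else 0)" by blast
  show thesis
  proof (rule that)
    have "inj l"
    proof (rule injI, rule ccontr)
      fix i j assume e: "l i = l j" and ne: "i \<noteq> j"
      have "(\<Sum>k\<in>{i, j}. cnt (\<Delta> k) (l i)) \<le> (\<Sum>k\<in>UNIV. cnt (\<Delta> k) (l i))" by (rule sum_mono2) auto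
      moreover have "(\<Sum>k\<in>{i, j}. cnt (\<Delta> k) (l i)) = 2" using ne e by (simp add: l)
      ultimately show False using one[of "l i"] by simp
    qed
    then show "bij l" by (simp add: bij_def finite_UNIV_inj_surj)
    show "ang \<Delta> i = \<theta> (l i)" for i
    proof -
      have "ang \<Delta> i = (\<Sum>x\<in>UNIV. (if x = l i then \<theta> x else 0))"
        unfolding angle_sum_corner[symmetric] angle_sum_cnt by (rule sum.cong) (auto simp: l)
      then show ?thesis by simp
    qed
  qed
qed

text \<open>Index 2 is the vertex \<open>B\<close>. Its single black tile gives sign 1 to both
  adjacent sides, and \<open>e\<close> is the sign of the third side, which can be read off at
  either of the other corners.\<close>

lemma (in special_dissection) colour_excess:
  fixes s :: "'t \<Rightarrow> real"
  assumes alt: "\<And>T T' p q. T \<in> I \<Longrightarrow> T' \<in> I \<Longrightarrow> (p, q) \<in> bd (vt T) \<Longrightarrow> (q, p) \<in> bd (vt T') \<Longrightarrow> s T' = - s T"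
    and sgn: "\<And>T. T \<in> I \<Longrightarrow> s T = 1 \<or> s T = - 1"
    and single: "corners (\<Delta> 2) = {(T\<^sub>0, j\<^sub>0)}" "s T\<^sub>0 = 1"
  obtains e :: real where "e = 1 \<or> e = - 1"
    "(\<Sum>T\<in>I. s T) * (\<Sum>x\<in>UNIV. sd x) = dist (\<Delta> 1) (\<Delta> 2) + dist (\<Delta> 2) (\<Delta> 3) + e * dist (\<Delta> 3) (\<Delta> 1)"
    "\<And>i. i \<noteq> 2 \<Longrightarrow> ang \<Delta> i = \<theta> 1 \<or> ang \<Delta> i = \<theta> 2 \<Longrightarrow> e = 1"
    "\<And>i. ang \<Delta> i = 2 * \<theta> 1 \<or> ang \<Delta> i = \<theta> 1 + \<theta> 2 \<Longrightarrow> e = - 1"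
proof -
  obtain c :: "3 \<Rightarrow> real" where c: "\<And>i. c i = 1 \<or> c i = - 1"
    and corner: "\<And>i. c (i + 2) + c i = 2 * (\<Sum>(T, j)\<in>corners (\<Delta> i). s T)"
    and parity: "\<And>i. c (i + 2) = c i \<longleftrightarrow> odd (card (corners (\<Delta> i)))"
    and total: "(\<Sum>T\<in>I. s T * (\<Sum>i\<in>UNIV. dist (vt T i) (vt T (i + 1)))) = (\<Sum>i\<in>UNIV. c i * dist (\<Delta> i) (\<Delta> (i + 1)))"
    by (rule side_colours[of s]) (rule alt, assumption+, rule sgn, assumption, rule odd_side, assumption+, blast)
  have "c 1 + c 2 = 2" using corner[of 2] single by simp
  then have 12: "c 1 = 1" "c 2 = 1" using c[of 1] c[of 2] by auto
  have per: "(\<Sum>i\<in>UNIV. dist (vt T i) (vt T (i + 1))) = (\<Sum>x\<in>UNIV. sd x)" if "T \<in> I" for T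
  proof -
    have "(\<Sum>i\<in>UNIV. dist (vt T i) (vt T (i + 1))) = (\<Sum>i\<in>UNIV. sd (lb T (i + 2)))"
      by (simp only: tile_side'[OF that])
    also have "\<dots> = (\<Sum>i\<in>UNIV. sd (lb T i))" by (simp add: sum_3 ac_simps)
    finally show ?thesis by (simp only: sum_lb[OF that])
  qed
  have "(\<Sum>T\<in>I. s T) * (\<Sum>x\<in>UNIV. sd x) = (\<Sum>i\<in>UNIV. c i * dist (\<Delta> i) (\<Delta> (i + 1)))"
    unfolding total[symmetric] sum_distrib_right by (rule sum.cong) (simp_all add: per)
  also have "\<dots> = dist (\<Delta> 1) (\<Delta> 2) + dist (\<Delta> 2) (\<Delta> 3) + c 3 * dist (\<Delta> 3) (\<Delta> 1)"
    by (simp add: sum_3 12)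
  finally have sum: "(\<Sum>T\<in>I. s T) * (\<Sum>x\<in>UNIV. sd x) = dist (\<Delta> 1) (\<Delta> 2) + dist (\<Delta> 2) (\<Delta> 3) + c 3 * dist (\<Delta> 3) (\<Delta> 1)" .
  have par: "c 3 = 1 \<longleftrightarrow> odd (card (corners (\<Delta> i)))" if "i \<noteq> 2" for i
    using parity[of i] 12 exhaust_3[of i] that by auto
  show thesis
  proof (rule that[OF c[of 3] sum])
    show "c 3 = 1" if "i \<noteq> 2" "ang \<Delta> i = \<theta> 1 \<or> ang \<Delta> i = \<theta> 2" for i
      using par[OF that(1)] that(2) corner_alpha_odd corner_beta_odd by blast
    show "c 3 = - 1" if "ang \<Delta> i = 2 * \<theta> 1 \<or> ang \<Delta> i = \<theta> 1 + \<theta> 2" for i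
    proof -
      have ev: "even (card (corners (\<Delta> i)))" using that corner_two_alpha_even corner_alpha_beta_even by blast
      \<comment> \<open>At \<open>B\<close> there is one tile, an odd number.\<close>
      then have "i \<noteq> 2" using single by auto
      then show ?thesis using par[of i] ev c[of 3] by simp
    qed
  qed
qed

lemma color_excess_sum:
  assumes "finite \<T>"
  shows "of_int (color_excess \<T> black) = (\<Sum>T\<in>\<T>. if black T then 1 else - 1 :: real)"
  using assms
  by (simp add: color_excess_def sum.If_cases Int_def sum_negf)

text \<open>Connects the adjacency of tiles along pieces with the topological adjacency in the
  colouring hypothesis: a point of an edge is in the triangle but not in its interior, so edges lie
  in the frontier.\<close>

lemma edges_share_segment:
  assumes "ccw (emb b \<circ> v)" "ccw (emb b \<circ> v')" "p \<noteq> q"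
    and pq: "p \<in> closed_segment (emb b (v i)) (emb b (v (i + 1)))" "q \<in> closed_segment (emb b (v i)) (emb b (v (i + 1)))"
    "p \<in> closed_segment (emb b (v' j)) (emb b (v' (j + 1)))" "q \<in> closed_segment (emb b (v' j)) (emb b (v' (j + 1)))"
  shows "share_segment (convex hull (range v)) (convex hull (range v'))"
proof -
  have front: "x \<in> frontier (convex hull (range v))"
    if c: "ccw (emb b \<circ> v)" and x: "emb b x \<in> closed_segment (emb b (v i)) (emb b (v (i + 1)))" for v i x
  proof -
    have t: "tri (emb b \<circ> v) = emb b ` (convex hull (range v))"
      by (simp add: tri_hull[OF c] convex_hull_linear_image[OF emb_linear] image_comp)
    have x': "emb b x \<in> closed_segment ((emb b \<circ> v) i) ((emb b \<circ> v) (i + 1))" using x by simp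
    have "x \<in> convex hull (range v)"
      using edge_segment(1)[OF c x'] inj_image_mem_iff[OF emb_inj] unfolding t by metis
    moreover have "x \<notin> interior (convex hull (range v))"
      using side_zero_not_interior[OF c edge_segment(2)[OF c x']] unfolding t emb_interior .
    ultimately show ?thesis by (auto simp: frontier_def intro: closure_subset[THEN subsetD])
  qed
  obtain x y where xy: "p = emb b x" "q = emb b y" using emb_surj[of b] by (metis surjD)
  have "emb b z \<in> closed_segment p q" if "z \<in> closed_segment x y" for z
    using that closed_segment_linear_image[OF emb_linear, of b x y] by (auto simp: xy)
  then have "closed_segment x y \<subseteq> frontier (convex hull (range v)) \<inter> frontier (convex hull (range v'))"
    using front[OF assms(1)] front[OF assms(2)] pq subset_closed_segment[of p q] by (meson IntI subsetI subsetD)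
  moreover have "x \<noteq> y" using assms(3) xy by blast
  ultimately show ?thesis unfolding share_segment_def by blast
qed

lemma pieces_closed_segment:
  assumes "(p, q) \<in> pieces S P Q" shows "p \<in> closed_segment P Q" "q \<in> closed_segment P Q"
proof -
  have "P + of_real t * (Q - P) \<in> closed_segment P Q" if "0 \<le> t" "t \<le> 1" for t
    using that unfolding closed_segment_def by (auto simp: scaleR_conv_of_real algebra_simps intro!: exI[of _ t])
  then show "p \<in> closed_segment P Q" "q \<in> closed_segment P Q" using assms by (auto simp: pieces_def)
qed

theorem theorem1:
  fixes U V W A B C :: "real^2"
    and a b c \<alpha> \<beta> \<gamma> X Y Z :: real
    and N :: nat and M :: int
    and \<T> :: "(real^2) set set"
    and black :: "(real^2) set \<Rightarrow> bool"
  assumes tile_nondeg: "\<not> collinear {U, V, W}"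
    and tile_angles: "\<alpha> = angle V U W" "\<beta> = angle U V W" "\<gamma> = angle U W V"
    and tile_sides: "a = dist V W" "b = dist U W" "c = dist U V"
    and angle_relation: "3 * \<alpha> + 2 * \<beta> = pi"
    and ABC_nondeg: "\<not> collinear {A, B, C}"
    and tiling: "is_tiling N \<T> (triangle_region U V W) (triangle_region A B C)"
    and not_similar: "\<not> similar (triangle_region U V W) (triangle_region A B C)"
    and one_tile_at_B: "\<exists>!S. S \<in> \<T> \<and> B extreme_point_of S"
    and side_lengths: "X = dist A B" "Z = dist B C" "Y = dist A C"
    and coloring: "alternating_coloring \<T> black"
    and black_at_B: "\<forall>S\<in>\<T>. B extreme_point_of S \<longrightarrow> black S"
    and M_def: "M = color_excess \<T> black"
  shows "(of_int M * (a + b + c) = X + Y + Z \<or> of_int M * (a + b + c) = X - Y + Z) \<and>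
    (isosceles_base_angle A B C \<alpha> \<or> isosceles_base_angle A B C \<beta> \<longrightarrow>
       of_int M * (a + b + c) = X + Y + Z) \<and>
    (has_angles A B C {#2 * \<alpha>, \<alpha>, 2 * \<beta>#} \<or>
     has_angles A B C {#2 * \<alpha>, \<beta>, \<alpha> + \<beta>#} \<or>
     isosceles_base_angle A B C (\<alpha> + \<beta>) \<longrightarrow>
       of_int M * (a + b + c) = X - Y + Z)"
proof -
  \<comment> \<open>Index 2 of \<open>D\<close> is \<open>B\<close>, so the sides with indices 1, 2,
    3 are \<open>AB\<close>, \<open>BC\<close>, \<open>CA\<close>.\<close>
  define w D :: "3 \<Rightarrow> real^2" where "w = ($) (vector [U, V, W])" and "D = ($) (vector [A, B, C])"
  have w: "w 1 = U" "w 2 = V" "w 3 = W" and D: "D 1 = A" "D 2 = B" "D 3 = C"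
    by (simp_all add: w_def D_def)
  have rw: "range w = {U, V, W}" and rD: "range D = {A, B, C}"
    using range_three[of w 1] range_three[of D 1] by (simp_all add: w D)
  have regions: "triangle_region U V W = convex hull (range w)" "triangle_region A B C = convex hull (range D)"
    by (simp_all add: triangle_region_def rw rD)
  have nc: "\<not> collinear (range w)" "\<not> collinear (range D)"
    using tile_nondeg ABC_nondeg by (simp_all add: rw rD)
  have \<theta>: "vangle w 1 = \<alpha>" "vangle w 2 = \<beta>" "vangle w 3 = \<gamma>"
    by (simp_all add: vangle_def w tile_angles angle_commute)
  define sd where "sd x = dist (w (x + 1)) (w (x + 2))" for x
  have sd: "(\<Sum>x\<in>UNIV. sd x) = a + b + c"
    by (simp add: sum_3 sd_def w tile_sides dist_commute)
  have fin: "finite \<T>" and tiles: "\<And>T. T \<in> \<T> \<Longrightarrow> congruent_sets (convex hull (range w)) T"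
    and union: "\<Union>\<T> = convex hull (range D)"
    and meet: "\<And>T T'. T \<in> \<T> \<Longrightarrow> T' \<in> \<T> \<Longrightarrow> T \<noteq> T' \<Longrightarrow> T \<inter> T' \<subseteq> frontier T \<inter> frontier T'"
    using tiling by (auto simp: is_tiling_def regions)
  obtain \<sigma> where big: "ccw (emb \<sigma> \<circ> D)" using ex_ccw_reflection[OF nc(2)] .
  let ?\<kappa> = "emb \<sigma>"
  \<comment> \<open>\<open>g\<close> consists of a counterclockwise list of the vertices of a tile
    and of their labels; one such pair is then chosen for every tile.\<close>
  define P where "P T g \<longleftrightarrow> bij (snd g) \<and> ccw (?\<kappa> \<circ> fst g) \<and> T = convex hull (range (fst g)) \<and>
    \<not> collinear (range (fst g)) \<and> (\<forall>i. ang (?\<kappa> \<circ> fst g) i = vangle w (snd g i)) \<and>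
    (\<forall>i. dist (fst g (i + 1)) (fst g (i + 2)) = sd (snd g i))" for T g
  have "\<forall>T\<in>\<T>. \<exists>g. P T g"
  proof
    fix T assume "T \<in> \<T>"
    show "\<exists>g. P T g"
    proof (rule tile_model[OF nc(1) tiles[OF \<open>T \<in> \<T>\<close>], of \<sigma>])
      fix v l assume "bij l" "ccw (?\<kappa> \<circ> v)" "T = convex hull (range v)" "\<not> collinear (range v)"
        "\<And>i. ang (?\<kappa> \<circ> v) i = vangle w (l i)"
        "\<And>i. dist (v (i + 1)) (v (i + 2)) = dist (w (l i + 1)) (w (l i + 2))"
      then show ?thesis by (intro exI[of _ "(v, l)"]) (simp add: P_def sd_def)
    qed
  qed
  from bchoice[OF this] obtain g where gP: "\<forall>T\<in>\<T>. P T (g T)" ..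
  have g: "bij (snd (g T))" "ccw (?\<kappa> \<circ> fst (g T))" "T = convex hull (range (fst (g T)))"
    "\<not> collinear (range (fst (g T)))" "ang (?\<kappa> \<circ> fst (g T)) i = vangle w (snd (g T) i)"
    "dist (fst (g T) (i + 1)) (fst (g T) (i + 2)) = sd (snd (g T) i)" if "T \<in> \<T>" for T i
    using bspec[OF gP that] unfolding P_def by blast+
  define vt where "vt T = ?\<kappa> \<circ> fst (g T)" for T
  have tri_image: "tri (?\<kappa> \<circ> v) = ?\<kappa> ` (convex hull (range v))" if "ccw (?\<kappa> \<circ> v)" for v
    by (simp add: tri_hull[OF that] convex_hull_linear_image[OF emb_linear] image_comp)
  have tri_vt: "tri (vt T) = ?\<kappa> ` T" if "T \<in> \<T>" for T
    using tri_image[OF g(2)[OF that]] g(3)[OF that] by (simp add: vt_def)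
  interpret congruent_dissection \<T> vt "?\<kappa> \<circ> D" "\<lambda>T. snd (g T)" "vangle w" sd
  proof
    show "finite \<T>" by (rule fin)
    show "ccw (vt T)" if "T \<in> \<T>" for T using g(2)[OF that] by (simp add: vt_def)
    show "ccw (?\<kappa> \<circ> D)" by (rule big)
    show "tri (?\<kappa> \<circ> D) = (\<Union>T\<in>\<T>. tri (vt T))"
      unfolding tri_image[OF big] union[symmetric] using tri_vt by auto
    show "otri (vt T) \<inter> otri (vt T') = {}" if TT: "T \<in> \<T>" "T' \<in> \<T>" "T \<noteq> T'" for T T'
    proof (rule ccontr)
      assume "otri (vt T) \<inter> otri (vt T') \<noteq> {}"
      then obtain z where "z \<in> otri (vt T)" "z \<in> otri (vt T')" by blast
      then have z: "z \<in> interior (?\<kappa> ` T)" "z \<in> interior (?\<kappa> ` T')"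
        using subsetD[OF otri_interior] tri_vt[OF TT(1)] tri_vt[OF TT(2)] by metis+
      obtain x where "z = ?\<kappa> x" using emb_surj[of \<sigma>] by (metis surjD)
      then have "x \<in> interior T" "x \<in> interior T'" using z by (simp_all add: emb_interior)
      then have "x \<in> frontier T" using meet[OF TT] interior_subset by blast
      then show False using \<open>x \<in> interior T\<close> by (simp add: frontier_def)
    qed
    show "bij (snd (g T))" if "T \<in> \<T>" for T by (rule g(1)[OF that])
    show "ang (vt T) i = vangle w (snd (g T) i)" if "T \<in> \<T>" for T i using g(5)[OF that] by (simp add: vt_def)
    show "dist (vt T (i + 1)) (vt T (i + 2)) = sd (snd (g T) i)" if "T \<in> \<T>" for T i
      using g(6)[OF that] by (simp add: vt_def emb_dist)
  qed
  have angD: "ang (?\<kappa> \<circ> D) i = vangle D i" for i by (rule ang_kap[OF big])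
  interpret special_dissection \<T> vt "?\<kappa> \<circ> D" "\<lambda>T. snd (g T)" "vangle w" sd
  proof
    show "3 * vangle w 1 + 2 * vangle w 2 = pi" using angle_relation by (simp add: \<theta>)
    show "\<not> (\<forall>x. (\<Sum>i\<in>UNIV. cnt ((?\<kappa> \<circ> D) i) x) = 1)"
    proof
      assume "\<forall>x. (\<Sum>i\<in>UNIV. cnt ((?\<kappa> \<circ> D) i) x) = 1"
      then obtain l where l: "bij l" "\<And>i. ang (?\<kappa> \<circ> D) i = vangle w (l i)" using corner_labels by blast
      have r: "range (w \<circ> l) = range w" using l(1) by (metis bij_is_surj fun.set_map)
      have "similar (convex hull (range (w \<circ> l))) (convex hull (range D))"
      proof (rule similar_of_angles)
        show "\<not> collinear (range (w \<circ> l))" unfolding r by (rule nc(1))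
        show "vangle (w \<circ> l) i = vangle D i" for i
          using l(2)[of i] unfolding vangle_perm[OF l(1)] angD by simp
      qed (rule nc(2))
      then show False using not_similar unfolding regions r by blast
    qed
  qed
  have vt_extreme: "x extreme_point_of T" if T: "T \<in> \<T>" and v: "vt T i = ?\<kappa> x" for T i x
  proof -
    have "x \<in> range (fst (g T))" using v injD[OF emb_inj[of \<sigma>]] by (auto simp: vt_def)
    then have "x extreme_point_of (convex hull (range (fst (g T))))" using extreme_point_triangle[OF g(4)[OF T]] by blast
    then show ?thesis using g(3)[OF T] by simp
  qed
  obtain T0 i0 where 0: "(T0, i0) \<in> corners ((?\<kappa> \<circ> D) 2)" using corners_nonempty[OF corner_S, of 2] by auto
  then have T0: "T0 \<in> \<T>" "vt T0 i0 = ?\<kappa> B" by (simp_all add: corners_def D)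
  have single: "corners ((?\<kappa> \<circ> D) 2) = {(T0, i0)}"
  proof -
    have "T = T0 \<and> i = i0" if "T \<in> \<T>" "vt T i = ?\<kappa> B" for T i
    proof -
      have "T = T0" using one_tile_at_B vt_extreme[OF that] vt_extreme[OF T0] that(1) T0(1) by blast
      then show ?thesis using ccw_inj[OF ccw_tile[OF T0(1)], of i i0] that T0 by simp
    qed
    then have "corners ((?\<kappa> \<circ> D) 2) \<subseteq> {(T0, i0)}" by (auto simp: corners_def D)
    then show ?thesis using 0 by blast
  qed
  define s :: "(real^2) set \<Rightarrow> real" where "s T = (if black T then 1 else - 1)" for T
  have s0: "s T0 = 1" using black_at_B T0(1) vt_extreme[OF T0] by (simp add: s_def)
  have alt: "s T' = - s T" if TT: "T \<in> \<T>" "T' \<in> \<T>" and pq: "(p, q) \<in> bd (vt T)" "(q, p) \<in> bd (vt T')" for T T' p q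
  proof -
    have "p \<noteq> q" by (rule bdD[OF pq(1) ccw_tile[OF TT(1)]]) (auto simp: piece_def)
    obtain i where i: "(p, q) \<in> pieces S (vt T i) (vt T (i + 1))" using pq(1) by (auto simp: bd_def)
    obtain j where j: "(q, p) \<in> pieces S (vt T' j) (vt T' (j + 1))" using pq(2) by (auto simp: bd_def)
    have "share_segment T T'"
      using edges_share_segment[OF g(2)[OF TT(1)] g(2)[OF TT(2)] \<open>p \<noteq> q\<close>, of i j]
        pieces_closed_segment[OF i] pieces_closed_segment[OF j] g(3)[OF TT(1)] g(3)[OF TT(2)] by (simp add: vt_def)
    \<comment> \<open>A counterclockwise triangle lies to the left of its boundary pieces, so it
      cannot carry one piece in both directions.\<close>
    moreover have "T \<noteq> T'"
    proof
      assume e: "T = T'"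
      have "crs (q - p) (\<i> * (q - p)) > 0" using \<open>p \<noteq> q\<close> by (simp add: crs_i_times)
      then have "\<forall>\<^sub>F t in at_right 0. mid p q + of_real t * (\<i> * (q - p)) \<in> otri (vt T)"
        by (rule bd_left[OF pq(1) ccw_tile[OF TT(1)]])
      then obtain t where t: "t > 0" "mid p q + of_real t * (\<i> * (q - p)) \<in> otri (vt T)" by (rule ex_right)
      then have "mid q p + of_real t * (\<i> * (q - p)) \<in> tri (vt T')" using otri_subset e by (auto simp: mid_sym[of q p])
      then have "crs (p - q) (\<i> * (q - p)) \<ge> 0" by (rule bd_in_left[OF pq(2) ccw_tile[OF TT(2)] _ t(1)])
      moreover have "crs (p - q) (\<i> * (q - p)) = - crs (q - p) (\<i> * (q - p))" by (simp add: crs_def algebra_simps)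
      ultimately show False using \<open>crs (q - p) (\<i> * (q - p)) > 0\<close> by simp
    qed
    ultimately have "black T \<noteq> black T'" using coloring TT by (auto simp: alternating_coloring_def)
    then show ?thesis by (simp add: s_def)
  qed
  have sgn: "s T = 1 \<or> s T = - 1" if "T \<in> \<T>" for T by (simp add: s_def)
  obtain e :: real where e: "e = 1 \<or> e = - 1"
    and total: "(\<Sum>T\<in>\<T>. s T) * (\<Sum>x\<in>UNIV. sd x) = dist ((?\<kappa> \<circ> D) 1) ((?\<kappa> \<circ> D) 2) + dist ((?\<kappa> \<circ> D) 2) ((?\<kappa> \<circ> D) 3) + e * dist ((?\<kappa> \<circ> D) 3) ((?\<kappa> \<circ> D) 1)"
    and plus: "\<And>i. i \<noteq> 2 \<Longrightarrow> ang (?\<kappa> \<circ> D) i = vangle w 1 \<or> ang (?\<kappa> \<circ> D) i = vangle w 2 \<Longrightarrow> e = 1"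
    and minus: "\<And>i. ang (?\<kappa> \<circ> D) i = 2 * vangle w 1 \<or> ang (?\<kappa> \<circ> D) i = vangle w 1 + vangle w 2 \<Longrightarrow> e = - 1"
    by (rule colour_excess[of s, OF _ _ single s0]) (rule alt, assumption+, rule sgn, assumption, blast)
  have angles: "angle B A C = vangle D 1" "angle A B C = vangle D 2" "angle A C B = vangle D 3"
    "angle C A B = vangle D 1" "angle C B A = vangle D 2" "angle B C A = vangle D 3"
    by (simp_all add: vangle_def D angle_commute)
  have M: "of_int M * (a + b + c) = X + e * Y + Z"
  proof -
    have "of_int M = (\<Sum>T\<in>\<T>. s T)" unfolding M_def color_excess_sum[OF fin] by (simp add: s_def)
    then show ?thesis using total by (simp add: sd emb_dist D side_lengths dist_commute)
  qed
  \<comment> \<open>At least one of the two base corners is different from \<open>B\<close>.\<close>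
  have "e = 1" if "isosceles_base_angle A B C \<alpha> \<or> isosceles_base_angle A B C \<beta>"
    using that plus[of 1] plus[of 3] by (auto simp: isosceles_base_angle_def angD \<theta> angles)
  moreover have "e = - 1" if "has_angles A B C {#2 * \<alpha>, \<alpha>, 2 * \<beta>#} \<or> has_angles A B C {#2 * \<alpha>, \<beta>, \<alpha> + \<beta>#} \<or>
     isosceles_base_angle A B C (\<alpha> + \<beta>)"
  proof -
    \<comment> \<open>A single corner with angle 2 \<alpha> or \<alpha> + \<beta> suffices, wherever
      it is.\<close>
    have "\<exists>i. vangle D i = 2 * \<alpha>" if "{#vangle D 1, vangle D 2, vangle D 3#} = add_mset (2 * \<alpha>) K" for K
    proof -
      have "2 * \<alpha> \<in># {#vangle D 1, vangle D 2, vangle D 3#}" unfolding that by simp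
      then show ?thesis by auto
    qed
    then have "\<exists>i. vangle D i = 2 * \<alpha> \<or> vangle D i = \<alpha> + \<beta>"
      using that by (auto simp: has_angles_def isosceles_base_angle_def angles)
    then show ?thesis using minus by (auto simp: angD \<theta>)
  qed
  ultimately show ?thesis using e M by auto
qed

end
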